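(* Consider a kernel-based spatial random graph as in the context with parameters $\alpha\in(1,\infty]$, $\tau\in(2,\infty]$, $\sigma\ge0$ and $d\in\mathbb{N}$. With $$\zeta_\star:=\lim_{k\to\infty}\frac{\log\mathbb{E}\big[\big|\{u\in\Lambda_k:\ u\searrow\Lambda_k^{\complement}\}\big|\big]}{\log k},\qquad \zeta_{\mathrm{long}}:=\lim_{k\to\infty}\Big(0\vee\frac{\log\mathbb{E}\big[\big|\{u\in\Lambda_{k/2}:\ u\searrow\Lambda_k^{\complement}\}\big|\big]}{\log k}\Big),$$ it holds that $$\zeta_\star=\max(\zeta_{\mathrm{long}},\zeta_{\mathrm{short}})\qquad\text{and}\qquad\zeta_{\mathrm{long}}=\max(\zeta_{\mathrm{ll}},\zeta_{\mathrm{hl}},\zeta_{\mathrm{hh}},0),$$ where for models with threshold profiles ($\alpha=\infty$) and/or lighter-tailed vertex marks ($\tau=\infty$) one takes the corresponding limits in the formulas for $\zeta_{\mathrm{ll}},\zeta_{\mathrm{hl}},\zeta_{\mathrm{hh}}$.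
   Context: Model. The vertex set $V$ is either $\mathbb{Z}^d$ or a unit-intensity homogeneous Poisson point process on $\mathbb{R}^d$. Each vertex $u$ at location $x_u$ has an i.i.d. mark $w_u\ge1$, with $\mathbb{P}(W\ge w)=w^{-(\tau-1)}$, $w\ge1$, if $\tau<\infty$, and $w_u\equiv1$ if $\tau=\infty$. Let $\beta>0$, $p\in(0,1]$. The kernel $\kappa$ is either $\kappa_\sigma(w_1,w_2)=(w_1\vee w_2)(w_1\wedge w_2)^\sigma$ with $\sigma\ge0$, or $\kappa_{\mathrm{sum}}(w_1,w_2)=(w_1^{1/d}+w_2^{1/d})^d$, in which case one sets $\sigma:=0$. Conditionally on all locations and marks, each pair $\{u,v\}$ is independently an edge with probability $p\,\varrho\big(\beta\kappa(w_u,w_v)/\|x_u-x_v\|^d\big)$, where $\varrho(s)=(1\wedge s)^\alpha$ if $\alpha<\infty$ and $\varrho(s)=\mathbf{1}\{s\ge1\}$ if $\alpha=\infty$. If $V=\mathbb{Z}^d$ it is assumed that $p\wedge\beta<1$. Notation. $\Lambda_k:=[-k^{1/d}/2,k^{1/d}/2]^d$, $\Lambda_k^{\complement}:=\mathbb{R}^d\setminus\Lambda_k$. For a vertex $u\in\Lambda_k$, $u\searrow\Lambda_k^{\complement}$ means that $u$ has an edge to some vertex $v$ located in $\Lambda_k^{\complement}$ with $w_v\le w_u$. Convention: $\log 0=-\infty$. Exponents. $\zeta_{\mathrm{ll}}:=2-\alpha$; $\zeta_{\mathrm{hl}}:=(\tau-1)/\alpha-(\tau-2)$; $\zeta_{\mathrm{hh}}:=\frac{\sigma+2-\tau}{\sigma+1-(\tau-1)/\alpha}$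 if $\tau\le\sigma+2$ and $\alpha<\infty$, and $\zeta_{\mathrm{hh}}:=\frac{\sigma+2-\tau}{\sigma+1}$ if $\tau>\sigma+2$ or $\alpha=\infty$; $\zeta_{\mathrm{short}}:=(d-1)/d$. If $\alpha=\infty$ or $\tau=\infty$ the corresponding limits are taken (so $\zeta_{\mathrm{ll}}=-\infty$ and $\zeta_{\mathrm{hl}}=-(\tau-2)$ if $\alpha=\infty$; $\zeta_{\mathrm{hl}}=\zeta_{\mathrm{hh}}=-\infty$ if $\tau=\infty$).
   Formalization: The identity for ζ_⋆ is not claimed when V=Z^d, α=τ=∞ and βκ(1,1)<1: there the graph a.s. has no edges, so ζ_⋆=−∞ while max(ζ_long,ζ_short)=(d−1)/d, and the claim as stated is false; the formula for ζ_long is still proved in that case. *)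

theory Defs
  imports "HOL-Probability.Probability"
begin

section \<open>Parameters of the model\<close>

datatype vertex_model = Lattice | Poisson

datatype kernel = Kernel_sigma real | Kernel_sum

fun sigma_of :: "kernel \<Rightarrow> real" where
  "sigma_of (Kernel_sigma \<sigma>) = \<sigma>"
| "sigma_of Kernel_sum = 0"

text \<open>The argument \<open>d\<close> is the dimension; only the sum kernel depends on it.\<close>

fun kernel_val :: "nat \<Rightarrow> kernel \<Rightarrow> real \<Rightarrow> real \<Rightarrow> real" where
  "kernel_val d (Kernel_sigma \<sigma>) w1 w2 = max w1 w2 * min w1 w2 powr \<sigma>"
| "kernel_val d Kernel_sum w1 w2 = (w1 powr (1 / real d) + w2 powr (1 / real d)) ^ d"

definition profile :: "ereal \<Rightarrow> real \<Rightarrow> real" where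
  "profile \<alpha> s = (if \<alpha> = \<infinity> then (if s \<ge> 1 then 1 else 0) else min 1 s powr real_of_ereal \<alpha>)"

text \<open>For \<open>x = y\<close> division by zero yields the value \<open>0\<close>. This concerns only distinct
  vertices at the same location, which almost surely do not exist.\<close>

definition edge_prob ::
  "kernel \<Rightarrow> ereal \<Rightarrow> real \<Rightarrow> real \<Rightarrow> real^'d \<Rightarrow> real^'d \<Rightarrow> real \<Rightarrow> real \<Rightarrow> real" where
  "edge_prob \<kappa> \<alpha> \<beta> p x y w1 w2 =
     p * profile \<alpha> (\<beta> * kernel_val CARD('d) \<kappa> w1 w2 / norm (x - y) ^ CARD('d))"

section \<open>The random graph\<close>

text \<open>Both vertex sets are (almost surely) countably infinite, so vertices are enumerated by
  \<open>nat\<close>: vertex \<open>i\<close> has location \<open>X i\<close> and mark \<open>W i\<close>, and \<open>E i j\<close> is the event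
  that \<open>{i, j}\<close> is an edge.\<close>

definition lattice_points :: "(nat \<Rightarrow> 'w \<Rightarrow> real^'d) \<Rightarrow> 'w measure \<Rightarrow> bool" where
  "lattice_points X M \<longleftrightarrow>
     (\<exists>z. bij_betw z UNIV {x :: real^'d. \<forall>a. x $ a \<in> \<int>} \<and> (\<forall>i. \<forall>\<omega>\<in>space M. X i \<omega> = z i))"

text \<open>The atoms of a unit-intensity homogeneous Poisson point process. Sets of Lebesgue measure
  zero need no clause of their own, being contained in sets of arbitrarily small positive measure.
  Simplicity of the process (no repeated atoms) follows, since \<open>card\<close> counts indices, that is,
  atoms with multiplicity.\<close>

definition poisson_points :: "(nat \<Rightarrow> 'w \<Rightarrow> real^'d) \<Rightarrow> 'w measure \<Rightarrow> bool" where
  "poisson_points X M \<longleftrightarrow>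
     (\<forall>A\<in>sets borel. emeasure lborel A < \<infinity> \<longrightarrow> (AE \<omega> in M. finite {i. X i \<omega> \<in> A})) \<and>
     (\<forall>A\<in>sets borel. 0 < emeasure lborel A \<and> emeasure lborel A < \<infinity> \<longrightarrow>
        distr M (count_space UNIV) (\<lambda>\<omega>. card {i. X i \<omega> \<in> A})
          = measure_pmf (poisson_pmf (measure lborel A))) \<and>
     (\<forall>(A :: nat \<Rightarrow> (real^'d) set) n.
        (\<forall>m<n. A m \<in> sets borel \<and> emeasure lborel (A m) < \<infinity>) \<and> disjoint_family_on A {..<n} \<longrightarrow>
        prob_space.indep_vars M (\<lambda>_. count_space UNIV) (\<lambda>m \<omega>. card {i. X i \<omega> \<in> A m}) {..<n})"

text \<open>The sigma-algebra generated by all locations and marks.\<close>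

definition vertex_algebra ::
  "'w measure \<Rightarrow> (nat \<Rightarrow> 'w \<Rightarrow> real^'d) \<Rightarrow> (nat \<Rightarrow> 'w \<Rightarrow> real) \<Rightarrow> 'w measure" where
  "vertex_algebra M X W =
     vimage_algebra (space M) (\<lambda>\<omega>. (\<lambda>i. X i \<omega>, \<lambda>i. W i \<omega>))
       ((\<Pi>\<^sub>M i\<in>UNIV. borel) \<Otimes>\<^sub>M (\<Pi>\<^sub>M i\<in>UNIV. borel))"

text \<open>In \<open>edges_cond\<close>, the unordered pairs \<open>{i, j}\<close> are represented by \<open>i < j\<close>. The
  factorisation of the conditional probability that all pairs of a finite set \<open>P\<close> are edges says
  that, given locations and marks, the edges are independent with the prescribed probabilities.\<close>

locale ksrg = prob_space M for M :: "'w measure" +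
  fixes V :: vertex_model and \<kappa> :: kernel and \<alpha> \<tau> :: ereal and \<beta> p :: real
    and X :: "nat \<Rightarrow> 'w \<Rightarrow> real^'d"
    and W :: "nat \<Rightarrow> 'w \<Rightarrow> real"
    and E :: "nat \<Rightarrow> nat \<Rightarrow> 'w \<Rightarrow> bool"
  assumes beta_pos: "\<beta> > 0"
    and p_pos: "p > 0" and p_le_1: "p \<le> 1"
    and sigma_nonneg: "sigma_of \<kappa> \<ge> 0"
    and lattice_param: "V = Lattice \<Longrightarrow> min p \<beta> < 1"
    and X_measurable: "\<And>i. X i \<in> borel_measurable M"
    and X_lattice: "V = Lattice \<Longrightarrow> lattice_points X M"
    and X_poisson: "V = Poisson \<Longrightarrow> poisson_points X M"
    and W_indep: "indep_vars (\<lambda>_. borel) W UNIV"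
    and W_pareto: "\<And>i w. \<tau> < \<infinity> \<Longrightarrow> w \<ge> 1 \<Longrightarrow>
          prob {\<omega> \<in> space M. W i \<omega> \<ge> w} = w powr (- (real_of_ereal \<tau> - 1))"
    and W_const: "\<And>i. \<tau> = \<infinity> \<Longrightarrow> AE \<omega> in M. W i \<omega> = 1"
    and X_W_indep: "indep_set
          (sets (vimage_algebra (space M) (\<lambda>\<omega> i. X i \<omega>) (\<Pi>\<^sub>M i\<in>UNIV. borel)))
          (sets (vimage_algebra (space M) (\<lambda>\<omega> i. W i \<omega>) (\<Pi>\<^sub>M i\<in>UNIV. borel)))"
    and E_measurable: "\<And>i j. {\<omega> \<in> space M. E i j \<omega>} \<in> events"
    and E_sym: "\<And>i j \<omega>. E i j \<omega> \<longleftrightarrow> E j i \<omega>"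
    and E_irrefl: "\<And>i \<omega>. \<not> E i i \<omega>"
    and edges_cond: "\<And>P. finite P \<Longrightarrow> P \<subseteq> {(i, j). i < j} \<Longrightarrow>
          AE \<omega> in M. real_cond_exp M (vertex_algebra M X W)
              (indicator {\<omega> \<in> space M. \<forall>(i, j)\<in>P. E i j \<omega>}) \<omega>
            = (\<Prod>(i, j)\<in>P. edge_prob \<kappa> \<alpha> \<beta> p (X i \<omega>) (X j \<omega>) (W i \<omega>) (W j \<omega>))"

section \<open>Downward edges leaving a box\<close>

text \<open>The box of volume \<open>k\<close>, written \<open>\<Lambda>\<^sub>k\<close>.\<close>

definition vol_box :: "real \<Rightarrow> (real^'d) set" where
  "vol_box k = {x. \<forall>a. \<bar>x $ a\<bar> \<le> k powr (1 / real CARD('d)) / 2}"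

definition down_edge_out ::
  "(nat \<Rightarrow> 'w \<Rightarrow> real^'d) \<Rightarrow> (nat \<Rightarrow> 'w \<Rightarrow> real) \<Rightarrow> (nat \<Rightarrow> nat \<Rightarrow> 'w \<Rightarrow> bool)
     \<Rightarrow> real \<Rightarrow> 'w \<Rightarrow> nat \<Rightarrow> bool" where
  "down_edge_out X W E k \<omega> i \<longleftrightarrow> (\<exists>j. E i j \<omega> \<and> X j \<omega> \<notin> vol_box k \<and> W j \<omega> \<le> W i \<omega>)"

text \<open>Expected number of vertices in \<open>\<Lambda>\<^sub>l\<close> with a downward edge leaving \<open>\<Lambda>\<^sub>k\<close>.\<close>

definition expected_down_out ::
  "'w measure \<Rightarrow> (nat \<Rightarrow> 'w \<Rightarrow> real^'d) \<Rightarrow> (nat \<Rightarrow> 'w \<Rightarrow> real) \<Rightarrow> (nat \<Rightarrow> nat \<Rightarrow> 'w \<Rightarrow> bool)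
     \<Rightarrow> real \<Rightarrow> real \<Rightarrow> ennreal" where
  "expected_down_out M X W E l k =
     (\<integral>\<^sup>+ \<omega>. emeasure (count_space UNIV) {i. X i \<omega> \<in> vol_box l \<and> down_edge_out X W E k \<omega> i} \<partial>M)"

definition ln_ext :: "ennreal \<Rightarrow> ereal" where
  "ln_ext x = (if x = 0 then -\<infinity> else if x = \<infinity> then \<infinity> else ereal (ln (enn2real x)))"

definition star_ratio ::
  "'w measure \<Rightarrow> (nat \<Rightarrow> 'w \<Rightarrow> real^'d) \<Rightarrow> (nat \<Rightarrow> 'w \<Rightarrow> real) \<Rightarrow> (nat \<Rightarrow> nat \<Rightarrow> 'w \<Rightarrow> bool)
     \<Rightarrow> real \<Rightarrow> ereal" where
  "star_ratio M X W E k = ln_ext (expected_down_out M X W E k k) / ereal (ln k)"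

definition long_ratio ::
  "'w measure \<Rightarrow> (nat \<Rightarrow> 'w \<Rightarrow> real^'d) \<Rightarrow> (nat \<Rightarrow> 'w \<Rightarrow> real) \<Rightarrow> (nat \<Rightarrow> nat \<Rightarrow> 'w \<Rightarrow> bool)
     \<Rightarrow> real \<Rightarrow> ereal" where
  "long_ratio M X W E k = max 0 (ln_ext (expected_down_out M X W E (k / 2) k) / ereal (ln k))"

text \<open>\<open>Lim\<close> is meaningful only when the limit exists, which has to be stated separately.\<close>

definition zeta_star ::
  "'w measure \<Rightarrow> (nat \<Rightarrow> 'w \<Rightarrow> real^'d) \<Rightarrow> (nat \<Rightarrow> 'w \<Rightarrow> real) \<Rightarrow> (nat \<Rightarrow> nat \<Rightarrow> 'w \<Rightarrow> bool) \<Rightarrow> ereal" where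
  "zeta_star M X W E = Lim at_top (star_ratio M X W E)"

definition zeta_long ::
  "'w measure \<Rightarrow> (nat \<Rightarrow> 'w \<Rightarrow> real^'d) \<Rightarrow> (nat \<Rightarrow> 'w \<Rightarrow> real) \<Rightarrow> (nat \<Rightarrow> nat \<Rightarrow> 'w \<Rightarrow> bool) \<Rightarrow> ereal" where
  "zeta_long M X W E = Lim at_top (long_ratio M X W E)"

section \<open>Exponents\<close>

definition zeta_ll :: "ereal \<Rightarrow> ereal" where
  "zeta_ll \<alpha> = 2 - \<alpha>"

text \<open>The case \<open>\<tau> = \<infinity>\<close> is separate because \<open>\<infinity> - \<infinity>\<close> and \<open>\<infinity> / \<infinity>\<close> on \<open>ereal\<close> do not
  give the limits \<open>\<tau> \<rightarrow> \<infinity>\<close>. For \<open>\<alpha> = \<infinity>\<close> and finite \<open>\<tau>\<close>, \<open>(\<tau> - 1) / \<alpha> = 0\<close>.\<close>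

definition zeta_hl :: "ereal \<Rightarrow> ereal \<Rightarrow> ereal" where
  "zeta_hl \<alpha> \<tau> = (if \<tau> = \<infinity> then -\<infinity> else (\<tau> - 1) / \<alpha> - (\<tau> - 2))"

definition zeta_hh :: "ereal \<Rightarrow> ereal \<Rightarrow> real \<Rightarrow> ereal" where
  "zeta_hh \<alpha> \<tau> \<sigma> =
     (if \<tau> = \<infinity> then -\<infinity>
      else if \<tau> \<le> ereal (\<sigma> + 2) \<and> \<alpha> < \<infinity>
      then (ereal (\<sigma> + 2) - \<tau>) / (ereal (\<sigma> + 1) - (\<tau> - 1) / \<alpha>)
      else (ereal (\<sigma> + 2) - \<tau>) / ereal (\<sigma> + 1))"

definition zeta_short :: "nat \<Rightarrow> ereal" where
  "zeta_short d = ereal ((real d - 1) / real d)"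

text \<open>On the lattice with threshold profile and constant marks, \<open>\<beta> \<kappa>(1, 1) < 1\<close> means that
  no pair of vertices, all being at distance at least one, can be connected: the graph almost surely
  has no edges.\<close>

definition edgeless :: "nat \<Rightarrow> vertex_model \<Rightarrow> kernel \<Rightarrow> ereal \<Rightarrow> ereal \<Rightarrow> real \<Rightarrow> bool" where
  "edgeless d V \<kappa> \<alpha> \<tau> \<beta> \<longleftrightarrow>
     V = Lattice \<and> \<alpha> = \<infinity> \<and> \<tau> = \<infinity> \<and> \<beta> * kernel_val d \<kappa> 1 1 < 1"

end

theory Submission
  imports Defs "HOL-Real_Asymp.Real_Asymp"
begin

text \<open>
  Both vertex models enter only through their intensity, which is comparable to Lebesgue measure on
  boxes of side at least one, and through the independence of the numbers of vertices in disjoint sets.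

  Upper bound: a vertex either has mark above a threshold \<open>t\<close>, or it has a downward edge while its
  mark is at most \<open>t\<close>; the latter is controlled by the expected number of such edges. Since
  \<open>W\<^sub>j \<le> W\<^sub>i \<le> t\<close>, one may insert factors \<open>(W\<^sub>i / W\<^sub>j)\<^sup>\<mu> (t / W\<^sub>i)\<^sup>s \<ge> 1\<close>
  to make both mark moments finite. With \<open>t\<close> a suitable power of the distance \<open>r\<close> to be bridged, this
  yields a probability of order \<open>r\<close> to the power \<open>- d (1 - \<eta>)\<close> for every \<open>\<eta>\<close> above \<open>\<zeta>\<^sub>l\<^sub>l\<close>,
  \<open>\<zeta>\<^sub>h\<^sub>l\<close>, \<open>\<zeta>\<^sub>h\<^sub>h\<close> and \<open>0\<close>; summing over dyadic layers parallel to the faces of the box gives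
  \<open>\<zeta>\<^sub>\<star>\<close>.

  Lower bound: marks of orders \<open>k\<^sup>a\<close> and \<open>k\<^sup>b\<close> inside and outside the box are chosen so that the expected
  number of edges per vertex is slightly smaller than one; then, by Bonferroni, it has the same order as
  the probability that there is one. The choices are \<open>a = b = 0\<close> for \<open>\<zeta>\<^sub>l\<^sub>l\<close>, \<open>b = 0\<close> for
  \<open>\<zeta>\<^sub>h\<^sub>l\<close> and \<open>a = b\<close> for \<open>\<zeta>\<^sub>h\<^sub>h\<close>. Pairs of nearby vertices on the two sides of one
  face of the box give \<open>\<zeta>\<^sub>s\<^sub>h\<^sub>o\<^sub>r\<^sub>t\<close>.
\<close>

section \<open>Series, Poisson moments and growth exponents\<close>

text \<open>The exponents come from balancing infinite moments. After bounding an edge probability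
  by a power \<gamma> \<le> \<alpha> of its argument, the larger mark carries the power \<gamma> and
  the smaller one \<sigma> \<gamma>, and a moment is infinite once its order reaches \<tau> - 1. The
  parameter \<open>s\<close> lowers the first power at the price of a power of the threshold;
  \<open>\<mu>\<close> shifts excess power from the smaller mark to the larger one, where
  \<open>s\<close> pays for it. If neither is needed the bound yields \<open>zeta_ll\<close>, if
  only \<open>s\<close> is needed it yields \<open>zeta_hl\<close>, and if both are needed
  \<open>zeta_hh\<close>. The exact order of the counts is never determined. Upper bounds for all
  exponents strictly above the maximum and lower bounds for all exponents strictly below it suffice;
  this slack avoids borderline moments and makes the expected number of long edges per chosen vertex
  a strictly negative power of k, so that multiple edges are negligible. For \<alpha> = \<infinity>
  an edge probability cannot be made small by adjusting marks, since it jumps between 0 and p; for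
  \<open>zeta_hh\<close> the number of possible endpoints is reduced instead.\<close>

lemma ennreal_suminf_swap:
  fixes f :: "nat \<Rightarrow> nat \<Rightarrow> ennreal"
  shows "(\<Sum>i. \<Sum>j. f i j) = (\<Sum>j. \<Sum>i. f i j)"
proof -
  have "(\<Sum>i. \<Sum>j. f i j) = (\<integral>\<^sup>+i. (\<Sum>j. f i j) \<partial>count_space UNIV)"
    by (simp add: nn_integral_count_space_nat)
  also have "\<dots> = (\<Sum>j. \<integral>\<^sup>+i. f i j \<partial>count_space UNIV)"
    by (rule nn_integral_suminf) auto
  finally show ?thesis
    by (simp add: nn_integral_count_space_nat)
qed

lemma ennreal_suminf_mono:
  fixes f g :: "nat \<Rightarrow> ennreal"
  assumes "\<And>i. f i \<le> g i"
  shows "suminf f \<le> suminf g"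
  using assms by (intro suminf_le summableI) auto

lemma ennreal_suminf_add:
  fixes f g :: "nat \<Rightarrow> ennreal"
  shows "(\<Sum>i. f i + g i) = suminf f + suminf g"
  by (rule suminf_add[symmetric]) (auto intro: summableI)

lemma ennreal_suminf_upper:
  fixes f :: "nat \<Rightarrow> ennreal"
  shows "f n \<le> suminf f"
  using sum_le_suminf[of f "{n}"] by (auto intro: summableI)

lemma emeasure_count_space_eq_suminf:
  "emeasure (count_space UNIV) {i::nat. P i} = (\<Sum>i. of_bool (P i))"
proof -
  have "emeasure (count_space UNIV) {i::nat. P i} = (\<integral>\<^sup>+i. indicator {i. P i} i \<partial>count_space UNIV)"
    by (rule nn_integral_indicator[symmetric]) simp
  also have "\<dots> = (\<Sum>i. of_bool (P i))"
    by (simp only: nn_integral_count_space_nat indicator_def mem_Collect_eq)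
  finally show ?thesis .
qed

lemma suminf_of_bool_finite:
  assumes "finite {i::nat. P i}"
  shows "(\<Sum>i. of_bool (P i) :: ennreal) = of_nat (card {i. P i})"
  by (subst suminf_finite[OF assms]) (auto simp: of_bool_def sum.If_cases)

text \<open>Ordered pairs of distinct indices are counted, which produces the second factorial power
  of the count. Its expectation is the correction term in the Bonferroni bound.\<close>

lemma suminf_of_bool_distinct_pairs:
  assumes "finite {i::nat. P i}"
  shows "(\<Sum>i. \<Sum>j. of_bool (P i \<and> P j \<and> i \<noteq> j) :: ennreal)
    = of_nat (card {i. P i} * (card {i. P i} - 1))"
proof -
  let ?S = "{i. P i}"
  have *: "(\<Sum>j. of_bool (P i \<and> P j \<and> i \<noteq> j) :: ennreal) = (if P i then of_nat (card ?S - 1) else 0)" for i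
  proof (cases "P i")
    case True
    have "finite {j. P j \<and> i \<noteq> j}" using assms by (rule rev_finite_subset) auto
    from suminf_of_bool_finite[OF this] True
    have "(\<Sum>j. of_bool (P i \<and> P j \<and> i \<noteq> j) :: ennreal) = of_nat (card {j. P j \<and> i \<noteq> j})" by simp
    also have "{j. P j \<and> i \<noteq> j} = ?S - {i}" by auto
    also have "card \<dots> = card ?S - 1" using True assms by simp
    finally show ?thesis using True by simp
  qed simp
  have "(\<Sum>i. \<Sum>j. of_bool (P i \<and> P j \<and> i \<noteq> j) :: ennreal)
      = (\<Sum>i. (of_nat (card ?S - 1)) * of_bool (P i))"
    unfolding * by (intro arg_cong[where f=suminf]) (auto simp: fun_eq_iff)
  also have "\<dots> = of_nat (card ?S - 1) * of_nat (card ?S)"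
    by (simp add: suminf_of_bool_finite[OF assms])
  finally show ?thesis by (simp add: mult.commute)
qed

lemma emeasure_eq_nn_integral_of_bool:
  assumes "{\<omega> \<in> space M. P \<omega>} \<in> sets M"
  shows "emeasure M {\<omega> \<in> space M. P \<omega>} = (\<integral>\<^sup>+\<omega>. of_bool (P \<omega>) \<partial>M)"
proof -
  have "emeasure M {\<omega> \<in> space M. P \<omega>} = (\<integral>\<^sup>+\<omega>. indicator {\<omega> \<in> space M. P \<omega>} \<omega> \<partial>M)"
    by (rule nn_integral_indicator[symmetric]) fact
  also have "\<dots> = (\<integral>\<^sup>+\<omega>. of_bool (P \<omega>) \<partial>M)"
    by (rule nn_integral_cong) (simp add: indicator_def)
  finally show ?thesis .
qed

section \<open>Moments of the Poisson distribution\<close>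

lemma poisson_pmf_mean:
  assumes "0 < r"
  shows "(\<integral>\<^sup>+n. of_nat n \<partial>measure_pmf (poisson_pmf r)) = ennreal r"
proof -
  have "(\<lambda>n. r * exp (-r) * (r ^ n / fact n)) sums (r * exp (-r) * exp r)"
    using exp_converges[of r] by (intro sums_mult) (simp add: divide_inverse mult.commute)
  moreover have "r * exp (-r) * (r ^ n / fact n) = (r ^ Suc n / fact (Suc n) * exp (-r)) * real (Suc n)" for n
    by (simp del: of_nat_Suc)
  moreover have "r * exp (-r) * exp r = r"
    by (simp add: exp_minus)
  ultimately have "(\<lambda>n. (r ^ Suc n / fact (Suc n) * exp (-r)) * real (Suc n)) sums r"
    by (simp only:)
  then have "(\<lambda>n. (r ^ n / fact n * exp (-r)) * real n) sums r"
    by (subst (asm) sums_Suc_iff) simp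
  then have "(\<Sum>n. ennreal ((r ^ n / fact n * exp (-r)) * real n)) = ennreal r"
    using assms by (intro suminf_ennreal_eq) auto
  moreover have "ennreal (r ^ n / fact n * exp (-r)) * of_nat n = ennreal ((r ^ n / fact n * exp (-r)) * real n)" for n
    using assms by (subst ennreal_mult'') (simp_all add: ennreal_of_nat_eq_real_of_nat)
  ultimately show ?thesis using assms
    by (simp add: nn_integral_measure_pmf nn_integral_count_space_nat)
qed

text \<open>The terms n = 0 and n = 1 vanish, so shifting the index by two cancels n (n - 1) against
  the factorial and leaves r^2 times the exponential series.\<close>

lemma poisson_pmf_factorial_moment2:
  assumes "0 < r"
  shows "(\<integral>\<^sup>+n. of_nat (n * (n - 1)) \<partial>measure_pmf (poisson_pmf r)) = (ennreal r)\<^sup>2"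
proof -
  have "(\<lambda>n. r\<^sup>2 * exp (-r) * (r ^ n / fact n)) sums (r\<^sup>2 * exp (-r) * exp r)"
    using exp_converges[of r] by (intro sums_mult) (simp add: divide_inverse mult.commute)
  moreover have "r\<^sup>2 * exp (-r) * (r ^ n / fact n)
     = (r ^ Suc (Suc n) / fact (Suc (Suc n)) * exp (-r)) * real (Suc (Suc n) * (Suc (Suc n) - 1))" for n
  proof -
    have "fact (Suc (Suc n)) = real (Suc (Suc n) * Suc n) * fact n" by (simp add: algebra_simps)
    then show ?thesis by (simp add: power2_eq_square del: fact_Suc of_nat_mult)
  qed
  moreover have "r\<^sup>2 * exp (-r) * exp r = r\<^sup>2"
    by (simp add: exp_minus)
  ultimately have "(\<lambda>n. (r ^ Suc (Suc n) / fact (Suc (Suc n)) * exp (-r)) * real (Suc (Suc n) * (Suc (Suc n) - 1))) sums r\<^sup>2"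
    by (simp only:)
  then have "(\<lambda>n. (r ^ Suc n / fact (Suc n) * exp (-r)) * real (Suc n * (Suc n - 1))) sums r\<^sup>2"
    by (subst (asm) sums_Suc_iff) simp
  then have "(\<lambda>n. (r ^ n / fact n * exp (-r)) * real (n * (n - 1))) sums r\<^sup>2"
    by (subst (asm) sums_Suc_iff) simp
  then have "(\<Sum>n. ennreal ((r ^ n / fact n * exp (-r)) * real (n * (n - 1)))) = ennreal (r\<^sup>2)"
    using assms by (intro suminf_ennreal_eq) auto
  moreover have "ennreal (r ^ n / fact n * exp (-r)) * of_nat (n * (n - 1))
     = ennreal ((r ^ n / fact n * exp (-r)) * real (n * (n - 1)))" for n
    using assms by (subst ennreal_mult'') (simp_all add: ennreal_of_nat_eq_real_of_nat del: of_nat_mult)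
  ultimately show ?thesis using assms
    by (simp add: nn_integral_measure_pmf nn_integral_count_space_nat ennreal_power del: of_nat_mult)
qed

lemma sigma_sets_vimage_subset:
  assumes "h \<in> measurable A N"
  shows "sigma_sets (space A) {h -` S \<inter> space A |S. S \<in> sets N} \<subseteq> sets A"
  using measurable_sets[OF assms] by (intro sets.sigma_sets_subset) blast

section \<open>Lattice points in cuboids\<close>

lemma card_vec_Pi:
  fixes T :: "'n::finite \<Rightarrow> 'a set"
  assumes "\<And>i. finite (T i)"
  shows "finite {x :: 'a^'n. \<forall>i. x $ i \<in> T i}"
    and "card {x :: 'a^'n. \<forall>i. x $ i \<in> T i} = (\<Prod>i\<in>UNIV. card (T i))"
proof -
  have "bij_betw (\<lambda>f. \<chi> i. f i) (Pi\<^sub>E UNIV T) {x :: 'a^'n. \<forall>i. x $ i \<in> T i}"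
    by (rule bij_betw_byWitness[where f'="\<lambda>x i. x $ i"]) (auto simp: vec_eq_iff)
  from bij_betw_same_card[OF this] bij_betw_finite[OF this]
  show "finite {x :: 'a^'n. \<forall>i. x $ i \<in> T i}"
    and "card {x :: 'a^'n. \<forall>i. x $ i \<in> T i} = (\<Prod>i\<in>UNIV. card (T i))"
    using assms by (auto simp: card_PiE intro: finite_PiE)
qed

lemma Ints_Int_atLeastAtMost: "\<int> \<inter> {l..u::real} = of_int ` {\<lceil>l\<rceil>..\<lfloor>u\<rfloor>}"
  by (auto simp: Ints_def ceiling_le_iff le_floor_iff)

lemma
  fixes a b :: "real^'n"
  shows finite_Ints_cbox: "finite {x \<in> cbox a b. \<forall>i. x $ i \<in> \<int>}"
    and card_Ints_cbox: "card {x \<in> cbox a b. \<forall>i. x $ i \<in> \<int>} = (\<Prod>i\<in>UNIV. nat (\<lfloor>b $ i\<rfloor> - \<lceil>a $ i\<rceil> + 1))"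
proof -
  have *: "{x \<in> cbox a b. \<forall>i. x $ i \<in> \<int>} = {x. \<forall>i. x $ i \<in> \<int> \<inter> {a $ i..b $ i}}"
    by (auto simp: mem_box_cart)
  have "card (\<int> \<inter> {a $ i..b $ i}) = nat (\<lfloor>b $ i\<rfloor> - \<lceil>a $ i\<rceil> + 1)" for i
    unfolding Ints_Int_atLeastAtMost by (subst card_image) (auto simp: inj_on_def)
  then show "finite {x \<in> cbox a b. \<forall>i. x $ i \<in> \<int>}"
    and "card {x \<in> cbox a b. \<forall>i. x $ i \<in> \<int>} = (\<Prod>i\<in>UNIV. nat (\<lfloor>b $ i\<rfloor> - \<lceil>a $ i\<rceil> + 1))"
    unfolding * by (subst card_vec_Pi card_vec_Pi(1); auto simp: Ints_Int_atLeastAtMost)+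
qed

section \<open>Bounds for kernel and profile\<close>

lemma kernel_val_le:
  assumes "1 \<le> v" "v \<le> u" "0 < n"
  shows "kernel_val n \<kappa> u v \<le> 2 ^ n * u * v powr sigma_of \<kappa>"
proof (cases \<kappa>)
  case (Kernel_sigma \<sigma>)
  have "1 * (u * v powr \<sigma>) \<le> 2 ^ n * (u * v powr \<sigma>)"
    using assms by (intro mult_right_mono) auto
  then show ?thesis using assms Kernel_sigma by (simp add: max_def min_def)
next
  case Kernel_sum
  have "(u powr (1 / n) + v powr (1 / n)) ^ n \<le> (2 * u powr (1 / n)) ^ n"
    using assms powr_mono2[of "1 / real n" v u] by (intro power_mono) auto
  also have "\<dots> = 2 ^ n * u"
    using assms by (simp add: power_mult_distrib powr_powr flip: powr_realpow)
  finally show ?thesis using assms Kernel_sum by simp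
qed

text \<open>With the matching upper bound, both kernels are comparable to u times v to the power
  \<open>sigma_of \<kappa>\<close> for v \<le> u, with ratio at most 2^n. The later estimates
  therefore treat the two kernels alike.\<close>

lemma kernel_val_ge:
  assumes "1 \<le> v" "v \<le> u" "0 < n" "0 \<le> sigma_of \<kappa>"
  shows "u * v powr sigma_of \<kappa> \<le> kernel_val n \<kappa> u v"
proof (cases \<kappa>)
  case (Kernel_sigma \<sigma>)
  then show ?thesis using assms by (simp add: max_def min_def)
next
  case Kernel_sum
  have "u = (u powr (1 / n)) ^ n"
    using assms by (simp add: powr_powr flip: powr_realpow)
  also have "\<dots> \<le> (u powr (1 / n) + v powr (1 / n)) ^ n"
    using assms by (intro power_mono) auto
  finally show ?thesis using assms Kernel_sum by simp
qed

text \<open>A smaller exponent enlarges powers of numbers in [0, 1], and dropping the cap at 1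
  enlarges further. For \<alpha> = \<infinity> every \<gamma> > 0 is allowed, so the threshold
  profile is dominated by power laws of arbitrary order.\<close>

lemma profile_le_powr:
  assumes "0 < \<gamma>" "ereal \<gamma> \<le> \<alpha>" "0 \<le> s"
  shows "profile \<alpha> s \<le> s powr \<gamma>"
proof (cases "\<alpha> = \<infinity>")
  case True
  with assms show ?thesis by (auto simp: profile_def ge_one_powr_ge_zero)
next
  case False
  with assms obtain a where a: "\<alpha> = ereal a" "\<gamma> \<le> a" by (cases \<alpha>) auto
  have "min 1 s powr a \<le> min 1 s powr \<gamma>"
  proof (cases "s = 0")
    case False
    then show ?thesis using assms a by (intro powr_mono') auto
  qed (use assms a in auto)
  also have "\<dots> \<le> s powr \<gamma>" using assms by (intro powr_mono2) auto
  finally show ?thesis using a by (simp add: profile_def)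
qed

text \<open>Serves to cut an arbitrary set of locations into countably many pieces of diameter of
  order one.\<close>

lemma countable_ball_cover:
  obtains c :: "nat \<Rightarrow> 'a::{metric_space, second_countable_topology}" where "\<And>x. \<exists>n. x \<in> ball (c n) 1"
proof -
  obtain D :: "'a set" where D: "countable D" "\<And>S. open S \<Longrightarrow> S \<noteq> {} \<Longrightarrow> \<exists>d\<in>D. d \<in> S"
    using countable_dense_exists by blast
  then have "D \<noteq> {}" by force
  have "\<exists>n. x \<in> ball (from_nat_into D n) 1" for x :: 'a
  proof -
    obtain d where "d \<in> D" "d \<in> ball x 1" using D(2)[of "ball x 1"] by force
    then show ?thesis
      using from_nat_into_surj[OF D(1) \<open>d \<in> D\<close>] by (auto simp: dist_commute)
  qed
  with that show ?thesis by blast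
qed

lemma dyadic_interval:
  assumes "1 \<le> (x::real)"
  obtains n :: nat where "2 ^ n \<le> x" "x < 2 ^ Suc n"
proof
  let ?n = "nat \<lfloor>log 2 x\<rfloor>"
  have l: "0 \<le> log 2 x" using assms by simp
  have "real ?n \<le> log 2 x" "log 2 x < real (Suc ?n)" using l by linarith+
  then have "2 powr real ?n \<le> x" "x < 2 powr real (Suc ?n)"
    using assms by (simp_all only: le_log_iff log_less_iff)
  then show "2 ^ ?n \<le> x" "x < 2 ^ Suc ?n"
    by (simp_all only: powr_realpow)
qed

lemma measurable_fst_component [measurable]:
  "(\<lambda>z. fst z i) \<in> measurable ((\<Pi>\<^sub>M i\<in>UNIV. borel) \<Otimes>\<^sub>M N) borel"
  by (rule measurable_compose[OF measurable_fst measurable_component_singleton]) simp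

lemma measurable_snd_component [measurable]:
  "(\<lambda>z. snd z i) \<in> measurable (N \<Otimes>\<^sub>M (\<Pi>\<^sub>M i\<in>UNIV. borel)) borel"
  by (rule measurable_compose[OF measurable_snd measurable_component_singleton]) simp

section \<open>Choice of the truncation exponents\<close>

text \<open>The threshold will be \<open>r\<close> to the power \<open>d (1 - \<eta>) / (t - 1)\<close>, for which the mark tail is
  exactly \<open>r\<close> to the power \<open>- d (1 - \<eta>)\<close>.\<close>

lemma optimal_parameters:
  fixes \<gamma> \<sigma> t \<eta> :: real
  assumes "1 < \<gamma>" "0 \<le> \<sigma>" "2 < t" "\<eta> < 1"
    and ll: "2 - \<gamma> < \<eta>" and hl: "(1 - \<eta>) * \<gamma> < (\<gamma> - 1) * (t - 1)"
    and hh: "(1 - \<eta>) * (\<gamma> * (1 + \<sigma>) - (t - 1)) < (\<gamma> - 1) * (t - 1)"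
  obtains \<mu> s where "0 \<le> \<mu>" "0 \<le> s" "\<gamma> + \<mu> - s < t - 1" "\<sigma> * \<gamma> - \<mu> < t - 1"
    "1 - \<eta> \<le> (\<gamma> - 1) - (1 - \<eta>) / (t - 1) * s"
proof -
  \<comment> \<open>\<open>hl\<close> and \<open>hh\<close> have the same right side. Up to
    \<epsilon>, \<open>D\<close> is the power \<gamma> + \<mu> carried by the larger mark: it is
    \<gamma> if no power is shifted, and \<gamma> (1 + \<sigma>) - (t - 1) if the least necessary
    amount is.\<close>
  define D where "D = max \<gamma> (\<gamma> * (1 + \<sigma>) - (t - 1))"
  have "(1 - \<eta>) * D < (\<gamma> - 1) * (t - 1)" using hl hh by (auto simp: D_def max_def)
  \<comment> \<open>Raising \<open>D\<close> by 2 \<epsilon> turns the strict inequality into an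
    equality; one \<epsilon> is spent in \<open>\<mu>\<close> and one in \<open>s\<close>.\<close>
  define \<epsilon> where "\<epsilon> = ((\<gamma> - 1) * (t - 1) - (1 - \<eta>) * D) / (2 * (1 - \<eta>))"
  have \<epsilon>: "0 < \<epsilon>" "(1 - \<eta>) * (D + 2 * \<epsilon>) = (\<gamma> - 1) * (t - 1)"
    using \<open>(1 - \<eta>) * D < (\<gamma> - 1) * (t - 1)\<close> assms by (auto simp: \<epsilon>_def field_simps)
  \<comment> \<open>Up to \<epsilon>, \<open>\<mu>\<close> and \<open>s\<close> are the least
    nonnegative values for which both mark moments are finite.\<close>
  define \<mu> where "\<mu> = max 0 (\<sigma> * \<gamma> - (t - 1) + \<epsilon>)"
  define s where "s = max 0 (\<gamma> + \<mu> - (t - 1) + \<epsilon>)"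
  have "\<gamma> + \<mu> \<le> D + \<epsilon>" using \<epsilon> by (auto simp: D_def \<mu>_def algebra_simps max_def)
  have "1 - \<eta> \<le> (\<gamma> - 1) - (1 - \<eta>) / (t - 1) * s"
  proof (cases "s = 0")
    case True
    then show ?thesis using ll by simp
  next
    case False
    then have "s \<le> D + 2 * \<epsilon> - (t - 1)" using \<open>\<gamma> + \<mu> \<le> D + \<epsilon>\<close> by (auto simp: s_def)
    then have "(1 - \<eta>) * s \<le> (1 - \<eta>) * (D + 2 * \<epsilon>) - (1 - \<eta>) * (t - 1)"
      using assms by (simp add: mult_left_mono flip: right_diff_distrib)
    then have "(1 - \<eta>) * s \<le> (\<gamma> - 1 - (1 - \<eta>)) * (t - 1)"
      unfolding \<epsilon>(2) by (simp add: algebra_simps)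
    then have "(1 - \<eta>) / (t - 1) * s \<le> \<gamma> - 1 - (1 - \<eta>)"
      using assms by (simp add: divide_simps)
    then show ?thesis by simp
  qed
  moreover have "0 \<le> \<mu>" "0 \<le> s" "\<gamma> + \<mu> - s < t - 1" "\<sigma> * \<gamma> - \<mu> < t - 1"
    using \<epsilon> by (auto simp: \<mu>_def s_def)
  ultimately show ?thesis using that by blast
qed

text \<open>For finite \<open>\<alpha>\<close> the choice \<open>\<gamma> = \<alpha>\<close> is always optimal; for \<open>\<alpha> = \<infinity>\<close> it is \<open>\<gamma> \<rightarrow> \<infinity>\<close>.\<close>

lemma admissible_decay:
  fixes \<alpha> \<tau> :: ereal and \<eta> \<sigma> :: real
  assumes "1 < \<alpha>" "\<tau> = ereal t" "2 < t" "0 \<le> \<sigma>" "0 < \<eta>" "\<eta> < 1"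
    and ll: "zeta_ll \<alpha> < ereal \<eta>" and hl: "zeta_hl \<alpha> \<tau> < ereal \<eta>" and hh: "zeta_hh \<alpha> \<tau> \<sigma> < ereal \<eta>"
  obtains \<gamma> where "1 < \<gamma>" "ereal \<gamma> \<le> \<alpha>" "2 - \<gamma> < \<eta>" "(1 - \<eta>) * \<gamma> < (\<gamma> - 1) * (t - 1)"
    "(1 - \<eta>) * (\<gamma> * (1 + \<sigma>) - (t - 1)) < (\<gamma> - 1) * (t - 1)"
proof (cases "\<alpha> = \<infinity>")
  case False
  then obtain a where a: "\<alpha> = ereal a" "1 < a" using assms(1) by (cases \<alpha>) auto
  have "(t - 1) / a - (t - 2) < \<eta>"
    using hl a assms by (simp add: zeta_hl_def one_ereal_def)
  then have 2: "(1 - \<eta>) * a < (a - 1) * (t - 1)"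
    using a by (simp add: field_simps)
  have 3: "(1 - \<eta>) * (a * (1 + \<sigma>) - (t - 1)) < (a - 1) * (t - 1)"
  proof (cases "t \<le> \<sigma> + 2")
    case True
    \<comment> \<open>\<alpha> > 1 keeps the denominator of \<open>zeta_hh\<close> positive even at
      \<tau> = \<sigma> + 2, so multiplying by it preserves the inequality.\<close>
    have pos: "0 < \<sigma> + 1 - (t - 1) / a"
    proof -
      have "(t - 1) / a < (t - 1) / 1" using a assms by (intro divide_strict_left_mono) auto
      then show ?thesis using True by simp
    qed
    have "(\<sigma> + 2 - t) / (\<sigma> + 1 - (t - 1) / a) < \<eta>"
      using hh a assms True pos by (simp add: zeta_hh_def one_ereal_def)
    then have "\<sigma> + 2 - t < \<eta> * (\<sigma> + 1 - (t - 1) / a)"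
      using pos by (simp add: pos_divide_less_eq)
    then have "(\<sigma> + 2 - t) * a < \<eta> * (\<sigma> + 1 - (t - 1) / a) * a"
      using a by simp
    also have "\<dots> = \<eta> * ((\<sigma> + 1) * a - (t - 1))" using a by (simp add: field_simps)
    finally show ?thesis by (simp add: algebra_simps)
  next
    case False
    \<comment> \<open>For \<tau> > \<sigma> + 2 the exponent is negative; the inequality comes from
      1 - \<eta> < 1 together with \<sigma> + 1 < \<tau> - 1.\<close>
    show ?thesis
    proof (cases "a * (1 + \<sigma>) - (t - 1) \<le> 0")
      case True
      then have "(1 - \<eta>) * (a * (1 + \<sigma>) - (t - 1)) \<le> 0"
        using assms by (intro mult_nonneg_nonpos) auto
      also have "0 < (a - 1) * (t - 1)" using a assms by simp
      finally show ?thesis .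
    next
      case *: False
      have "(1 - \<eta>) * (a * (1 + \<sigma>) - (t - 1)) < 1 * (a * (1 + \<sigma>) - (t - 1))"
        using * assms by (intro mult_strict_right_mono) auto
      also have "\<dots> \<le> a * (t - 1) - (t - 1)" using False a by simp
      finally show ?thesis by (simp add: algebra_simps)
    qed
  qed
  have "2 - a < \<eta>" using ll a by (simp add: zeta_ll_def)
  with 2 3 show ?thesis using that[of a] a by simp
next
  case True
  have "0 < (t - 1) - (1 - \<eta>)" using assms by simp
  moreover have "0 < (t - 1) - (1 - \<eta>) * (1 + \<sigma>)"
  proof -
    have "(\<sigma> + 2 - t) / (\<sigma> + 1) < \<eta>"
      using hh assms True by (simp add: zeta_hh_def one_ereal_def)
    then show ?thesis using assms by (simp add: field_simps)
  qed
  moreover have "eventually (\<lambda>\<gamma>::real. \<gamma> > 2) at_top" by (rule eventually_gt_at_top)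
  moreover have "filterlim (\<lambda>\<gamma>. \<gamma> * c) at_top at_top" if "0 < c" for c :: real
    using that filterlim_ident by (intro filterlim_at_top_mult_tendsto_pos[OF tendsto_const]) auto
  \<comment> \<open>Both inequalities are linear in \<gamma> with positive slope, hence hold for all
    large \<gamma>.\<close>
  ultimately have "eventually (\<lambda>\<gamma>. 2 < \<gamma> \<and> t - 1 < \<gamma> * ((t - 1) - (1 - \<eta>))
      \<and> t - 1 < \<gamma> * ((t - 1) - (1 - \<eta>) * (1 + \<sigma>))) at_top"
    by (intro eventually_conj) (auto simp: filterlim_at_top_dense)
  then obtain \<gamma> where \<gamma>: "2 < \<gamma>" "t - 1 < \<gamma> * ((t - 1) - (1 - \<eta>))"
      "t - 1 < \<gamma> * ((t - 1) - (1 - \<eta>) * (1 + \<sigma>))"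
    by (metis (no_types, lifting) eventually_happens' trivial_limit_at_top_linorder)
  have "(1 - \<eta>) * (\<gamma> * (1 + \<sigma>) - (t - 1)) \<le> (1 - \<eta>) * (\<gamma> * (1 + \<sigma>))"
    using assms by (intro mult_left_mono) auto
  also have "\<dots> < (\<gamma> - 1) * (t - 1)" using \<gamma>(3) by (simp add: algebra_simps)
  finally show ?thesis using that[of \<gamma>] \<gamma> True assms by (simp add: algebra_simps)
qed

section \<open>Growth exponents\<close>

abbreviation grows_at_least :: "(real \<Rightarrow> ennreal) \<Rightarrow> real \<Rightarrow> bool" where
  "grows_at_least F \<eta> \<equiv> \<exists>c>0. eventually (\<lambda>k. ennreal (c * k powr \<eta>) \<le> F k) at_top"

text \<open>Constants are free because they disappear after division by \<open>ln k\<close>. Only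
  the lower version prescribes a sign: \<open>ennreal\<close> sends negative reals to 0, which would
  empty a lower bound but is harmless in an upper one.\<close>

abbreviation grows_at_most :: "(real \<Rightarrow> ennreal) \<Rightarrow> real \<Rightarrow> bool" where
  "grows_at_most F \<eta> \<equiv> \<exists>C. eventually (\<lambda>k. F k \<le> ennreal (C * k powr \<eta>)) at_top"

lemma ln_ext_mono: "x \<le> y \<Longrightarrow> ln_ext x \<le> ln_ext y"
  by (auto simp: ln_ext_def top_unique less_top[symmetric] enn2real_mono zero_less_iff_neq_zero
      intro!: ln_mono enn2real_positive_iff[THEN iffD2])

lemma ln_ext_ennreal: "0 < r \<Longrightarrow> ln_ext (ennreal r) = ereal (ln r)"
  by (auto simp: ln_ext_def)

lemma ln_ext_ratio_upper:
  assumes "eventually (\<lambda>k. F k \<le> ennreal (C * k powr \<eta>)) at_top" and "ereal \<eta> < y"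
  shows "eventually (\<lambda>k. ln_ext (F k) / ereal (ln k) < y) at_top"
proof -
  \<comment> \<open>The constant has to be positive for its logarithm to be meaningful.\<close>
  define C' where "C' = max C 1"
  have C': "0 < C'" by (simp add: C'_def)
  have "((\<lambda>k::real. ln C' / ln k + \<eta>) \<longlongrightarrow> \<eta>) at_top" by real_asymp
  then have "((\<lambda>k::real. ereal (ln C' / ln k + \<eta>)) \<longlongrightarrow> ereal \<eta>) at_top" by simp
  from order_tendstoD(2)[OF this assms(2)] assms(1) eventually_gt_at_top[of 1]
  show ?thesis
  proof eventually_elim
    case (elim k)
    have "F k \<le> ennreal (C' * k powr \<eta>)"
      using elim(2) by (rule order_trans) (auto intro!: ennreal_leI mult_right_mono simp: C'_def)
    from ln_ext_mono[OF this] have "ln_ext (F k) \<le> ereal (ln C' + \<eta> * ln k)"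
      using C' elim(3) by (simp add: ln_ext_ennreal ln_mult ln_powr)
    then have "ln_ext (F k) / ereal (ln k) \<le> ereal (ln C' + \<eta> * ln k) / ereal (ln k)"
      using elim(3) by (intro ereal_divide_right_mono) auto
    also have "\<dots> = ereal (ln C' / ln k + \<eta>)" using elim(3) by (simp add: field_simps)
    finally show ?case using elim(1) by simp
  qed
qed

lemma ln_ext_ratio_lower:
  assumes "eventually (\<lambda>k. ennreal (c * k powr \<eta>) \<le> F k) at_top" and "y < ereal \<eta>" and "0 < c"
  shows "eventually (\<lambda>k. y < ln_ext (F k) / ereal (ln k)) at_top"
proof -
  have "((\<lambda>k::real. ln c / ln k + \<eta>) \<longlongrightarrow> \<eta>) at_top" by real_asymp
  then have "((\<lambda>k::real. ereal (ln c / ln k + \<eta>)) \<longlongrightarrow> ereal \<eta>) at_top" by simp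
  from order_tendstoD(1)[OF this assms(2)] assms(1) eventually_gt_at_top[of 1]
  show ?thesis
  proof eventually_elim
    case (elim k)
    from ln_ext_mono[OF elim(2)] have "ereal (ln c + \<eta> * ln k) \<le> ln_ext (F k)"
      using assms(3) elim(3) by (simp add: ln_ext_ennreal ln_mult ln_powr)
    then have "ereal (ln c + \<eta> * ln k) / ereal (ln k) \<le> ln_ext (F k) / ereal (ln k)"
      using elim(3) by (intro ereal_divide_right_mono) auto
    moreover have "ereal (ln c + \<eta> * ln k) / ereal (ln k) = ereal (ln c / ln k + \<eta>)"
      using elim(3) by (simp add: field_simps)
    ultimately show ?case using elim(1) by simp
  qed
qed

text \<open>Strictly larger and strictly smaller exponents suffice, because reals are dense between
  z and any bound in \<open>ereal\<close>.\<close>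

lemma ln_ext_ratio_tendsto:
  assumes "\<And>\<eta>. z < \<eta> \<Longrightarrow> grows_at_most F \<eta>"
    and "\<And>\<eta>. \<eta> < z \<Longrightarrow> grows_at_least F \<eta>"
  shows "((\<lambda>k. ln_ext (F k) / ereal (ln k)) \<longlongrightarrow> ereal z) at_top"
proof (rule order_tendstoI)
  fix y assume "y < ereal z"
  then obtain \<eta> where \<eta>: "y < ereal \<eta>" "\<eta> < z" using ereal_dense2[of y "ereal z"] by auto
  show "eventually (\<lambda>k. y < ln_ext (F k) / ereal (ln k)) at_top"
    using assms(2)[OF \<eta>(2)] ln_ext_ratio_lower[OF _ \<eta>(1)] by blast
next
  fix y assume "ereal z < y"
  then obtain \<eta> where \<eta>: "ereal \<eta> < y" "z < \<eta>" using ereal_dense2[of "ereal z" y] by auto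
  show "eventually (\<lambda>k. ln_ext (F k) / ereal (ln k) < y) at_top"
    using assms(1)[OF \<eta>(2)] ln_ext_ratio_upper[OF _ \<eta>(1)] by blast
qed

text \<open>A lower bound is asked for only if z > 0. At z = 0 the maximum with 0 bounds the ratio
  from below by itself, even if \<open>F\<close> vanishes and its logarithm is -\<infinity>.\<close>

lemma max_0_ln_ext_ratio_tendsto:
  assumes "0 \<le> z" and "\<And>\<eta>. z < \<eta> \<Longrightarrow> grows_at_most F \<eta>"
    and "\<And>\<eta>. 0 < z \<Longrightarrow> \<eta> < z \<Longrightarrow> grows_at_least F \<eta>"
  shows "((\<lambda>k. max 0 (ln_ext (F k) / ereal (ln k))) \<longlongrightarrow> ereal z) at_top"
proof (cases "z = 0")
  case False
  then have "((\<lambda>k. ln_ext (F k) / ereal (ln k)) \<longlongrightarrow> ereal z) at_top"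
    using assms by (intro ln_ext_ratio_tendsto) auto
  from tendsto_max[OF tendsto_const this, of 0] show ?thesis using assms(1) by (simp add: max_def)
next
  case True
  show ?thesis
  proof (rule order_tendstoI)
    fix y assume "y < ereal z"
    then have "y < max 0 (ln_ext (F k) / ereal (ln k))" for k
      using True by (simp add: zero_ereal_def less_max_iff_disj)
    then show "eventually (\<lambda>k. y < max 0 (ln_ext (F k) / ereal (ln k))) at_top" by simp
  next
    fix y assume y: "ereal z < y"
    then obtain \<eta> where \<eta>: "ereal \<eta> < y" "z < \<eta>" using ereal_dense2[of "ereal z" y] by auto
    have "eventually (\<lambda>k. ln_ext (F k) / ereal (ln k) < y) at_top"
      using assms(2)[OF \<eta>(2)] ln_ext_ratio_upper[OF _ \<eta>(1)] by blast
    then show "eventually (\<lambda>k. max 0 (ln_ext (F k) / ereal (ln k)) < y) at_top"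
      by eventually_elim (use y True in \<open>simp add: zero_ereal_def\<close>)
  qed
qed

text \<open>For the loss \<epsilon> in a mark exponent: it costs \<epsilon> K in the final exponent,
  which has to stay below the available gap \<delta>. \<open>K\<close> may have either sign, hence
  the absolute value in the witness.\<close>

lemma obtain_small_scale:
  fixes E \<delta> K :: real
  assumes "0 < E" "0 < \<delta>"
  obtains \<epsilon> where "0 < \<epsilon>" "\<epsilon> \<le> E" "\<epsilon> * K < \<delta>"
proof
  let ?e = "min E (\<delta> / (2 * (\<bar>K\<bar> + 1)))"
  show "0 < ?e" "?e \<le> E" using assms by auto
  have "?e * K \<le> ?e * \<bar>K\<bar>" using \<open>0 < ?e\<close> by (intro mult_left_mono) auto
  also have "\<dots> \<le> (\<delta> / (2 * (\<bar>K\<bar> + 1))) * (\<bar>K\<bar> + 1)"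
    using assms by (intro mult_mono) auto
  also have "\<dots> = \<delta> / 2" by (simp add: field_simps)
  finally show "?e * K < \<delta>" using assms by simp
qed

lemma zeta_infinity [simp]: "zeta_ll \<infinity> = -\<infinity>" "zeta_hl \<alpha> \<infinity> = -\<infinity>" "zeta_hh \<alpha> \<infinity> \<sigma> = -\<infinity>"
  by (simp_all add: zeta_ll_def zeta_hl_def zeta_hh_def)

lemma zeta_ll_ereal: "zeta_ll (ereal a) = ereal (2 - a)"
  by (simp add: zeta_ll_def)

lemma zeta_hl_ereal:
  "a \<noteq> 0 \<Longrightarrow> zeta_hl (ereal a) (ereal t) = ereal ((t - 1) / a - (t - 2))"
  "zeta_hl \<infinity> (ereal t) = ereal (2 - t)"
  by (simp_all add: zeta_hl_def one_ereal_def)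

lemma zeta_hh_ereal:
  "a \<noteq> 0 \<Longrightarrow> t \<le> \<sigma> + 2 \<Longrightarrow> \<sigma> + 1 - (t - 1) / a \<noteq> 0 \<Longrightarrow>
    zeta_hh (ereal a) (ereal t) \<sigma> = ereal ((\<sigma> + 2 - t) / (\<sigma> + 1 - (t - 1) / a))"
  "\<sigma> + 2 < t \<Longrightarrow> \<sigma> + 1 \<noteq> 0 \<Longrightarrow> zeta_hh \<alpha> (ereal t) \<sigma> = ereal ((\<sigma> + 2 - t) / (\<sigma> + 1))"
  "\<sigma> + 1 \<noteq> 0 \<Longrightarrow> zeta_hh \<infinity> (ereal t) \<sigma> = ereal ((\<sigma> + 2 - t) / (\<sigma> + 1))"
  by (simp_all add: zeta_hh_def one_ereal_def)

lemma eventually_powr_lower_mono: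
  fixes F :: "real \<Rightarrow> ennreal"
  assumes "grows_at_least F \<eta>'" "\<eta> \<le> \<eta>'"
  shows "grows_at_least F \<eta>"
proof -
  obtain c where c: "0 < c" "eventually (\<lambda>k. ennreal (c * k powr \<eta>') \<le> F k) at_top" using assms(1) by blast
  have "eventually (\<lambda>k. ennreal (c * k powr \<eta>) \<le> F k) at_top"
    using c(2) eventually_ge_at_top[of 1]
  proof eventually_elim
    case (elim k)
    have "c * k powr \<eta> \<le> c * k powr \<eta>'" using elim(2) c(1) assms(2) by (intro mult_left_mono powr_mono) auto
    then show ?case using elim(1) by (meson ennreal_leI order_trans)
  qed
  with c(1) show ?thesis by blast
qed

lemma emeasure_lborel_cbox_cart:
  fixes a b :: "real^'n"
  assumes "\<And>i. a $ i \<le> b $ i"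
  shows "emeasure lborel (cbox a b) = ennreal (\<Prod>i\<in>UNIV. b $ i - a $ i)"
proof -
  have "cbox a b \<noteq> {}" using assms by (auto simp: interval_ne_empty_cart)
  then have "measure lborel (cbox a b) = (\<Prod>i\<in>UNIV. b $ i - a $ i)"
    by (rule content_cbox_cart)
  then show ?thesis
    using emeasure_eq_ennreal_measure[of lborel "cbox a b"] emeasure_bounded_finite[of "cbox a b"]
    by (simp add: less_top[symmetric])
qed

lemma mark_interval_const_pos: "2 < t \<Longrightarrow> 0 < 1 - 2 powr (- (t - 1) :: real)"
  using powr_less_mono[of "- (t - 1)" 0 2] by simp

section \<open>Probabilities of edges\<close>

context ksrg
begin

abbreviation pr :: "('w \<Rightarrow> bool) \<Rightarrow> ennreal" where
  "pr Q \<equiv> emeasure M {\<omega> \<in> space M. Q \<omega>}"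

abbreviation at_vertices :: "((nat \<Rightarrow> real^'d) \<Rightarrow> (nat \<Rightarrow> real) \<Rightarrow> 'b) \<Rightarrow> 'w \<Rightarrow> 'b" where
  "at_vertices Q \<omega> \<equiv> Q (\<lambda>i. X i \<omega>) (\<lambda>i. W i \<omega>)"

abbreviation link_prob :: "real^'d \<Rightarrow> real^'d \<Rightarrow> real \<Rightarrow> real \<Rightarrow> real" where
  "link_prob \<equiv> edge_prob \<kappa> \<alpha> \<beta> p"

abbreviation link_prob_at :: "nat \<Rightarrow> nat \<Rightarrow> 'w \<Rightarrow> real" where
  "link_prob_at i j \<omega> \<equiv> link_prob (X i \<omega>) (X j \<omega>) (W i \<omega>) (W j \<omega>)"

declare X_measurable [measurable]

lemma W_measurable [measurable]: "W i \<in> borel_measurable M"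
  using W_indep by (auto simp: indep_vars_def)

lemma E_measurable_pred [measurable]: "Measurable.pred M (\<lambda>\<omega>. E i j \<omega>)"
  using E_measurable[of i j] by (simp add: pred_def)

lemma vol_box_borel [measurable]: "(vol_box k :: (real^'d) set) \<in> sets borel"
proof -
  have "vol_box k = (\<Inter>a. {x::real^'d. \<bar>x $ a\<bar> \<le> k powr (1 / real CARD('d)) / 2})"
    by (auto simp: vol_box_def)
  also have "closed \<dots>"
    by (intro closed_INT ballI closed_Collect_le continuous_intros)
  finally show ?thesis by (rule borel_closed)
qed

text \<open>By monotone convergence this is the expected number of vertices in \<open>A\<close> with
  a downward edge leaving the box. General sets \<open>A\<close> are allowed so that boundary layers
  and pieces of a face can be counted separately.\<close>

definition down_count :: "(real^'d) set \<Rightarrow> real \<Rightarrow> ennreal" where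
  "down_count A k = (\<Sum>i. pr (\<lambda>\<omega>. X i \<omega> \<in> A \<and> down_edge_out X W E k \<omega> i))"

abbreviation star_count :: "real \<Rightarrow> ennreal" where
  "star_count \<equiv> \<lambda>k. down_count (vol_box k) k"

abbreviation long_count :: "real \<Rightarrow> ennreal" where
  "long_count \<equiv> \<lambda>k. down_count (vol_box (k / 2)) k"

lemma down_edge_out_measurable [measurable]:
  "Measurable.pred M (\<lambda>\<omega>. down_edge_out X W E k \<omega> i)"
  unfolding down_edge_out_def by measurable

lemma suminf_pr:
  assumes [measurable]: "\<And>i. Measurable.pred M (Q i)"
  shows "(\<Sum>i. pr (Q i)) = (\<integral>\<^sup>+\<omega>. (\<Sum>i. of_bool (Q i \<omega>)) \<partial>M)"
  by (simp add: nn_integral_suminf emeasure_eq_nn_integral_of_bool)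

lemma suminf_pr2:
  assumes [measurable]: "\<And>i j. Measurable.pred M (Q i j)"
  shows "(\<Sum>i. \<Sum>j. pr (Q i j)) = (\<integral>\<^sup>+\<omega>. (\<Sum>i. \<Sum>j. of_bool (Q i j \<omega>)) \<partial>M)"
  by (simp add: nn_integral_suminf suminf_pr)

lemma suminf_pr3:
  assumes [measurable]: "\<And>i j j'. Measurable.pred M (Q i j j')"
  shows "(\<Sum>i. \<Sum>j. \<Sum>j'. pr (Q i j j')) = (\<integral>\<^sup>+\<omega>. (\<Sum>i. \<Sum>j. \<Sum>j'. of_bool (Q i j j' \<omega>)) \<partial>M)"
  by (simp add: nn_integral_suminf suminf_pr2)

lemma expected_down_out_eq: "expected_down_out M X W E l k = down_count (vol_box l) k"
  by (simp add: expected_down_out_def emeasure_count_space_eq_suminf down_count_def suminf_pr)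

lemma subalgebra_vertex_algebra: "subalgebra M (vertex_algebra M X W)"
  unfolding subalgebra_def vertex_algebra_def
proof (intro conjI)
  let ?f = "\<lambda>\<omega>. (\<lambda>i. X i \<omega>, \<lambda>i. W i \<omega>)"
  let ?N = "(\<Pi>\<^sub>M i\<in>UNIV. borel) \<Otimes>\<^sub>M (\<Pi>\<^sub>M i\<in>UNIV. borel)"
  have "?f \<in> measurable M ?N"
    by (intro measurable_Pair measurable_PiM_single') auto
  then show "sets (vimage_algebra (space M) ?f ?N) \<subseteq> sets M"
    by (auto simp: sets_vimage_algebra intro!: sets.sigma_sets_subset)
qed simp

lemma AE_W_ge_1:
  assumes "2 < \<tau>"
  shows "AE \<omega> in M. 1 \<le> W i \<omega>"
proof (cases "\<tau> = \<infinity>")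
  case True
  with W_const[of i] show ?thesis by auto
next
  case False
  then have "prob {\<omega> \<in> space M. 1 \<le> W i \<omega>} = 1"
    using W_pareto[of 1 i] by simp
  then show ?thesis
    by (subst AE_iff_emeasure_eq_1) (simp_all add: emeasure_eq_measure)
qed

section \<open>Independence of locations and marks\<close>

lemma indep_var_locations_marks:
  fixes f :: "(nat \<Rightarrow> real^'d) \<Rightarrow> 'c" and g :: "(nat \<Rightarrow> real) \<Rightarrow> 'c"
  assumes f: "f \<in> measurable (\<Pi>\<^sub>M i\<in>UNIV. borel) N" and g: "g \<in> measurable (\<Pi>\<^sub>M i\<in>UNIV. borel) L"
  shows "indep_var N (\<lambda>\<omega>. f (\<lambda>i. X i \<omega>)) L (\<lambda>\<omega>. g (\<lambda>i. W i \<omega>))"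
proof -
  let ?X = "vimage_algebra (space M) (\<lambda>\<omega> i. X i \<omega>) (\<Pi>\<^sub>M i\<in>UNIV. borel)"
  let ?W = "vimage_algebra (space M) (\<lambda>\<omega> i. W i \<omega>) (\<Pi>\<^sub>M i\<in>UNIV. borel)"
  have X: "(\<lambda>\<omega> i. X i \<omega>) \<in> measurable M (\<Pi>\<^sub>M i\<in>UNIV. borel)"
    and W: "(\<lambda>\<omega> i. W i \<omega>) \<in> measurable M (\<Pi>\<^sub>M i\<in>UNIV. borel)"
    by (intro measurable_PiM_single'; auto)+
  have "(\<lambda>\<omega>. f (\<lambda>i. X i \<omega>)) \<in> measurable ?X N"
    by (rule measurable_compose[OF measurable_vimage_algebra1 f]) (auto simp: space_PiM)
  then have 1: "sigma_sets (space M) {(\<lambda>\<omega>. f (\<lambda>i. X i \<omega>)) -` A \<inter> space M |A. A \<in> sets N} \<subseteq> sets ?X"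
    by (rule sigma_sets_vimage_subset[where A="?X", unfolded space_vimage_algebra])
  have "(\<lambda>\<omega>. g (\<lambda>i. W i \<omega>)) \<in> measurable ?W L"
    by (rule measurable_compose[OF measurable_vimage_algebra1 g]) (auto simp: space_PiM)
  then have 2: "sigma_sets (space M) {(\<lambda>\<omega>. g (\<lambda>i. W i \<omega>)) -` A \<inter> space M |A. A \<in> sets L} \<subseteq> sets ?W"
    by (rule sigma_sets_vimage_subset[where A="?W", unfolded space_vimage_algebra])
  have "indep_set (sigma_sets (space M) {(\<lambda>\<omega>. f (\<lambda>i. X i \<omega>)) -` A \<inter> space M |A. A \<in> sets N})
      (sigma_sets (space M) {(\<lambda>\<omega>. g (\<lambda>i. W i \<omega>)) -` A \<inter> space M |A. A \<in> sets L})"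
    using X_W_indep subsetD[OF 1] subsetD[OF 2] unfolding indep_sets2_eq
    by (intro conjI ballI subsetI) auto
  then show ?thesis
    unfolding indep_var_eq using measurable_compose[OF X f] measurable_compose[OF W g] by simp
qed

lemma nn_integral_indep_var_mult:
  fixes f g :: "'w \<Rightarrow> ennreal"
  assumes "indep_var borel f borel g"
  shows "(\<integral>\<^sup>+\<omega>. f \<omega> * g \<omega> \<partial>M) = (\<integral>\<^sup>+\<omega>. f \<omega> \<partial>M) * (\<integral>\<^sup>+\<omega>. g \<omega> \<partial>M)"
proof -
  have "case_bool borel borel = (\<lambda>_::bool. borel :: ennreal measure)"
    by (auto split: bool.split)
  with assms have "indep_vars (\<lambda>_. borel) (case_bool f g) UNIV"
    unfolding indep_var_def by simp
  from indep_vars_nn_integral[OF _ this] show ?thesis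
    by (simp add: UNIV_bool mult.commute)
qed

text \<open>The estimates below split into one functional of all locations and one factor per mark.
  Independence of locations from marks gives the first split, independence of the marks among
  themselves the second.\<close>

lemma nn_integral_locations_marks:
  fixes f :: "(nat \<Rightarrow> real^'d) \<Rightarrow> ennreal" and g :: "nat \<Rightarrow> real \<Rightarrow> ennreal"
  assumes f: "f \<in> borel_measurable (\<Pi>\<^sub>M i\<in>UNIV. borel)"
    and g: "\<And>i. g i \<in> borel_measurable borel" and K: "finite K"
  shows "(\<integral>\<^sup>+\<omega>. f (\<lambda>i. X i \<omega>) * (\<Prod>i\<in>K. g i (W i \<omega>)) \<partial>M)
    = (\<integral>\<^sup>+\<omega>. f (\<lambda>i. X i \<omega>) \<partial>M) * (\<Prod>i\<in>K. \<integral>\<^sup>+\<omega>. g i (W i \<omega>) \<partial>M)"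
proof -
  let ?G = "\<lambda>w::nat \<Rightarrow> real. \<Prod>i\<in>K. g i (w i)"
  have [measurable]: "?G \<in> borel_measurable (\<Pi>\<^sub>M i\<in>UNIV. borel)"
    by (intro borel_measurable_prod_ennreal measurable_compose[OF _ g]) measurable
  have "(\<integral>\<^sup>+\<omega>. f (\<lambda>i. X i \<omega>) * ?G (\<lambda>i. W i \<omega>) \<partial>M)
      = (\<integral>\<^sup>+\<omega>. f (\<lambda>i. X i \<omega>) \<partial>M) * (\<integral>\<^sup>+\<omega>. ?G (\<lambda>i. W i \<omega>) \<partial>M)"
    by (intro nn_integral_indep_var_mult indep_var_locations_marks f) measurable
  moreover have "indep_vars (\<lambda>_. borel) (\<lambda>i \<omega>. g i (W i \<omega>)) K"
    by (rule indep_vars_compose2[OF indep_vars_subset[OF W_indep]]) (use g in auto)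
  note indep_vars_nn_integral[OF K this]
  ultimately show ?thesis by simp
qed

text \<open>The defining property of conditional expectation: integrating the conditional edge
  probability over an event \<open>F\<close> of locations and marks gives the probability of
  \<open>F\<close> together with the edges. Through this formula the law of the edges enters the
  estimates.\<close>

lemma nn_integral_edges:
  assumes P: "finite P" "P \<subseteq> {(i, j). i < j}" and F: "F \<in> sets (vertex_algebra M X W)"
  shows "emeasure M (F \<inter> {\<omega> \<in> space M. \<forall>(i, j)\<in>P. E i j \<omega>})
    = (\<integral>\<^sup>+\<omega>. indicator F \<omega> *
        ennreal (\<Prod>(i, j)\<in>P. link_prob_at i j \<omega>) \<partial>M)"
proof -
  let ?A = "{\<omega> \<in> space M. \<forall>(i, j)\<in>P. E i j \<omega>}"
  let ?q = "\<lambda>\<omega>. \<Prod>(i, j)\<in>P. link_prob_at i j \<omega>"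
  interpret FA: finite_measure_subalgebra M "vertex_algebra M X W"
    by (unfold_locales) (rule subalgebra_vertex_algebra)
  have [measurable]: "?A \<in> sets M"
  proof -
    have "?A = {\<omega> \<in> space M. \<forall>x\<in>P. E (fst x) (snd x) \<omega>}" by auto
    also have "\<dots> \<in> sets M" using P(1) by measurable
    finally show ?thesis .
  qed
  have [measurable]: "F \<in> sets M"
    using F subalgebra_vertex_algebra by (auto simp: subalgebra_def)
  have q: "?q \<omega> \<ge> 0" for \<omega>
    using p_pos by (intro prod_nonneg) (auto simp: edge_prob_def profile_def)
  have cond: "AE \<omega> in M. real_cond_exp M (vertex_algebra M X W) (indicator ?A) \<omega> = ?q \<omega>"
    using edges_cond[OF P] .
  have int: "integrable M (indicator ?A :: 'w \<Rightarrow> real)"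
    using \<open>?A \<in> sets M\<close> by (intro integrable_const_bound[where B=1]) auto
  have "measure M (F \<inter> ?A) = (\<integral>\<omega>\<in>F. indicator ?A \<omega> \<partial>M)"
    using \<open>?A \<in> sets M\<close> \<open>F \<in> sets M\<close> sets.sets_into_space[OF \<open>F \<in> sets M\<close>]
    by (simp only: set_lebesgue_integral_def real_scaleR_def indicator_inter_arith[symmetric]
        Bochner_Integration.integral_indicator Int_absorb2[OF le_infI1])
  also have "\<dots> = (\<integral>\<omega>\<in>F. real_cond_exp M (vertex_algebra M X W) (indicator ?A) \<omega> \<partial>M)"
    by (rule FA.real_cond_exp_intA[OF int F])
  also have "ennreal \<dots> = (\<integral>\<^sup>+\<omega>. ennreal (indicator F \<omega> *\<^sub>R real_cond_exp M (vertex_algebra M X W) (indicator ?A) \<omega>) \<partial>M)"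
    unfolding set_lebesgue_integral_def
  proof (rule nn_integral_eq_integral[symmetric])
    show "integrable M (\<lambda>x. indicat_real F x *\<^sub>R real_cond_exp M (vertex_algebra M X W) (indicator ?A) x)"
      using FA.real_cond_exp_int(1)[OF int] by (intro integrable_mult_indicator) auto
    show "AE x in M. 0 \<le> indicat_real F x *\<^sub>R real_cond_exp M (vertex_algebra M X W) (indicator ?A) x"
      using cond by eventually_elim (use q in \<open>auto simp: indicator_def\<close>)
  qed
  also have "\<dots> = (\<integral>\<^sup>+\<omega>. indicator F \<omega> * ennreal (?q \<omega>) \<partial>M)"
    by (rule nn_integral_cong_AE) (use cond in eventually_elim, auto simp: indicator_def)
  finally show ?thesis by (simp add: emeasure_eq_measure)
qed

lemma edge_prob_sym:
  fixes x y :: "real^'d"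
  shows "link_prob x y u v = link_prob y x v u"
proof -
  have "kernel_val CARD('d) \<kappa> u v = kernel_val CARD('d) \<kappa> v u"
    by (cases \<kappa>) (auto simp: max.commute min.commute add.commute)
  then show ?thesis by (simp add: edge_prob_def norm_minus_commute)
qed

lemma edge_prob_min_max:
  "link_prob (X (min i j) \<omega>) (X (max i j) \<omega>) (W (min i j) \<omega>) (W (max i j) \<omega>)
    = link_prob_at i j \<omega>"
  by (cases "i \<le> j") (simp_all add: min_def max_def edge_prob_sym[of "X i \<omega>"])

text \<open>Lets events of locations and marks be named by predicates \<open>Q\<close> on the two
  sequences, with measurability checked on the product space.\<close>

lemma vertex_algebra_measurableI:
  assumes "Measurable.pred ((\<Pi>\<^sub>M i\<in>UNIV. borel) \<Otimes>\<^sub>M (\<Pi>\<^sub>M i\<in>UNIV. borel)) (\<lambda>(x, w). Q x w)"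
  shows "{\<omega> \<in> space M. at_vertices Q \<omega>} \<in> sets (vertex_algebra M X W)"
proof -
  let ?N = "(\<Pi>\<^sub>M i\<in>(UNIV::nat set). borel :: (real^'d) measure) \<Otimes>\<^sub>M (\<Pi>\<^sub>M i\<in>(UNIV::nat set). borel :: real measure)"
  have "{x \<in> space ?N. case x of (x, w) \<Rightarrow> Q x w} \<in> sets ?N"
    using assms by (simp add: pred_def)
  from in_vimage_algebra[OF this, of "\<lambda>\<omega>. (\<lambda>i. X i \<omega>, \<lambda>i. W i \<omega>)" "space M"]
  show ?thesis
    unfolding vertex_algebra_def
    by (rule back_subst[where P="\<lambda>A. A \<in> _"]) (auto simp: space_pair_measure space_PiM)
qed

text \<open>The edges of a star with centre \<open>i\<close> are conditionally independent. The
  model stores a pair with its smaller index first, so each \<open>j\<close> is sent to the ordered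
  pair; as \<open>i\<close> is not in \<open>S\<close>, this map is injective and no pair
  degenerates.\<close>

lemma emeasure_star_edges:
  assumes Q: "Measurable.pred ((\<Pi>\<^sub>M i\<in>UNIV. borel) \<Otimes>\<^sub>M (\<Pi>\<^sub>M i\<in>UNIV. borel)) (\<lambda>(x, w). Q x w)"
    and "finite S" "i \<notin> S"
  shows "pr (\<lambda>\<omega>. at_vertices Q \<omega> \<and> (\<forall>j\<in>S. E i j \<omega>))
    = (\<integral>\<^sup>+\<omega>. of_bool (at_vertices Q \<omega>) * ennreal (\<Prod>j\<in>S. link_prob_at i j \<omega>) \<partial>M)"
proof -
  let ?m = "\<lambda>j. (min i j, max i j)"
  let ?F = "{\<omega> \<in> space M. at_vertices Q \<omega>}"
  have inj: "inj_on ?m S"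
    using assms(3) by (auto simp: inj_on_def min_def max_def split: if_splits)
  have lt: "min i j < max i j" if "j \<in> S" for j
    using assms(3) that by (cases i j rule: linorder_cases) auto
  have "E (min i j) (max i j) \<omega> \<longleftrightarrow> E i j \<omega>" for j \<omega>
    using E_sym by (auto simp: min_def max_def)
  then have eq: "{\<omega> \<in> space M. at_vertices Q \<omega> \<and> (\<forall>j\<in>S. E i j \<omega>)}
      = ?F \<inter> {\<omega> \<in> space M. \<forall>(i, j)\<in>?m ` S. E i j \<omega>}"
    by auto
  have "emeasure M (?F \<inter> {\<omega> \<in> space M. \<forall>(i, j)\<in>?m ` S. E i j \<omega>})
      = (\<integral>\<^sup>+\<omega>. indicator ?F \<omega> * ennreal (\<Prod>(i, j)\<in>?m ` S. link_prob_at i j \<omega>) \<partial>M)"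
    using assms(2) lt by (intro nn_integral_edges vertex_algebra_measurableI[OF Q]) auto
  also have "\<dots> = (\<integral>\<^sup>+\<omega>. of_bool (at_vertices Q \<omega>) * ennreal (\<Prod>j\<in>S. link_prob_at i j \<omega>) \<partial>M)"
  proof (rule nn_integral_cong, goal_cases)
    case (1 \<omega>)
    have "(\<Prod>(i, j)\<in>?m ` S. link_prob_at i j \<omega>) = (\<Prod>j\<in>S. link_prob_at i j \<omega>)"
      by (simp add: prod.reindex[OF inj] edge_prob_min_max)
    moreover have "(indicator ?F \<omega> :: ennreal) = of_bool (at_vertices Q \<omega>)"
      using 1 by (simp only: indicator_def mem_Collect_eq simp_thms)
    ultimately show ?case by (simp only:)
  qed
  finally show ?thesis unfolding eq .
qed

lemma emeasure_edge:
  assumes "Measurable.pred ((\<Pi>\<^sub>M i\<in>UNIV. borel) \<Otimes>\<^sub>M (\<Pi>\<^sub>M i\<in>UNIV. borel)) (\<lambda>(x, w). Q x w)"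
    and "i \<noteq> j"
  shows "pr (\<lambda>\<omega>. at_vertices Q \<omega> \<and> E i j \<omega>)
    = (\<integral>\<^sup>+\<omega>. of_bool (at_vertices Q \<omega>) * ennreal (link_prob_at i j \<omega>) \<partial>M)"
  using emeasure_star_edges[OF assms(1), of "{j}" i] assms(2) by simp

lemma emeasure_two_edges:
  assumes "Measurable.pred ((\<Pi>\<^sub>M i\<in>UNIV. borel) \<Otimes>\<^sub>M (\<Pi>\<^sub>M i\<in>UNIV. borel)) (\<lambda>(x, w). Q x w)"
    and "i \<noteq> j" "i \<noteq> j'" "j \<noteq> j'"
  shows "pr (\<lambda>\<omega>. at_vertices Q \<omega> \<and> E i j \<omega> \<and> E i j' \<omega>)
    = (\<integral>\<^sup>+\<omega>. of_bool (at_vertices Q \<omega>) * ennreal (link_prob_at i j \<omega> * link_prob_at i j' \<omega>) \<partial>M)"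
  using emeasure_star_edges[OF assms(1), of "{j, j'}" i] assms(2-4) by simp

section \<open>Intensities\<close>

definition intensity :: "(real^'d) set \<Rightarrow> ennreal" where
  "intensity A = (\<Sum>i. pr (\<lambda>\<omega>. X i \<omega> \<in> A))"

text \<open>The second factorial moment measure of the vertex set, evaluated on B \<times>
  B.\<close>

definition pair_intensity :: "(real^'d) set \<Rightarrow> ennreal" where
  "pair_intensity B = (\<Sum>i. \<Sum>j. pr (\<lambda>\<omega>. X i \<omega> \<in> B \<and> X j \<omega> \<in> B \<and> i \<noteq> j))"

lemma lattice_obtain:
  assumes "V = Lattice"
  obtains z where "bij_betw z UNIV {x :: real^'d. \<forall>a. x $ a \<in> \<int>}"
    "\<And>i \<omega>. \<omega> \<in> space M \<Longrightarrow> X i \<omega> = z i"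
  using X_lattice[OF assms] unfolding lattice_points_def by blast

lemma bounded_emeasure_lborel_finite:
  fixes A :: "(real^'d) set"
  assumes "bounded A"
  shows "emeasure lborel A < \<infinity>"
  using emeasure_bounded_finite[OF assms] by simp

lemma lattice_card:
  assumes z: "bij_betw z UNIV {x :: real^'d. \<forall>a. x $ a \<in> \<int>}" and "bounded A"
  shows "finite {i::nat. z i \<in> A}" "card {i. z i \<in> A} = card {x\<in>A. \<forall>a. x $ a \<in> \<int>}"
proof -
  from bounded_subset_cbox_symmetric[OF \<open>bounded A\<close>] obtain a where "A \<subseteq> cbox (-a) a" by blast
  then have fin: "finite {x\<in>A. \<forall>a. x $ a \<in> \<int>}"
    by (intro finite_subset[OF _ finite_Ints_cbox[of "-a" a]]) auto
  have "bij_betw z {i. z i \<in> A} {x\<in>A. \<forall>a. x $ a \<in> \<int>}"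
    using z by (auto simp: bij_betw_def inj_on_def)
  with fin show "finite {i. z i \<in> A}" "card {i. z i \<in> A} = card {x\<in>A. \<forall>a. x $ a \<in> \<int>}"
    by (auto simp: bij_betw_finite bij_betw_same_card)
qed

lemma AE_finite_points:
  assumes A: "A \<in> sets borel" "bounded A"
  shows "AE \<omega> in M. finite {i. X i \<omega> \<in> A}"
proof (cases V)
  case Lattice
  then obtain z where z: "bij_betw z UNIV {x :: real^'d. \<forall>a. x $ a \<in> \<int>}"
    "\<And>i \<omega>. \<omega> \<in> space M \<Longrightarrow> X i \<omega> = z i"
    using lattice_obtain by blast
  show ?thesis
    using lattice_card(1)[OF z(1) A(2)] by (intro AE_I2) (simp add: z(2))
next
  case Poisson
  with X_poisson A bounded_emeasure_lborel_finite[OF A(2)] show ?thesis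
    unfolding poisson_points_def by blast
qed

lemma poisson_card_indep:
  fixes A :: "nat \<Rightarrow> (real^'d) set"
  assumes "V = Poisson" and "\<And>m. m < n \<Longrightarrow> A m \<in> sets borel" "\<And>m. m < n \<Longrightarrow> bounded (A m)"
    and "disjoint_family_on A {..<n}"
  shows "indep_vars (\<lambda>_. count_space UNIV) (\<lambda>m \<omega>. card {i. X i \<omega> \<in> A m}) {..<n}"
  using X_poisson[OF assms(1)] assms(2-4) bounded_emeasure_lborel_finite
  unfolding poisson_points_def by simp

text \<open>On the lattice the counts are constants; for Poisson points the counts of disjoint sets
  are independent. The product formulas that follow hold for both models alike.\<close>

lemma nn_integral_card_indep:
  fixes f g :: "nat \<Rightarrow> ennreal"
  assumes A: "A \<in> sets borel" "bounded A" and B: "B \<in> sets borel" "bounded B"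
    and disj: "A \<inter> B = {}"
  shows "(\<integral>\<^sup>+\<omega>. f (card {i. X i \<omega> \<in> A}) * g (card {i. X i \<omega> \<in> B}) \<partial>M)
    = (\<integral>\<^sup>+\<omega>. f (card {i. X i \<omega> \<in> A}) \<partial>M) * (\<integral>\<^sup>+\<omega>. g (card {i. X i \<omega> \<in> B}) \<partial>M)"
proof (cases V)
  case Lattice
  then obtain z where z: "\<And>i \<omega>. \<omega> \<in> space M \<Longrightarrow> X i \<omega> = z i"
    using lattice_obtain by metis
  have *: "(\<integral>\<^sup>+\<omega>. h \<omega> \<partial>M) = c" if "\<And>\<omega>. \<omega> \<in> space M \<Longrightarrow> h \<omega> = c" for h and c :: ennreal
    using nn_integral_cong[of M h "\<lambda>_. c"] that by (simp add: emeasure_space_1)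
  show ?thesis
    by (simp add: *[of _ "f (card {i. z i \<in> A})"] *[of _ "g (card {i. z i \<in> B})"]
        *[of _ "f (card {i. z i \<in> A}) * g (card {i. z i \<in> B})"] z)
next
  case Poisson
  let ?AB = "\<lambda>m::nat. if m = 0 then A else B"
  have "indep_vars (\<lambda>_. count_space UNIV) (\<lambda>m \<omega>. card {i. X i \<omega> \<in> ?AB m}) {..<2}"
    using A B disj by (intro poisson_card_indep Poisson) (auto simp: disjoint_family_on_def)
  then have "indep_vars (\<lambda>_. borel) (\<lambda>m \<omega>. (if m = 0 then f else g) (card {i. X i \<omega> \<in> ?AB m})) {..<2}"
    by (rule indep_vars_compose2) auto
  from indep_vars_nn_integral[OF _ this] show ?thesis
    by (simp add: numeral_2_eq_2 lessThan_Suc mult.commute)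
qed

lemma intensity_eq:
  assumes A: "A \<in> sets borel" "bounded A"
  shows "intensity A = (\<integral>\<^sup>+\<omega>. of_nat (card {i. X i \<omega> \<in> A}) \<partial>M)"
proof -
  note [measurable] = A(1)
  have "intensity A = (\<integral>\<^sup>+\<omega>. (\<Sum>i. of_bool (X i \<omega> \<in> A)) \<partial>M)"
    unfolding intensity_def by (rule suminf_pr) measurable
  also have "\<dots> = (\<integral>\<^sup>+\<omega>. of_nat (card {i. X i \<omega> \<in> A}) \<partial>M)"
    using AE_finite_points[OF A] by (intro nn_integral_cong_AE) (auto simp: suminf_of_bool_finite)
  finally show ?thesis .
qed

lemma pair_intensity_eq:
  assumes A: "A \<in> sets borel" "bounded A"
  shows "pair_intensity A = (\<integral>\<^sup>+\<omega>. of_nat (card {i. X i \<omega> \<in> A} * (card {i. X i \<omega> \<in> A} - 1)) \<partial>M)"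
proof -
  note [measurable] = A(1)
  have "pair_intensity A = (\<integral>\<^sup>+\<omega>. (\<Sum>i. \<Sum>j. of_bool (X i \<omega> \<in> A \<and> X j \<omega> \<in> A \<and> i \<noteq> j)) \<partial>M)"
    unfolding pair_intensity_def by (rule suminf_pr2) measurable
  also have "\<dots> = (\<integral>\<^sup>+\<omega>. of_nat (card {i. X i \<omega> \<in> A} * (card {i. X i \<omega> \<in> A} - 1)) \<partial>M)"
    using AE_finite_points[OF A] by (intro nn_integral_cong_AE) (auto simp: suminf_of_bool_distinct_pairs)
  finally show ?thesis .
qed

text \<open>Pointwise, the double sum is the product of the two vertex counts, which are almost
  surely finite because the sets are bounded.\<close>

lemma intensity_prod:
  assumes A: "A \<in> sets borel" "bounded A" and B: "B \<in> sets borel" "bounded B" and disj: "A \<inter> B = {}"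
  shows "(\<Sum>i. \<Sum>j. pr (\<lambda>\<omega>. X i \<omega> \<in> A \<and> X j \<omega> \<in> B)) = intensity A * intensity B"
proof -
  note [measurable] = A(1) B(1)
  have "(\<Sum>i. \<Sum>j. pr (\<lambda>\<omega>. X i \<omega> \<in> A \<and> X j \<omega> \<in> B))
      = (\<integral>\<^sup>+\<omega>. (\<Sum>i. \<Sum>j. of_bool (X i \<omega> \<in> A \<and> X j \<omega> \<in> B)) \<partial>M)"
    by (rule suminf_pr2) measurable
  also have "\<dots> = (\<integral>\<^sup>+\<omega>. of_nat (card {i. X i \<omega> \<in> A}) * of_nat (card {i. X i \<omega> \<in> B}) \<partial>M)"
  proof (rule nn_integral_cong_AE)
    show "AE \<omega> in M. (\<Sum>i. \<Sum>j. of_bool (X i \<omega> \<in> A \<and> X j \<omega> \<in> B))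
        = (of_nat (card {i. X i \<omega> \<in> A}) * of_nat (card {i. X i \<omega> \<in> B}) :: ennreal)"
      using AE_finite_points[OF A] AE_finite_points[OF B]
      by eventually_elim (simp only: of_bool_conj ennreal_suminf_cmult ennreal_suminf_multc suminf_of_bool_finite)
  qed
  also have "\<dots> = intensity A * intensity B"
    unfolding intensity_eq[OF A] intensity_eq[OF B] by (rule nn_integral_card_indep[OF A B disj])
  finally show ?thesis .
qed

lemma intensity_prod_pair:
  assumes A: "A \<in> sets borel" "bounded A" and B: "B \<in> sets borel" "bounded B" and disj: "A \<inter> B = {}"
  shows "(\<Sum>i. \<Sum>j. \<Sum>j'. pr (\<lambda>\<omega>. X i \<omega> \<in> A \<and> X j \<omega> \<in> B \<and> X j' \<omega> \<in> B \<and> j \<noteq> j'))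
    = intensity A * pair_intensity B"
proof -
  note [measurable] = A(1) B(1)
  have "(\<Sum>i. \<Sum>j. \<Sum>j'. pr (\<lambda>\<omega>. X i \<omega> \<in> A \<and> X j \<omega> \<in> B \<and> X j' \<omega> \<in> B \<and> j \<noteq> j'))
      = (\<integral>\<^sup>+\<omega>. (\<Sum>i. \<Sum>j. \<Sum>j'. of_bool (X i \<omega> \<in> A \<and> X j \<omega> \<in> B \<and> X j' \<omega> \<in> B \<and> j \<noteq> j')) \<partial>M)"
    by (rule suminf_pr3) measurable
  also have "\<dots> = (\<integral>\<^sup>+\<omega>. of_nat (card {i. X i \<omega> \<in> A}) *
      of_nat (card {i. X i \<omega> \<in> B} * (card {i. X i \<omega> \<in> B} - 1)) \<partial>M)"
  proof (rule nn_integral_cong_AE)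
    show "AE \<omega> in M. (\<Sum>i. \<Sum>j. \<Sum>j'. of_bool (X i \<omega> \<in> A \<and> X j \<omega> \<in> B \<and> X j' \<omega> \<in> B \<and> j \<noteq> j'))
        = (of_nat (card {i. X i \<omega> \<in> A}) * of_nat (card {i. X i \<omega> \<in> B} * (card {i. X i \<omega> \<in> B} - 1)) :: ennreal)"
      using AE_finite_points[OF A] AE_finite_points[OF B]
    proof eventually_elim
      case (elim \<omega>)
      show ?case
        unfolding of_bool_conj[of "_ \<in> A"] ennreal_suminf_cmult ennreal_suminf_multc
          suminf_of_bool_finite[OF elim(1)] suminf_of_bool_distinct_pairs[OF elim(2)] ..
    qed
  qed
  also have "\<dots> = intensity A * pair_intensity B"
    unfolding intensity_eq[OF A] pair_intensity_eq[OF B]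
    using nn_integral_card_indep[OF A B disj, of of_nat "\<lambda>n. of_nat (n * (n - 1))"] by simp
  finally show ?thesis .
qed

lemma lattice_intensity:
  assumes "V = Lattice" and A: "A \<in> sets borel" "bounded A"
  shows "intensity A = of_nat (card {x\<in>A. \<forall>a. x $ a \<in> \<int>})"
    and "pair_intensity A = of_nat (card {x\<in>A. \<forall>a. x $ a \<in> \<int>} * (card {x\<in>A. \<forall>a. x $ a \<in> \<int>} - 1))"
proof -
  obtain z where z: "bij_betw z UNIV {x :: real^'d. \<forall>a. x $ a \<in> \<int>}"
    "\<And>i \<omega>. \<omega> \<in> space M \<Longrightarrow> X i \<omega> = z i"
    using lattice_obtain[OF assms(1)] by blast
  have c: "card {i. X i \<omega> \<in> A} = card {x\<in>A. \<forall>a. x $ a \<in> \<int>}" if "\<omega> \<in> space M" for \<omega>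
    using lattice_card(2)[OF z(1) A(2)] z(2)[OF that] by simp
  show "intensity A = of_nat (card {x\<in>A. \<forall>a. x $ a \<in> \<int>})"
    unfolding intensity_eq[OF A] using c
    by (subst nn_integral_cong[where v="\<lambda>_. of_nat (card {x\<in>A. \<forall>a. x $ a \<in> \<int>})"])
      (auto simp: emeasure_space_1)
  show "pair_intensity A = of_nat (card {x\<in>A. \<forall>a. x $ a \<in> \<int>} * (card {x\<in>A. \<forall>a. x $ a \<in> \<int>} - 1))"
    unfolding pair_intensity_eq[OF A] using c
    by (subst nn_integral_cong[where v="\<lambda>_. of_nat (card {x\<in>A. \<forall>a. x $ a \<in> \<int>} * (card {x\<in>A. \<forall>a. x $ a \<in> \<int>} - 1))"])
      (auto simp: emeasure_space_1)
qed

lemma poisson_intensity: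
  assumes "V = Poisson" and A: "A \<in> sets borel" "bounded A" and pos: "0 < emeasure lborel A"
  shows "intensity A = emeasure lborel A" and "pair_intensity A = (emeasure lborel A)\<^sup>2"
proof -
  let ?N = "\<lambda>\<omega>. card {i. X i \<omega> \<in> A}"
  have fin: "emeasure lborel A < \<infinity>" using bounded_emeasure_lborel_finite[OF A(2)] .
  have pos': "0 < measure lborel A" and eq: "emeasure lborel A = ennreal (measure lborel A)"
    using pos fin by (auto simp: emeasure_eq_ennreal_measure zero_less_measure_iff)
  note pp = X_poisson[OF assms(1), unfolded poisson_points_def]
  have d: "distr M (count_space UNIV) ?N = measure_pmf (poisson_pmf (measure lborel A))"
    using pp A pos fin by blast
  \<comment> \<open>The law of the count is prescribed through \<open>distr\<close>, which does not
    by itself make the count measurable; independence of the family consisting of \<open>A\<close>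
    alone does.\<close>
  have "indep_vars (\<lambda>_. count_space UNIV) (\<lambda>(m::nat) \<omega>. ?N \<omega>) {..<1}"
    using A by (intro poisson_card_indep assms(1)) (auto simp: disjoint_family_on_def)
  then have m: "?N \<in> measurable M (count_space UNIV)"
    by (auto simp: indep_vars_def)
  have *: "(\<integral>\<^sup>+\<omega>. f (?N \<omega>) \<partial>M) = (\<integral>\<^sup>+n. f n \<partial>measure_pmf (poisson_pmf (measure lborel A)))" for f :: "nat \<Rightarrow> ennreal"
    unfolding d[symmetric] by (rule nn_integral_distr[OF m, symmetric]) simp
  show "intensity A = emeasure lborel A"
    unfolding intensity_eq[OF A] *[of of_nat] poisson_pmf_mean[OF pos'] eq ..
  show "pair_intensity A = (emeasure lborel A)\<^sup>2"
    unfolding pair_intensity_eq[OF A] *[of "\<lambda>n. of_nat (n * (n - 1))"]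
      poisson_pmf_factorial_moment2[OF pos'] eq ..
qed

section \<open>Intensity of cuboids\<close>

lemma intensity_mono:
  assumes "A \<subseteq> B" "B \<in> sets borel"
  shows "intensity A \<le> intensity B"
proof -
  note [measurable] = assms(2)
  show ?thesis
    unfolding intensity_def using assms(1)
    by (intro ennreal_suminf_mono emeasure_mono) auto
qed

text \<open>An interval of length l contains at most l + 1 integers, and the volume is below the
  same product. Strict inequalities give positive volume, as the prescribed Poisson law of the count
  requires.\<close>

lemma intensity_cbox_le:
  assumes "\<And>i. a $ i < b $ i"
  shows "intensity (cbox a b) \<le> ennreal (\<Prod>i\<in>UNIV. b $ i - a $ i + 1)"
proof (cases V)
  case Lattice
  have "real (nat (\<lfloor>b $ i\<rfloor> - \<lceil>a $ i\<rceil> + 1)) \<le> b $ i - a $ i + 1" for i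
    using assms[of i] by linarith
  then have "(\<Prod>i\<in>UNIV. real (nat (\<lfloor>b $ i\<rfloor> - \<lceil>a $ i\<rceil> + 1))) \<le> (\<Prod>i\<in>UNIV. b $ i - a $ i + 1)"
    by (intro prod_mono) auto
  then show ?thesis
    by (simp add: lattice_intensity[OF Lattice] bounded_cbox card_Ints_cbox ennreal_of_nat_eq_real_of_nat
        ennreal_leI)
next
  case Poisson
  have "0 < (\<Prod>i\<in>UNIV. b $ i - a $ i)"
    using assms by (intro prod_pos) auto
  then have "intensity (cbox a b) = ennreal (\<Prod>i\<in>UNIV. b $ i - a $ i)"
    using assms by (subst poisson_intensity[OF Poisson]) (auto simp: emeasure_lborel_cbox_cart less_imp_le bounded_cbox)
  also have "\<dots> \<le> ennreal (\<Prod>i\<in>UNIV. b $ i - a $ i + 1)"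
    using assms by (intro ennreal_leI prod_mono) (auto simp: less_imp_le)
  finally show ?thesis .
qed

text \<open>An interval of length l contains at least l - 1 integers; sides of length at least one
  keep all factors nonnegative.\<close>

lemma intensity_cbox_ge:
  assumes "\<And>i. a $ i + 1 \<le> b $ i"
  shows "ennreal (\<Prod>i\<in>UNIV. b $ i - a $ i - 1) \<le> intensity (cbox a b)"
proof (cases V)
  case Lattice
  have "b $ i - a $ i - 1 \<le> real (nat (\<lfloor>b $ i\<rfloor> - \<lceil>a $ i\<rceil> + 1))" for i
    using assms[of i] by linarith
  then have "(\<Prod>i\<in>UNIV. b $ i - a $ i - 1) \<le> (\<Prod>i\<in>UNIV. real (nat (\<lfloor>b $ i\<rfloor> - \<lceil>a $ i\<rceil> + 1)))"
    using assms by (intro prod_mono) (auto simp: algebra_simps)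
  then show ?thesis
    by (simp add: lattice_intensity[OF Lattice] bounded_cbox card_Ints_cbox ennreal_of_nat_eq_real_of_nat
        ennreal_leI)
next
  case Poisson
  have lt: "a $ i < b $ i" for i using assms[of i] by linarith
  have "0 < (\<Prod>i\<in>UNIV. b $ i - a $ i)"
    using lt by (intro prod_pos) auto
  then have "intensity (cbox a b) = ennreal (\<Prod>i\<in>UNIV. b $ i - a $ i)"
    using lt by (subst poisson_intensity[OF Poisson]) (auto simp: emeasure_lborel_cbox_cart less_imp_le bounded_cbox)
  moreover have "(\<Prod>i\<in>UNIV. b $ i - a $ i - 1) \<le> (\<Prod>i\<in>UNIV. b $ i - a $ i)"
    using assms by (intro prod_mono) (auto simp: algebra_simps)
  ultimately show ?thesis by (simp add: ennreal_leI)
qed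

lemma intensity_finite:
  assumes "bounded A"
  shows "intensity A < \<infinity>"
proof -
  from bounded_subset_cbox_symmetric[OF assms] obtain a where a: "A \<subseteq> cbox (-a) a" by blast
  \<comment> \<open>Enlarged so that no side of the cuboid is degenerate.\<close>
  define b where "b = (\<chi> i. max (a $ i) 1)"
  have "A \<subseteq> cbox (-b) b" 
  proof
    fix x assume "x \<in> A"
    with a have "- a $ i \<le> x $ i \<and> x $ i \<le> a $ i" for i by (auto simp: mem_box_cart)
    moreover have "a $ i \<le> b $ i" for i by (simp add: b_def)
    ultimately have "- b $ i \<le> x $ i \<and> x $ i \<le> b $ i" for i
      by (meson neg_le_iff_le order_trans)
    then show "x \<in> cbox (-b) b" by (simp add: mem_box_cart)
  qed
  then have "intensity A \<le> intensity (cbox (-b) b)" by (intro intensity_mono) auto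
  also have "\<dots> \<le> ennreal (\<Prod>i\<in>UNIV. b $ i - (- b) $ i + 1)"
    by (rule intensity_cbox_le) (auto simp: b_def)
  also have "\<dots> < \<infinity>" by simp
  finally show ?thesis .
qed

lemma pair_intensity_le:
  assumes "\<And>i. a $ i < b $ i"
  shows "pair_intensity (cbox a b) \<le> (intensity (cbox a b))\<^sup>2"
proof (cases V)
  case Lattice
  show ?thesis
    unfolding lattice_intensity[OF Lattice borel_closed[OF closed_cbox] bounded_cbox]
    by (simp only: power2_eq_square of_nat_mult[symmetric] of_nat_le_iff) simp
next
  case Poisson
  have "0 < (\<Prod>i\<in>UNIV. b $ i - a $ i)"
    using assms by (intro prod_pos) auto
  then have "0 < emeasure lborel (cbox a b)"
    using assms by (auto simp: emeasure_lborel_cbox_cart less_imp_le)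
  from poisson_intensity[OF Poisson _ _ this] show ?thesis by (simp add: bounded_cbox)
qed

section \<open>Upper bounds\<close>

lemma emeasure_W_gt_le:
  assumes "\<tau> = ereal t" "1 \<le> w"
  shows "pr (\<lambda>\<omega>. w < W i \<omega>) \<le> ennreal (w powr (- (t - 1)))"
proof -
  have "pr (\<lambda>\<omega>. w < W i \<omega>) \<le> pr (\<lambda>\<omega>. w \<le> W i \<omega>)"
    by (intro emeasure_mono) auto
  also have "\<dots> = ennreal (w powr (- (t - 1)))"
    using W_pareto[of w i] assms by (simp add: emeasure_eq_measure)
  finally show ?thesis .
qed

text \<open>If 2^n \<le> W < 2^(n+1), the power is at most 2^(q' (n+1)), and W \<ge> 2^n has
  probability 2^(-n (t-1)). A geometric series of ratio \<open>\<rho>\<close> < 1 therefore bounds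
  the moment, with the same constant for every index.\<close>

lemma moment_finite:
  assumes "\<tau> = ereal t" "2 < t" "q < t - 1"
  shows "\<exists>K\<ge>0. \<forall>i. (\<integral>\<^sup>+\<omega>. ennreal (W i \<omega> powr q) \<partial>M) \<le> ennreal K"
proof -
  \<comment> \<open>A nonnegative exponent makes the power increasing in the mark, and for marks at
    least one it only enlarges the moment.\<close>
  define q' where "q' = max q 0"
  have q': "q' \<ge> 0" "q' < t - 1" "q \<le> q'" using assms by (auto simp: q'_def)
  define \<rho> where "\<rho> = 2 powr (q' - (t - 1))"
  have \<rho>: "0 < \<rho>" "\<rho> < 1" using q' powr_less_mono[of "q' - (t - 1)" 0 2] by (auto simp: \<rho>_def)
  have "(\<integral>\<^sup>+\<omega>. ennreal (W i \<omega> powr q) \<partial>M) \<le> ennreal (2 powr q' * (1 / (1 - \<rho>)))" for i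
  proof -
    have "AE \<omega> in M. ennreal (W i \<omega> powr q) \<le>
        (\<Sum>n. ennreal (2 powr (q' * real (Suc n))) * of_bool (2 ^ n \<le> W i \<omega>))"
      using AE_W_ge_1[of i]
    proof (rule AE_mp)
      show "2 < \<tau>" using assms by simp
      show "AE \<omega> in M. 1 \<le> W i \<omega> \<longrightarrow> ennreal (W i \<omega> powr q) \<le>
        (\<Sum>n. ennreal (2 powr (q' * real (Suc n))) * of_bool (2 ^ n \<le> W i \<omega>))"
      proof (intro AE_I2 impI)
        fix \<omega> assume W: "1 \<le> W i \<omega>"
        then obtain n where n: "2 ^ n \<le> W i \<omega>" "W i \<omega> < 2 ^ Suc n" by (rule dyadic_interval)
        have "W i \<omega> powr q \<le> W i \<omega> powr q'" using W q' by (intro powr_mono) auto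
        also have "\<dots> \<le> (2 ^ Suc n) powr q'" using n W q' by (intro powr_mono2) auto
        also have "\<dots> = 2 powr (q' * real (Suc n))"
          by (simp add: powr_powr mult.commute del: power_Suc of_nat_Suc flip: powr_realpow)
        finally have "ennreal (W i \<omega> powr q) \<le> ennreal (2 powr (q' * real (Suc n))) * of_bool (2 ^ n \<le> W i \<omega>)"
          using n by (simp add: ennreal_leI del: of_nat_Suc)
        also have "\<dots> \<le> (\<Sum>n. ennreal (2 powr (q' * real (Suc n))) * of_bool (2 ^ n \<le> W i \<omega>))"
          by (rule ennreal_suminf_upper)
        finally show "ennreal (W i \<omega> powr q) \<le> \<dots>" .
      qed
    qed
    then have "(\<integral>\<^sup>+\<omega>. ennreal (W i \<omega> powr q) \<partial>M) \<le>
        (\<integral>\<^sup>+\<omega>. (\<Sum>n. ennreal (2 powr (q' * real (Suc n))) * of_bool (2 ^ n \<le> W i \<omega>)) \<partial>M)"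
      by (rule nn_integral_mono_AE)
    also have "\<dots> = (\<Sum>n. ennreal (2 powr (q' * real (Suc n))) * pr (\<lambda>\<omega>. 2 ^ n \<le> W i \<omega>))"
      by (simp add: nn_integral_suminf nn_integral_cmult emeasure_eq_nn_integral_of_bool)
    also have "\<dots> = (\<Sum>n. ennreal (2 powr q' * \<rho> ^ n))"
    proof (intro arg_cong[where f=suminf] ext)
      fix n
      have "pr (\<lambda>\<omega>. 2 ^ n \<le> W i \<omega>) = ennreal ((2 ^ n) powr (- (t - 1)))"
        using W_pareto[of "2 ^ n" i] assms by (simp add: emeasure_eq_measure)
      moreover have "2 powr (q' * real (Suc n)) * (2 ^ n) powr (- (t - 1)) = 2 powr q' * \<rho> ^ n"
        by (simp add: \<rho>_def powr_powr algebra_simps flip: powr_realpow powr_add)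
      ultimately show "ennreal (2 powr (q' * real (Suc n))) * pr (\<lambda>\<omega>. 2 ^ n \<le> W i \<omega>)
          = ennreal (2 powr q' * \<rho> ^ n)"
        by (simp add: ennreal_mult'[symmetric] del: of_nat_Suc)
    qed
    also have "\<dots> = ennreal (2 powr q' * (1 / (1 - \<rho>)))"
      using \<rho> by (intro suminf_ennreal_eq sums_mult geometric_sums) auto
    finally show ?thesis .
  qed
  moreover have "0 \<le> 2 powr q' * (1 / (1 - \<rho>))" using \<rho> by simp
  ultimately show ?thesis by blast
qed

section \<open>Spatial decay of edge probabilities\<close>

lemma edge_prob_le:
  fixes x y :: "real^'d" and \<gamma> :: real
  assumes "0 < \<gamma>" "ereal \<gamma> \<le> \<alpha>" "1 \<le> v" "v \<le> u" "x \<noteq> y"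
  shows "link_prob x y u v
    \<le> (\<beta> * 2 ^ CARD('d)) powr \<gamma> * u powr \<gamma> * v powr (sigma_of \<kappa> * \<gamma>) * dist x y powr (- (CARD('d) * \<gamma>))"
proof -
  have d: "0 < dist x y" using assms by simp
  have k0: "0 \<le> kernel_val CARD('d) \<kappa> u v"
    using kernel_val_ge[of v u "CARD('d)" \<kappa>] assms sigma_nonneg
    by (intro order_trans[OF _ kernel_val_ge[of v u]]) auto
  let ?s = "\<beta> * kernel_val CARD('d) \<kappa> u v / norm (x - y) ^ CARD('d)"
  have s0: "0 \<le> ?s" using beta_pos k0 by simp
  have "link_prob x y u v \<le> 1 * profile \<alpha> ?s"
    unfolding edge_prob_def using p_le_1 by (intro mult_right_mono) (auto simp: profile_def)
  also have "\<dots> \<le> ?s powr \<gamma>" using profile_le_powr[OF assms(1,2) s0] by simp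
  also have "\<dots> \<le> (\<beta> * (2 ^ CARD('d) * u * v powr sigma_of \<kappa>) / dist x y ^ CARD('d)) powr \<gamma>"
    using s0 assms d beta_pos kernel_val_le[of v u "CARD('d)" \<kappa>]
    by (intro powr_mono2) (auto simp: dist_norm intro!: divide_right_mono mult_left_mono)
  also have "\<dots> = (\<beta> * 2 ^ CARD('d)) powr \<gamma> * u powr \<gamma> * v powr (sigma_of \<kappa> * \<gamma>) * dist x y powr (- (CARD('d) * \<gamma>))"
    using beta_pos assms d
    by (simp add: powr_divide powr_mult powr_powr powr_minus_divide mult_ac flip: powr_realpow)
  finally show ?thesis .
qed

lemma intensity_ball_le:
  assumes "1 \<le> R" "A \<subseteq> ball z R"
  shows "intensity A \<le> ennreal ((3 * R) ^ CARD('d))"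
proof -
  let ?a = "z - (\<chi> i. R)" and ?b = "z + (\<chi> i. R)"
  have "A \<subseteq> cbox ?a ?b"
  proof
    fix x assume "x \<in> A"
    then have "norm (x - z) < R" using assms by (auto simp: dist_norm norm_minus_commute)
    then have "\<bar>(x - z) $ i\<bar> \<le> R" for i using component_le_norm_cart[of "x - z" i] by linarith
    then show "x \<in> cbox ?a ?b" by (auto simp: mem_box_cart abs_le_iff algebra_simps)
  qed
  then have "intensity A \<le> intensity (cbox ?a ?b)" by (intro intensity_mono) auto
  also have "\<dots> \<le> ennreal (\<Prod>i\<in>UNIV. ?b $ i - ?a $ i + 1)"
    using assms by (intro intensity_cbox_le) auto
  also have "\<dots> \<le> ennreal ((3 * R) ^ CARD('d))"
  proof (rule ennreal_leI)
    have "(\<Prod>i\<in>(UNIV::'d set). ?b $ i - ?a $ i + 1) \<le> (\<Prod>i\<in>(UNIV::'d set). 3 * R)"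
      using assms by (intro prod_mono) auto
    then show "(\<Prod>i\<in>(UNIV::'d set). ?b $ i - ?a $ i + 1) \<le> (3 * R) ^ CARD('d)" by simp
  qed
  finally show ?thesis .
qed

text \<open>The location factor that remains of the expected number of edges once the marks have
  been integrated out.\<close>

definition decay_sum :: "real \<Rightarrow> (real^'d) set \<Rightarrow> (real^'d) set \<Rightarrow> ennreal" where
  "decay_sum q A B = (\<Sum>i. \<Sum>j. \<integral>\<^sup>+\<omega>. indicator A (X i \<omega>) *
      (indicator B (X j \<omega>) * ennreal (dist (X i \<omega>) (X j \<omega>) powr (- q))) \<partial>M)"

text \<open>\<open>A\<close> has diameter of order one, so the distance from a point of
  \<open>A\<close> may be replaced by the distance from \<open>z\<close>, which decouples the two
  locations on dyadic shells around \<open>z\<close>. Shell \<open>l\<close> holds at most about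
  (2^l r)^d vertices of weight about (2^l r)^(- d \<gamma>), and \<gamma> > 1 makes the sum over
  shells geometric.\<close>

lemma decay_sum_local_le:
  fixes \<gamma> :: real
  assumes "1 < \<gamma>" and A: "A \<in> sets borel" "A \<subseteq> ball z 1" and B: "B \<in> sets borel"
    and r: "4 \<le> r" "\<And>x y. x \<in> A \<Longrightarrow> y \<in> B \<Longrightarrow> r \<le> dist x y"
  shows "decay_sum (CARD('d) * \<gamma>) A B \<le> ennreal (4 powr (CARD('d) * \<gamma>) * 3 ^ CARD('d) / (1 - 2 powr (- (CARD('d) * (\<gamma> - 1))))
      * r powr (- (CARD('d) * (\<gamma> - 1)))) * intensity A"
proof -
  define d where "d = real CARD('d)"
  have d: "d \<ge> 1" by (simp add: d_def Suc_leI)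
  define \<rho> where "\<rho> = 2 powr (- (d * (\<gamma> - 1)))"
  have \<rho>: "0 < \<rho>" "\<rho> < 1"
    using d assms(1) powr_less_mono[of "- (d * (\<gamma> - 1))" 0 2] by (auto simp: \<rho>_def)
  note [measurable] = A(1) B
  \<comment> \<open>The shells start at r / 2, because points of \<open>B\<close> have distance at
    least r - 1 \<ge> r / 2 from \<open>z\<close>.\<close>
  define S where "S l = {y\<in>B. 2 ^ l * (r / 2) \<le> dist z y \<and> dist z y < 2 ^ Suc l * (r / 2)}" for l :: nat
  have [measurable]: "S l \<in> sets borel" for l
    unfolding S_def by measurable
  have bA: "bounded A" using A(2) bounded_ball bounded_subset by blast
  have SB: "S l \<subseteq> ball z (2 ^ l * r)" "S l \<subseteq> B" for l by (auto simp: S_def)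
  have bS: "bounded (S l)" for l using SB(1) bounded_ball bounded_subset by blast
  have disj: "A \<inter> S l = {}" for l using r SB(2)[of l] by fastforce
  let ?c = "\<lambda>l::nat. (2 ^ l * (r / 4)) powr (- (d * \<gamma>))"
  have pt: "indicator A x * (indicator B y * ennreal (dist x y powr (- (d * \<gamma>))))
      \<le> (\<Sum>l. ennreal (?c l) * (indicator A x * indicator (S l) y))" for x y
  proof (cases "x \<in> A \<and> y \<in> B")
    case True
    then have "dist x z < 1" "r \<le> dist x y" using A(2) r by (auto simp: subset_iff dist_commute)
    then have zy: "r - 1 \<le> dist z y" "dist z y - 1 \<le> dist x y"
      using dist_triangle[of x y z] dist_triangle[of z y x] by (auto simp: dist_commute)
    have "1 \<le> dist z y / (r / 2)" using zy r(1) by simp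
    then obtain l where l: "2 ^ l \<le> dist z y / (r / 2)" "dist z y / (r / 2) < 2 ^ Suc l"
      by (rule dyadic_interval)
    then have l': "2 ^ l * (r / 2) \<le> dist z y" "dist z y < 2 ^ Suc l * (r / 2)"
      using r(1) by (auto simp: field_simps)
    then have "y \<in> S l" using True by (auto simp: S_def)
    \<comment> \<open>Passing from \<open>z\<close> to \<open>x\<close> costs 1, which is at most
      half of the inner radius since r \<ge> 4.\<close>
    have "2 ^ l * (r / 4) \<le> dist x y" using l'(1) zy r(1) by simp
    then have "dist x y powr (- (d * \<gamma>)) \<le> ?c l"
      using r(1) d assms(1) by (intro powr_mono2') auto
    then have "ennreal (dist x y powr (- (d * \<gamma>))) \<le> ennreal (?c l) * (indicator A x * indicator (S l) y)"
      using True \<open>y \<in> S l\<close> by (simp add: ennreal_leI)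
    also have "\<dots> \<le> (\<Sum>l. ennreal (?c l) * (indicator A x * indicator (S l) y))"
      by (rule ennreal_suminf_upper)
    finally show ?thesis using True by simp
  qed auto
  have "decay_sum (d * \<gamma>) A B \<le> (\<Sum>i. \<Sum>j. \<integral>\<^sup>+\<omega>. (\<Sum>l. ennreal (?c l) * (indicator A (X i \<omega>) * indicator (S l) (X j \<omega>))) \<partial>M)"
    unfolding decay_sum_def by (intro ennreal_suminf_mono nn_integral_mono pt)
  also have "\<dots> = (\<Sum>i. \<Sum>j. \<Sum>l. ennreal (?c l) * pr (\<lambda>\<omega>. X i \<omega> \<in> A \<and> X j \<omega> \<in> S l))"
  proof (intro arg_cong[where f=suminf] ext)
    fix i j
    have "(\<integral>\<^sup>+\<omega>. (\<Sum>l. ennreal (?c l) * (indicator A (X i \<omega>) * indicator (S l) (X j \<omega>))) \<partial>M)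
      = (\<Sum>l. \<integral>\<^sup>+\<omega>. ennreal (?c l) * (indicator A (X i \<omega>) * indicator (S l) (X j \<omega>)) \<partial>M)"
      by (rule nn_integral_suminf) measurable
    also have "\<dots> = (\<Sum>l. ennreal (?c l) * pr (\<lambda>\<omega>. X i \<omega> \<in> A \<and> X j \<omega> \<in> S l))"
    proof (intro arg_cong[where f=suminf] ext)
      fix l
      have "(\<integral>\<^sup>+\<omega>. ennreal (?c l) * (indicator A (X i \<omega>) * indicator (S l) (X j \<omega>)) \<partial>M)
        = ennreal (?c l) * (\<integral>\<^sup>+\<omega>. indicator A (X i \<omega>) * indicator (S l) (X j \<omega>) \<partial>M)"
        by (rule nn_integral_cmult) measurable
      also have "(\<integral>\<^sup>+\<omega>. indicator A (X i \<omega>) * indicator (S l) (X j \<omega>) \<partial>M) = (\<integral>\<^sup>+\<omega>. of_bool (X i \<omega> \<in> A \<and> X j \<omega> \<in> S l) \<partial>M)"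
        by (rule nn_integral_cong) (simp add: indicator_def)
      also have "\<dots> = pr (\<lambda>\<omega>. X i \<omega> \<in> A \<and> X j \<omega> \<in> S l)"
        by (rule emeasure_eq_nn_integral_of_bool[symmetric]) measurable
      finally show "(\<integral>\<^sup>+\<omega>. ennreal (?c l) * (indicator A (X i \<omega>) * indicator (S l) (X j \<omega>)) \<partial>M)
        = ennreal (?c l) * pr (\<lambda>\<omega>. X i \<omega> \<in> A \<and> X j \<omega> \<in> S l)" .
    qed
    finally show "(\<integral>\<^sup>+\<omega>. (\<Sum>l. ennreal (?c l) * (indicator A (X i \<omega>) * indicator (S l) (X j \<omega>))) \<partial>M)
      = (\<Sum>l. ennreal (?c l) * pr (\<lambda>\<omega>. X i \<omega> \<in> A \<and> X j \<omega> \<in> S l))" .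
  qed
  also have "\<dots> = (\<Sum>i. \<Sum>l. \<Sum>j. ennreal (?c l) * pr (\<lambda>\<omega>. X i \<omega> \<in> A \<and> X j \<omega> \<in> S l))"
    by (intro arg_cong[where f=suminf] ext ennreal_suminf_swap)
  also have "\<dots> = (\<Sum>l. \<Sum>i. \<Sum>j. ennreal (?c l) * pr (\<lambda>\<omega>. X i \<omega> \<in> A \<and> X j \<omega> \<in> S l))"
    by (rule ennreal_suminf_swap)
  also have "\<dots> = (\<Sum>l. ennreal (?c l) * (intensity A * intensity (S l)))"
    unfolding ennreal_suminf_cmult using intensity_prod[OF A(1) bA _ bS disj] by simp
  also have "\<dots> \<le> (\<Sum>l. ennreal (4 powr (d * \<gamma>) * 3 ^ CARD('d) * r powr (- (d * (\<gamma> - 1))) * \<rho> ^ l) * intensity A)"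
  proof (rule ennreal_suminf_mono)
    fix l :: nat
    have R1: "1 \<le> 2 ^ l * r"
      using r(1) one_le_power[of "2::real" l] mult_mono[of 1 "2^l" 1 r] by simp
    have "intensity (S l) \<le> ennreal ((3 * (2 ^ l * r)) ^ CARD('d))"
      using intensity_ball_le[OF R1 SB(1)] .
    then have "ennreal (?c l) * (intensity A * intensity (S l)) \<le> ennreal (?c l) * (intensity A * ennreal ((3 * (2 ^ l * r)) ^ CARD('d)))"
      by (intro mult_left_mono) auto
    also have "\<dots> = ennreal (?c l * (3 * (2 ^ l * r)) ^ CARD('d)) * intensity A"
      using r(1) by (simp add: ennreal_mult mult_ac)
    also have "?c l * (3 * (2 ^ l * r)) ^ CARD('d) = 4 powr (d * \<gamma>) * 3 ^ CARD('d) * r powr (- (d * (\<gamma> - 1))) * \<rho> ^ l"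
    proof -
      have "?c l = 4 powr (d * \<gamma>) * (2 ^ l * r) powr (- (d * \<gamma>))"
        using r(1) by (simp add: powr_divide powr_mult powr_minus field_simps)
      moreover have "(3 * (2 ^ l * r)) ^ CARD('d) = 3 ^ CARD('d) * (2 ^ l * r) powr d"
        using r(1) by (simp add: power_mult_distrib powr_realpow d_def)
      moreover have "(2 ^ l * r) powr (- (d * \<gamma>)) * (2 ^ l * r) powr d = (2 ^ l * r) powr (- (d * (\<gamma> - 1)))"
        using r(1) by (simp add: powr_add[symmetric] algebra_simps)
      moreover have "(2 ^ l * r) powr (- (d * (\<gamma> - 1))) = r powr (- (d * (\<gamma> - 1))) * \<rho> ^ l"
        using r(1) by (simp add: powr_mult \<rho>_def powr_powr mult_ac flip: powr_realpow)
      ultimately show ?thesis by (simp add: mult_ac)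
    qed
    finally show "ennreal (?c l) * (intensity A * intensity (S l))
      \<le> ennreal (4 powr (d * \<gamma>) * 3 ^ CARD('d) * r powr (- (d * (\<gamma> - 1))) * \<rho> ^ l) * intensity A" .
  qed
  also have "\<dots> = (\<Sum>l. ennreal (4 powr (d * \<gamma>) * 3 ^ CARD('d) * r powr (- (d * (\<gamma> - 1))) * \<rho> ^ l)) * intensity A"
    by (rule ennreal_suminf_multc)
  also have "(\<Sum>l. ennreal (4 powr (d * \<gamma>) * 3 ^ CARD('d) * r powr (- (d * (\<gamma> - 1))) * \<rho> ^ l))
      = ennreal (4 powr (d * \<gamma>) * 3 ^ CARD('d) * r powr (- (d * (\<gamma> - 1))) * (1 / (1 - \<rho>)))"
    using \<rho> by (intro suminf_ennreal_eq sums_mult geometric_sums) auto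
  finally show ?thesis
    by (simp add: d_def \<rho>_def mult_ac)
qed

text \<open>Both sides are countably additive in \<open>A\<close>, and the constant of the local
  bound does not depend on the centre; so \<open>A\<close> is partitioned into pieces lying in unit
  balls.\<close>

lemma decay_sum_le:
  fixes \<gamma> :: real
  assumes "1 < \<gamma>" and A: "A \<in> sets borel" and B: "B \<in> sets borel"
    and r: "4 \<le> r" "\<And>x y. x \<in> A \<Longrightarrow> y \<in> B \<Longrightarrow> r \<le> dist x y"
  shows "decay_sum (CARD('d) * \<gamma>) A B \<le> ennreal (4 powr (CARD('d) * \<gamma>) * 3 ^ CARD('d) / (1 - 2 powr (- (CARD('d) * (\<gamma> - 1))))
      * r powr (- (CARD('d) * (\<gamma> - 1)))) * intensity A"
proof -
  obtain c :: "nat \<Rightarrow> real^'d" where c: "\<And>x. \<exists>n. x \<in> ball (c n) 1"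
    using countable_ball_cover by blast
  define Q where "Q = disjointed (\<lambda>n. ball (c n) 1)"
  have "range Q \<subseteq> sets borel"
    unfolding Q_def by (rule sets.range_disjointed_sets) auto
  then have [measurable]: "Q n \<in> sets borel" for n by auto
  have "disjoint_family Q" unfolding Q_def by (rule disjoint_family_disjointed)
  moreover have "(\<Union>n. Q n) = UNIV" unfolding Q_def UN_disjointed_eq using c by auto
  ultimately have part: "indicator A x = (\<Sum>n. indicator (A \<inter> Q n) x :: ennreal)" for x
    by (subst suminf_indicator) (auto simp: disjoint_family_on_def indicator_def)
  note [measurable] = A B
  have dec: "decay_sum q A B = (\<Sum>n. decay_sum q (A \<inter> Q n) B)" for q
  proof -
    let ?h = "\<lambda>i j \<omega>. indicator B (X j \<omega>) * ennreal (dist (X i \<omega>) (X j \<omega>) powr (- q))"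
    have "decay_sum q A B = (\<Sum>i. \<Sum>j. \<integral>\<^sup>+\<omega>. (\<Sum>n. indicator (A \<inter> Q n) (X i \<omega>) * ?h i j \<omega>) \<partial>M)"
      unfolding decay_sum_def by (simp add: part)
    also have "\<dots> = (\<Sum>i. \<Sum>j. \<Sum>n. \<integral>\<^sup>+\<omega>. indicator (A \<inter> Q n) (X i \<omega>) * ?h i j \<omega> \<partial>M)"
      by (intro arg_cong[where f=suminf] ext nn_integral_suminf) measurable
    also have "\<dots> = (\<Sum>i. \<Sum>n. \<Sum>j. \<integral>\<^sup>+\<omega>. indicator (A \<inter> Q n) (X i \<omega>) * ?h i j \<omega> \<partial>M)"
      by (intro arg_cong[where f=suminf] ext ennreal_suminf_swap)
    also have "\<dots> = (\<Sum>n. decay_sum q (A \<inter> Q n) B)"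
      unfolding decay_sum_def by (rule ennreal_suminf_swap)
    finally show ?thesis .
  qed
  have int: "intensity A = (\<Sum>n. intensity (A \<inter> Q n))"
  proof -
    have *: "intensity S = (\<Sum>i. \<integral>\<^sup>+\<omega>. indicator S (X i \<omega>) \<partial>M)" if "S \<in> sets borel" for S
      unfolding intensity_def indicator_def using that
      by (subst emeasure_eq_nn_integral_of_bool) simp_all
    have "intensity A = (\<Sum>i. \<integral>\<^sup>+\<omega>. (\<Sum>n. indicator (A \<inter> Q n) (X i \<omega>)) \<partial>M)"
      by (simp add: * part)
    also have "\<dots> = (\<Sum>i. \<Sum>n. \<integral>\<^sup>+\<omega>. indicator (A \<inter> Q n) (X i \<omega>) \<partial>M)"
      by (intro arg_cong[where f=suminf] ext nn_integral_suminf) measurable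
    also have "\<dots> = (\<Sum>n. intensity (A \<inter> Q n))"
      by (subst ennreal_suminf_swap) (simp add: *)
    finally show ?thesis .
  qed
  let ?K = "ennreal (4 powr (CARD('d) * \<gamma>) * 3 ^ CARD('d) / (1 - 2 powr (- (CARD('d) * (\<gamma> - 1))))
      * r powr (- (CARD('d) * (\<gamma> - 1))))"
  have "Q n \<subseteq> ball (c n) 1" for n unfolding Q_def by (rule disjointed_subset)
  then have "decay_sum (CARD('d) * \<gamma>) (A \<inter> Q n) B \<le> ?K * intensity (A \<inter> Q n)" for n
    using r by (intro decay_sum_local_le[where z="c n"] assms(1)) auto
  then have "decay_sum (CARD('d) * \<gamma>) A B \<le> (\<Sum>n. ?K * intensity (A \<inter> Q n))"
    unfolding dec by (rule ennreal_suminf_mono)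
  then show ?thesis unfolding int by simp
qed

text \<open>\<open>C\<close> is chosen before the set, the box, the distance and the threshold,
  which are fixed only later. The tail is kept as an arbitrary bound \<open>T\<close>, so that
  Pareto marks and constant marks (T = 0 at threshold 1) use the same statement.\<close>

lemma down_count_truncation:
  fixes \<gamma> \<mu> s K1 K2 :: real
  assumes \<tau>: "2 < \<tau>" and \<gamma>: "1 < \<gamma>" "ereal \<gamma> \<le> \<alpha>" and "0 \<le> \<mu>" "0 \<le> s"
    and K1: "0 \<le> K1" "\<And>i. (\<integral>\<^sup>+\<omega>. ennreal (W i \<omega> powr (\<gamma> + \<mu> - s)) \<partial>M) \<le> ennreal K1"
    and K2: "0 \<le> K2" "\<And>i. (\<integral>\<^sup>+\<omega>. ennreal (W i \<omega> powr (sigma_of \<kappa> * \<gamma> - \<mu>)) \<partial>M) \<le> ennreal K2"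
  shows "\<exists>C\<ge>0. \<forall>A k r t T. A \<in> sets borel \<longrightarrow> 4 \<le> r \<longrightarrow> 1 \<le> t \<longrightarrow>
      (\<forall>x\<in>A. \<forall>y. y \<notin> vol_box k \<longrightarrow> r \<le> dist x y) \<longrightarrow>
      (\<forall>i. pr (\<lambda>\<omega>. t < W i \<omega>) \<le> T) \<longrightarrow>
      down_count A k \<le> intensity A * (T + ennreal (C * t powr s * r powr (- (CARD('d) * (\<gamma> - 1)))))"
proof -
  define d where "d = real CARD('d)"
  define C0 where "C0 = (\<beta> * 2 ^ CARD('d)) powr \<gamma>"
  define C1 where "C1 = 4 powr (d * \<gamma>) * 3 ^ CARD('d) / (1 - 2 powr (- (d * (\<gamma> - 1))))"
  have C0: "0 \<le> C0" by (simp add: C0_def)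
  have d: "d \<ge> 1" by (simp add: d_def Suc_leI)
  have "2 powr (- (d * (\<gamma> - 1))) < 1"
    using d \<gamma>(1) powr_less_mono[of "- (d * (\<gamma> - 1))" 0 2] by simp
  then have C1: "0 \<le> C1" by (simp add: C1_def)
  have "down_count A k \<le> intensity A * (T + ennreal (C0 * K1 * K2 * C1 * t powr s * r powr (- (d * (\<gamma> - 1)))))"
    if A: "A \<in> sets borel" and r: "4 \<le> r" and t: "1 \<le> t"
      and dist: "\<And>x y. x \<in> A \<Longrightarrow> y \<notin> vol_box k \<Longrightarrow> r \<le> dist x y"
      and T: "\<And>i. pr (\<lambda>\<omega>. t < W i \<omega>) \<le> T" for A k r t T
  proof -
    let ?B = "- vol_box k :: (real^'d) set"
    have B: "?B \<in> sets borel" by simp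
    note [measurable] = A B
    let ?Q = "\<lambda>i j (x::nat \<Rightarrow> real^'d) (w::nat \<Rightarrow> real). x i \<in> A \<and> x j \<in> ?B \<and> w j \<le> w i \<and> w i \<le> t"
    let ?I = "\<lambda>i j. \<integral>\<^sup>+\<omega>. indicator A (X i \<omega>) *
      (indicator ?B (X j \<omega>) * ennreal (dist (X i \<omega>) (X j \<omega>) powr (- (d * \<gamma>)))) \<partial>M"
    have large: "pr (\<lambda>\<omega>. X i \<omega> \<in> A \<and> t < W i \<omega>) \<le> pr (\<lambda>\<omega>. X i \<omega> \<in> A) * T" for i
    proof -
      have "pr (\<lambda>\<omega>. X i \<omega> \<in> A \<and> t < W i \<omega>) = (\<integral>\<^sup>+\<omega>. of_bool (X i \<omega> \<in> A \<and> t < W i \<omega>) \<partial>M)"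
        by (rule emeasure_eq_nn_integral_of_bool) measurable
      also have "\<dots> = (\<integral>\<^sup>+\<omega>. of_bool (X i \<omega> \<in> A) * (\<Prod>i\<in>{i}. of_bool (t < W i \<omega>)) \<partial>M)"
        by (rule nn_integral_cong) simp
      also have "\<dots> = (\<integral>\<^sup>+\<omega>. of_bool (X i \<omega> \<in> A) \<partial>M) * (\<Prod>i\<in>{i}. \<integral>\<^sup>+\<omega>. of_bool (t < W i \<omega>) \<partial>M)"
        by (rule nn_integral_locations_marks[where f="\<lambda>x. of_bool (x i \<in> A)" and g="\<lambda>_ w. of_bool (t < w)"]) measurable
      also have "\<dots> = pr (\<lambda>\<omega>. X i \<omega> \<in> A) * pr (\<lambda>\<omega>. t < W i \<omega>)"
        by (simp add: emeasure_eq_nn_integral_of_bool)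
      also have "\<dots> \<le> pr (\<lambda>\<omega>. X i \<omega> \<in> A) * T"
        using T by (intro mult_left_mono) auto
      finally show ?thesis .
    qed
    have small: "pr (\<lambda>\<omega>. at_vertices (?Q i j) \<omega> \<and> E i j \<omega>)
        \<le> ennreal (C0 * t powr s * K1 * K2) * ?I i j" for i j
    proof (cases "i = j")
      case True
      then have "{\<omega> \<in> space M. at_vertices (?Q i j) \<omega> \<and> E i j \<omega>} = {}"
        using E_irrefl by auto
      then show ?thesis by (simp only: emeasure_empty zero_le)
    next
      case False
      \<comment> \<open>The powers of the larger and the smaller mark after the inserted factors
        have been distributed.\<close>
      let ?q = "\<lambda>k. if k = i then \<gamma> + \<mu> - s else sigma_of \<kappa> * \<gamma> - \<mu>"
      let ?f = "\<lambda>x::nat \<Rightarrow> real^'d. indicator A (x i) * (indicator ?B (x j) * ennreal (dist (x i) (x j) powr (- (d * \<gamma>))))"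
      have "pr (\<lambda>\<omega>. at_vertices (?Q i j) \<omega> \<and> E i j \<omega>)
        = (\<integral>\<^sup>+\<omega>. of_bool (at_vertices (?Q i j) \<omega>) *
          ennreal (link_prob_at i j \<omega>) \<partial>M)"
        by (rule emeasure_edge[OF _ False]) (unfold split_beta, measurable)
      also have "\<dots> \<le> (\<integral>\<^sup>+\<omega>. ennreal (C0 * t powr s) * (?f (\<lambda>i. X i \<omega>) * (\<Prod>k\<in>{i, j}. ennreal (W k \<omega> powr ?q k))) \<partial>M)"
      proof (rule nn_integral_mono_AE)
        show "AE \<omega> in M. of_bool (at_vertices (?Q i j) \<omega>) *
            ennreal (link_prob_at i j \<omega>)
          \<le> ennreal (C0 * t powr s) * (?f (\<lambda>i. X i \<omega>) * (\<Prod>k\<in>{i, j}. ennreal (W k \<omega> powr ?q k)))"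
          using AE_W_ge_1[OF \<tau>, of i] AE_W_ge_1[OF \<tau>, of j]
        proof eventually_elim
          case (elim \<omega>)
          let ?x = "X i \<omega>" and ?y = "X j \<omega>" and ?u = "W i \<omega>" and ?v = "W j \<omega>"
          show ?case
          proof (cases "at_vertices (?Q i j) \<omega>")
            case True
            then have xy: "?x \<noteq> ?y" using dist[of ?x ?y] r by auto
            have "link_prob ?x ?y ?u ?v
                \<le> C0 * ?u powr \<gamma> * ?v powr (sigma_of \<kappa> * \<gamma>) * dist ?x ?y powr (- (d * \<gamma>))"
              unfolding C0_def d_def using True elim \<gamma> xy by (intro edge_prob_le) auto
            also have "\<dots> \<le> C0 * ?u powr \<gamma> * ?v powr (sigma_of \<kappa> * \<gamma>) * dist ?x ?y powr (- (d * \<gamma>))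
                * ((?u / ?v) powr \<mu> * (t / ?u) powr s)"
            proof -
              have "1 \<le> (?u / ?v) powr \<mu>" "1 \<le> (t / ?u) powr s"
                using True elim assms by (auto intro!: ge_one_powr_ge_zero)
              then have "1 * 1 \<le> (?u / ?v) powr \<mu> * (t / ?u) powr s" by (intro mult_mono) auto
              moreover have "0 \<le> C0 * ?u powr \<gamma> * ?v powr (sigma_of \<kappa> * \<gamma>) * dist ?x ?y powr (- (d * \<gamma>))"
                using C0 by simp
              ultimately show ?thesis
                using mult_left_mono[of 1 "(?u / ?v) powr \<mu> * (t / ?u) powr s"] by simp
            qed
            also have "\<dots> = C0 * t powr s * (dist ?x ?y powr (- (d * \<gamma>)) * (?u powr (\<gamma> + \<mu> - s) * ?v powr (sigma_of \<kappa> * \<gamma> - \<mu>)))"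
              using elim t by (simp add: powr_divide powr_diff powr_add mult_ac)
            finally have "ennreal (link_prob ?x ?y ?u ?v) \<le> ennreal \<dots>" by (rule ennreal_leI)
            then show ?thesis using True False C0 t by (simp add: ennreal_mult mult_ac)
          next
            case no: False
            have "of_bool (at_vertices (?Q i j) \<omega>) = (0::ennreal)"
              using no by (simp only: of_bool_eq_0_iff not_False_eq_True)
            then show ?thesis by (simp only: mult_zero_left zero_le)
          qed
        qed
      qed
      also have "\<dots> = ennreal (C0 * t powr s) * (?I i j * (\<Prod>k\<in>{i, j}. \<integral>\<^sup>+\<omega>. ennreal (W k \<omega> powr ?q k) \<partial>M))"
      proof -
        have eq: "(\<integral>\<^sup>+\<omega>. ?f (\<lambda>i. X i \<omega>) * (\<Prod>k\<in>{i, j}. ennreal (W k \<omega> powr ?q k)) \<partial>M)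
          = ?I i j * (\<Prod>k\<in>{i, j}. \<integral>\<^sup>+\<omega>. ennreal (W k \<omega> powr ?q k) \<partial>M)"
          by (rule nn_integral_locations_marks[where f="?f" and g="\<lambda>k w. ennreal (w powr ?q k)"]) measurable
        show ?thesis unfolding eq[symmetric] by (rule nn_integral_cmult) measurable
      qed
      also have "\<dots> \<le> ennreal (C0 * t powr s) * (?I i j * (ennreal K1 * ennreal K2))"
        using False K1 K2 by (intro mult_left_mono) (auto intro!: mult_mono)
      also have "\<dots> = ennreal (C0 * t powr s * K1 * K2) * ?I i j"
        using K1 K2 C0 by (simp add: ennreal_mult mult_ac)
      finally show ?thesis .
    qed
    have "down_count A k \<le> (\<Sum>i. pr (\<lambda>\<omega>. X i \<omega> \<in> A) * T + (\<Sum>j. ennreal (C0 * t powr s * K1 * K2) * ?I i j))"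
      unfolding down_count_def
    proof (rule ennreal_suminf_mono)
      fix i
      let ?S = "\<lambda>j. {\<omega> \<in> space M. at_vertices (?Q i j) \<omega> \<and> E i j \<omega>}"
      let ?L = "{\<omega> \<in> space M. X i \<omega> \<in> A \<and> t < W i \<omega>}"
      have [measurable]: "?S j \<in> sets M" "?L \<in> sets M" for j by measurable
      have "pr (\<lambda>\<omega>. X i \<omega> \<in> A \<and> down_edge_out X W E k \<omega> i) \<le> emeasure M (?L \<union> (\<Union>j. ?S j))"
        by (rule emeasure_mono) (auto simp: down_edge_out_def not_le)
      also have "\<dots> \<le> emeasure M ?L + emeasure M (\<Union>j. ?S j)"
        by (rule emeasure_subadditive) auto
      also have "\<dots> \<le> emeasure M ?L + (\<Sum>j. emeasure M (?S j))"
        by (intro add_left_mono emeasure_subadditive_countably) auto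
      also have "\<dots> \<le> pr (\<lambda>\<omega>. X i \<omega> \<in> A) * T + (\<Sum>j. ennreal (C0 * t powr s * K1 * K2) * ?I i j)"
        by (intro add_mono large ennreal_suminf_mono small)
      finally show "pr (\<lambda>\<omega>. X i \<omega> \<in> A \<and> down_edge_out X W E k \<omega> i)
        \<le> pr (\<lambda>\<omega>. X i \<omega> \<in> A) * T + (\<Sum>j. ennreal (C0 * t powr s * K1 * K2) * ?I i j)" .
    qed
    also have "\<dots> = intensity A * T + ennreal (C0 * t powr s * K1 * K2) * decay_sum (d * \<gamma>) A ?B"
      unfolding ennreal_suminf_add ennreal_suminf_cmult ennreal_suminf_multc intensity_def decay_sum_def ..
    also have "\<dots> \<le> intensity A * T + ennreal (C0 * t powr s * K1 * K2) * (ennreal (C1 * r powr (- (d * (\<gamma> - 1)))) * intensity A)"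
      unfolding C1_def d_def using dist
      by (intro add_left_mono mult_left_mono decay_sum_le \<gamma>(1) A B r) auto
    also have "\<dots> = intensity A * (T + ennreal (C0 * K1 * K2 * C1 * t powr s * r powr (- (d * (\<gamma> - 1)))))"
      using C0 C1 K1 K2 by (simp add: ennreal_mult distrib_left mult_ac)
    finally show ?thesis .
  qed
  then show ?thesis unfolding d_def using C0 C1 K1(1) K2(1)
    by (intro exI[of _ "C0 * K1 * K2 * C1"] conjI allI impI) auto
qed

text \<open>The threshold is tied to the distance r so that neither the mark tail nor the truncated
  edge bound exceeds the order r^(- d (1 - \<eta>)). Constant marks use the threshold 1, which is
  almost surely never exceeded.\<close>

lemma down_count_decay:
  fixes \<eta> :: real
  assumes "1 < \<alpha>" "2 < \<tau>" "0 < \<eta>" "\<eta> < 1"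
    and ll: "zeta_ll \<alpha> < ereal \<eta>" and hl: "zeta_hl \<alpha> \<tau> < ereal \<eta>"
    and hh: "zeta_hh \<alpha> \<tau> (sigma_of \<kappa>) < ereal \<eta>"
  shows "\<exists>C\<ge>0. \<forall>A k r. A \<in> sets borel \<longrightarrow> 4 \<le> r \<longrightarrow>
      (\<forall>x\<in>A. \<forall>y. y \<notin> vol_box k \<longrightarrow> r \<le> dist x y) \<longrightarrow>
      down_count A k \<le> intensity A * ennreal (C * r powr (- (CARD('d) * (1 - \<eta>))))"
proof -
  define d where "d = real CARD('d)"
  have d: "d \<ge> 1" by (simp add: d_def Suc_leI)
  show ?thesis
  proof (cases "\<tau> = \<infinity>")
    case True
    obtain \<gamma> where \<gamma>: "1 < \<gamma>" "ereal \<gamma> \<le> \<alpha>" "1 - \<eta> \<le> \<gamma> - 1"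
    proof (cases "\<alpha> = \<infinity>")
      case True
      \<comment> \<open>Since 1 - \<eta> < 1, the choice \<gamma> - 1 = 1 is large enough.\<close>
      then show ?thesis using that[of 2] assms by simp
    next
      case False
      then obtain a where "\<alpha> = ereal a" using assms(1) by (cases \<alpha>) auto
      then show ?thesis using that[of a] assms(1) ll by (simp add: zeta_ll_def)
    qed
    have W1: "(\<integral>\<^sup>+\<omega>. ennreal (W i \<omega> powr q) \<partial>M) \<le> ennreal 1" for i q
    proof -
      have "(\<integral>\<^sup>+\<omega>. ennreal (W i \<omega> powr q) \<partial>M) = (\<integral>\<^sup>+\<omega>. 1 \<partial>M)"
        using W_const[OF True, of i] by (intro nn_integral_cong_AE) auto
      then show ?thesis by (simp add: emeasure_space_1)
    qed
    obtain C where C: "0 \<le> C" "\<And>A k r t T. A \<in> sets borel \<Longrightarrow> 4 \<le> r \<Longrightarrow> 1 \<le> t \<Longrightarrow>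
      (\<forall>x\<in>A. \<forall>y. y \<notin> vol_box k \<longrightarrow> r \<le> dist x y) \<Longrightarrow>
      (\<forall>i. pr (\<lambda>\<omega>. t < W i \<omega>) \<le> T) \<Longrightarrow>
      down_count A k \<le> intensity A * (T + ennreal (C * t powr 0 * r powr (- (d * (\<gamma> - 1)))))"
      using down_count_truncation[OF assms(2) \<gamma>(1,2), of 0 0 1 1] W1 unfolding d_def by auto
    have W0: "pr (\<lambda>\<omega>. 1 < W i \<omega>) \<le> 0" for i
    proof -
      have "AE \<omega> in M. \<not> 1 < W i \<omega>" using W_const[OF True, of i] by eventually_elim simp
      then show ?thesis by (subst (asm) AE_iff_measurable) auto
    qed
    have "down_count A k \<le> intensity A * ennreal (C * r powr (- (d * (1 - \<eta>))))"
      if A: "A \<in> sets borel" and r: "4 \<le> r" and dist: "\<forall>x\<in>A. \<forall>y. y \<notin> vol_box k \<longrightarrow> r \<le> dist x y" for A k r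
    proof -
      have "down_count A k \<le> intensity A * (0 + ennreal (C * 1 powr 0 * r powr (- (d * (\<gamma> - 1)))))"
        by (rule C(2)[OF A r order_refl dist]) (use W0 in blast)
      also have "\<dots> \<le> intensity A * ennreal (C * r powr (- (d * (1 - \<eta>))))"
        using r d \<gamma> C(1) by (auto intro!: mult_left_mono ennreal_leI powr_mono)
      finally show ?thesis .
    qed
    with C(1) show ?thesis unfolding d_def by blast
  next
    case False
    then obtain t where t: "\<tau> = ereal t" "2 < t" using assms(2) by (cases \<tau>) auto
    from admissible_decay[OF assms(1) t sigma_nonneg assms(3,4) ll hl hh]
    obtain \<gamma> where \<gamma>: "1 < \<gamma>" "ereal \<gamma> \<le> \<alpha>" "2 - \<gamma> < \<eta>" "(1 - \<eta>) * \<gamma> < (\<gamma> - 1) * (t - 1)"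
      "(1 - \<eta>) * (\<gamma> * (1 + sigma_of \<kappa>) - (t - 1)) < (\<gamma> - 1) * (t - 1)"
      by blast
    from optimal_parameters[OF \<gamma>(1) sigma_nonneg t(2) assms(4) \<gamma>(3-5)]
    obtain l s where l: "0 \<le> l" "0 \<le> s" "\<gamma> + l - s < t - 1" "sigma_of \<kappa> * \<gamma> - l < t - 1"
      "1 - \<eta> \<le> (\<gamma> - 1) - (1 - \<eta>) / (t - 1) * s"
      by blast
    obtain K1 where K1: "0 \<le> K1" "\<And>i. (\<integral>\<^sup>+\<omega>. ennreal (W i \<omega> powr (\<gamma> + l - s)) \<partial>M) \<le> ennreal K1"
      using moment_finite[OF t l(3)] by blast
    obtain K2 where K2: "0 \<le> K2" "\<And>i. (\<integral>\<^sup>+\<omega>. ennreal (W i \<omega> powr (sigma_of \<kappa> * \<gamma> - l)) \<partial>M) \<le> ennreal K2"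
      using moment_finite[OF t l(4)] by blast
    obtain C where C: "0 \<le> C" "\<And>A k r t T. A \<in> sets borel \<Longrightarrow> 4 \<le> r \<Longrightarrow> 1 \<le> t \<Longrightarrow>
      (\<forall>x\<in>A. \<forall>y. y \<notin> vol_box k \<longrightarrow> r \<le> dist x y) \<Longrightarrow>
      (\<forall>i. pr (\<lambda>\<omega>. t < W i \<omega>) \<le> T) \<Longrightarrow>
      down_count A k \<le> intensity A * (T + ennreal (C * t powr s * r powr (- (d * (\<gamma> - 1)))))"
      using down_count_truncation[OF assms(2) \<gamma>(1,2) l(1,2) K1 K2] unfolding d_def by auto
    \<comment> \<open>Solves a (t - 1) = 1 - \<eta>, which gives the threshold r^(d a) the tail r^(-
      d (1 - \<eta>)). Here \<open>t\<close> is \<tau> as a real number, whereas \<open>?t\<close>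
      below is the threshold.\<close>
    define a where "a = (1 - \<eta>) / (t - 1)"
    have a: "0 \<le> a" "a * (t - 1) = 1 - \<eta>" using t assms by (auto simp: a_def)
    have "down_count A k \<le> intensity A * ennreal ((1 + C) * r powr (- (d * (1 - \<eta>))))"
      if A: "A \<in> sets borel" and r: "4 \<le> r" and dist: "\<forall>x\<in>A. \<forall>y. y \<notin> vol_box k \<longrightarrow> r \<le> dist x y" for A k r
    proof -
      let ?t = "r powr (d * a)" and ?T = "r powr (- (d * (1 - \<eta>)))"
      have t1: "1 \<le> ?t" using r d a by (intro ge_one_powr_ge_zero) auto
      have eq: "?t powr (- (t - 1)) = ?T"
        unfolding powr_powr a(2)[symmetric] by (simp add: algebra_simps)
      have "down_count A k \<le> intensity A * (ennreal ?T + ennreal (C * ?t powr s * r powr (- (d * (\<gamma> - 1)))))"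
        using emeasure_W_gt_le[OF t(1) t1] unfolding eq by (intro C(2)[OF A r t1 dist]) blast
      also have "\<dots> \<le> intensity A * (ennreal ?T + ennreal (C * ?T))"
      proof (intro mult_left_mono add_left_mono ennreal_leI)
        have "?t powr s * r powr (- (d * (\<gamma> - 1))) = r powr (- (d * (\<gamma> - 1 - a * s)))"
          using r by (simp add: powr_powr algebra_simps flip: powr_add)
        also have "\<dots> \<le> ?T"
          using l(5) d r by (intro powr_mono) (auto simp: a_def)
        finally show "C * ?t powr s * r powr (- (d * (\<gamma> - 1))) \<le> C * ?T"
          using mult_left_mono[OF _ C(1)] by (simp add: mult.assoc)
      qed auto
      also have "\<dots> = intensity A * ennreal ((1 + C) * ?T)"
        using C(1) by (simp add: distrib_right flip: ennreal_plus)
      finally show ?thesis .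
    qed
    then show ?thesis unfolding d_def using C(1)
      by (intro exI[of _ "1 + C"] conjI allI impI) auto
  qed
qed

section \<open>Comparison and additivity of counts over sets\<close>

lemma down_count_le_intensity:
  assumes "A \<in> sets borel"
  shows "down_count A k \<le> intensity A"
proof -
  note [measurable] = assms
  show ?thesis unfolding down_count_def intensity_def
    by (intro ennreal_suminf_mono emeasure_mono) auto
qed

lemma down_count_mono:
  assumes "A \<subseteq> B" "B \<in> sets borel"
  shows "down_count A k \<le> down_count B k"
proof -
  note [measurable] = assms(2)
  show ?thesis unfolding down_count_def using assms(1)
    by (intro ennreal_suminf_mono emeasure_mono) auto
qed

lemma down_count_disjoint_Un:
  assumes "A \<in> sets borel" "B \<in> sets borel" "A \<inter> B = {}"
  shows "down_count (A \<union> B) k = down_count A k + down_count B k"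
proof -
  note [measurable] = assms(1,2)
  have "down_count (A \<union> B) k = (\<Sum>i. pr (\<lambda>\<omega>. X i \<omega> \<in> A \<and> down_edge_out X W E k \<omega> i)
      + pr (\<lambda>\<omega>. X i \<omega> \<in> B \<and> down_edge_out X W E k \<omega> i))"
    unfolding down_count_def
  proof (intro arg_cong[where f=suminf] ext)
    fix i
    have "{\<omega> \<in> space M. X i \<omega> \<in> A \<union> B \<and> down_edge_out X W E k \<omega> i}
      = {\<omega> \<in> space M. X i \<omega> \<in> A \<and> down_edge_out X W E k \<omega> i} \<union> {\<omega> \<in> space M. X i \<omega> \<in> B \<and> down_edge_out X W E k \<omega> i}"
      by auto
    moreover have "{\<omega> \<in> space M. X i \<omega> \<in> A \<and> down_edge_out X W E k \<omega> i}
      \<inter> {\<omega> \<in> space M. X i \<omega> \<in> B \<and> down_edge_out X W E k \<omega> i} = {}"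
      using assms(3) by blast
    ultimately show "pr (\<lambda>\<omega>. X i \<omega> \<in> A \<union> B \<and> down_edge_out X W E k \<omega> i)
      = pr (\<lambda>\<omega>. X i \<omega> \<in> A \<and> down_edge_out X W E k \<omega> i)
      + pr (\<lambda>\<omega>. X i \<omega> \<in> B \<and> down_edge_out X W E k \<omega> i)"
      by (simp only:) (subst plus_emeasure; simp)
  qed
  also have "\<dots> = down_count A k + down_count B k"
    unfolding down_count_def by (rule ennreal_suminf_add)
  finally show ?thesis .
qed

lemma down_count_Un:
  assumes "A \<in> sets borel" "B \<in> sets borel"
  shows "down_count (A \<union> B) k \<le> down_count A k + down_count B k"
proof -
  have "down_count (A \<union> (B - A)) k = down_count A k + down_count (B - A) k"
    using assms by (intro down_count_disjoint_Un) auto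
  also have "\<dots> \<le> down_count A k + down_count B k"
    using assms by (intro add_left_mono down_count_mono) auto
  finally show ?thesis by simp
qed

lemma intensity_Un:
  assumes "A \<in> sets borel" "B \<in> sets borel"
  shows "intensity (A \<union> B) \<le> intensity A + intensity B"
proof -
  note [measurable] = assms
  have "intensity (A \<union> B) \<le> (\<Sum>i. pr (\<lambda>\<omega>. X i \<omega> \<in> A) + pr (\<lambda>\<omega>. X i \<omega> \<in> B))"
    unfolding intensity_def
  proof (rule ennreal_suminf_mono)
    fix i
    have "{\<omega> \<in> space M. X i \<omega> \<in> A \<union> B} = {\<omega> \<in> space M. X i \<omega> \<in> A} \<union> {\<omega> \<in> space M. X i \<omega> \<in> B}"
      by auto
    then show "pr (\<lambda>\<omega>. X i \<omega> \<in> A \<union> B)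
      \<le> pr (\<lambda>\<omega>. X i \<omega> \<in> A) + pr (\<lambda>\<omega>. X i \<omega> \<in> B)"
      by (simp only:) (rule emeasure_subadditive; measurable)
  qed
  also have "\<dots> = intensity A + intensity B"
    unfolding intensity_def by (rule ennreal_suminf_add)
  finally show ?thesis .
qed

lemma intensity_UN_le:
  assumes "finite I" "\<And>i. i \<in> I \<Longrightarrow> A i \<in> sets borel" "\<And>i. i \<in> I \<Longrightarrow> intensity (A i) \<le> c"
  shows "intensity (\<Union>i\<in>I. A i) \<le> of_nat (card I) * c"
  using assms
proof (induction I rule: finite_induct)
  case empty
  then show ?case by (simp add: intensity_def)
next
  case (insert i I)
  have "intensity (\<Union>j\<in>insert i I. A j) \<le> intensity (A i) + intensity (\<Union>j\<in>I. A j)"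
    using intensity_Un[of "A i" "\<Union>j\<in>I. A j"] insert.prems insert.hyps by (simp add: sets.finite_UN)
  also have "\<dots> \<le> c + of_nat (card I) * c"
    using insert by (intro add_mono) auto
  finally show ?case using insert.hyps by (simp add: distrib_right)
qed

section \<open>Geometry of the box and its boundary layers\<close>

lemma vol_box_eq_cbox:
  "vol_box k = (cbox (- (\<chi> i. k powr (1 / CARD('d)) / 2)) (\<chi> i. k powr (1 / CARD('d)) / 2) :: (real^'d) set)"
proof -
  have "\<bar>t\<bar> \<le> c \<longleftrightarrow> - c \<le> t \<and> t \<le> c" for t c :: real by auto
  then show ?thesis
    by (simp only: set_eq_iff vol_box_def mem_box_cart mem_Collect_eq uminus_vec_def vec_lambda_beta) simp
qed

lemma root_CARD:
  fixes k \<eta> :: real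
  assumes "0 < k"
  shows "(k powr (1 / CARD('d))) ^ CARD('d) = k" "(k powr (1 / CARD('d))) powr (CARD('d) * \<eta>) = k powr \<eta>"
  using assms by (auto simp: powr_powr simp flip: powr_realpow)

lemma intensity_vol_box_le:
  assumes "1 \<le> k"
  shows "intensity (vol_box k) \<le> ennreal (2 ^ CARD('d) * k)"
proof -
  let ?L = "k powr (1 / CARD('d))"
  have L: "1 \<le> ?L" using assms by (intro ge_one_powr_ge_zero) auto
  have "intensity (vol_box k) \<le> ennreal (\<Prod>i\<in>(UNIV::'d set). ?L + 1)"
    unfolding vol_box_eq_cbox using L by (intro order_trans[OF intensity_cbox_le]) auto
  also have "(\<Prod>i\<in>(UNIV::'d set). ?L + 1) \<le> (\<Prod>i\<in>(UNIV::'d set). 2 * ?L)"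
    using L by (intro prod_mono) auto
  also have "\<dots> = 2 ^ CARD('d) * k"
    using assms root_CARD(1)[of k] by (simp add: power_mult_distrib)
  finally show ?thesis by (simp add: ennreal_leI)
qed

lemma vol_box_half_subset: "0 < k \<Longrightarrow> vol_box (k / 2) \<subseteq> (vol_box k :: (real^'d) set)"
proof -
  assume "0 < k"
  then have "(k / 2) powr (1 / CARD('d)) \<le> k powr (1 / CARD('d))"
    by (intro powr_mono2) auto
  then show ?thesis unfolding vol_box_def by (auto intro: order_trans)
qed

lemma long_count_le_star_count: "0 < k \<Longrightarrow> long_count k \<le> star_count k"
  by (intro down_count_mono vol_box_half_subset) auto

lemma star_count_le_powr:
  assumes "1 \<le> k" "1 \<le> \<eta>"
  shows "star_count k \<le> ennreal (2 ^ CARD('d) * k powr \<eta>)"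
proof -
  have "star_count k \<le> intensity (vol_box k)"
    by (rule down_count_le_intensity) simp
  also have "\<dots> \<le> ennreal (2 ^ CARD('d) * k)" using assms(1) by (rule intensity_vol_box_le)
  also have "\<dots> \<le> ennreal (2 ^ CARD('d) * k powr \<eta>)"
    using assms powr_mono[of 1 \<eta> k] by (intro ennreal_leI mult_left_mono) auto
  finally show ?thesis .
qed

text \<open>Some coordinate of \<open>y\<close> lies beyond a face, and that coordinate alone
  provides the distance.\<close>

lemma dist_vol_box_ge:
  fixes x y :: "real^'d"
  assumes "\<And>a. \<bar>x $ a\<bar> \<le> k powr (1 / CARD('d)) / 2 - r" "y \<notin> vol_box k"
  shows "r \<le> dist x y"
proof -
  obtain a where a: "k powr (1 / CARD('d)) / 2 < \<bar>y $ a\<bar>"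
    using assms(2) by (auto simp: vol_box_def not_le)
  have "r \<le> \<bar>(x - y) $ a\<bar>" using a assms(1)[of a] by simp
  also have "\<dots> \<le> dist x y" unfolding dist_norm by (rule component_le_norm_cart)
  finally show ?thesis .
qed

text \<open>There are about k vertices, and each bridges a distance of order k^(1/d) with
  probability of order at most k^(\<eta> - 1). For \<eta> \<ge> 1 the number of vertices is itself a
  sufficient bound.\<close>

lemma long_upper:
  fixes \<eta> :: real
  assumes "1 < \<alpha>" "2 < \<tau>" "0 < \<eta>"
    and "zeta_ll \<alpha> < ereal \<eta>" "zeta_hl \<alpha> \<tau> < ereal \<eta>" "zeta_hh \<alpha> \<tau> (sigma_of \<kappa>) < ereal \<eta>"
  shows "grows_at_most long_count \<eta>"
proof (cases "\<eta> < 1")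
  case False
  have "eventually (\<lambda>k. long_count k \<le> ennreal (2 ^ CARD('d) * k powr \<eta>)) at_top"
    using eventually_ge_at_top[of 1]
  proof eventually_elim
    case (elim k)
    have "long_count k \<le> star_count k" using elim by (intro long_count_le_star_count) simp
    also have "\<dots> \<le> ennreal (2 ^ CARD('d) * k powr \<eta>)" using elim False by (intro star_count_le_powr) auto
    finally show ?case .
  qed
  then show ?thesis by blast
next
  case True
  from down_count_decay[OF assms(1-3) True assms(4-6)] obtain C where C: "0 \<le> C"
    "\<And>A k r. A \<in> sets borel \<Longrightarrow> 4 \<le> r \<Longrightarrow> (\<forall>x\<in>A. \<forall>y. y \<notin> vol_box k \<longrightarrow> r \<le> dist x y) \<Longrightarrow>
    down_count A k \<le> intensity A * ennreal (C * r powr (- (CARD('d) * (1 - \<eta>))))"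
    by blast
  \<comment> \<open>c k^(1/d) is the gap between the faces of the boxes of volume k / 2 and
    k.\<close>
  define c where "c = (1 - 2 powr (- (1 / CARD('d)))) / 2"
  have c: "0 < c" using powr_less_mono[of "- (1 / CARD('d))" 0 2] by (simp add: c_def)
  have ev: "eventually (\<lambda>k::real. 4 \<le> c * k powr (1 / CARD('d))) at_top"
    using c by real_asymp
  have "eventually (\<lambda>k. long_count k
      \<le> ennreal (2 ^ CARD('d) * C * c powr (- (CARD('d) * (1 - \<eta>))) * k powr \<eta>)) at_top"
    using eventually_ge_at_top[of 1] ev
  proof eventually_elim
    case (elim k)
    let ?L = "k powr (1 / CARD('d))"
    have L: "1 \<le> ?L" using elim by (intro ge_one_powr_ge_zero) auto
    have half: "(k / 2) powr (1 / CARD('d)) / 2 = ?L / 2 - c * ?L"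
      using elim by (simp add: c_def powr_divide powr_minus_divide field_simps)
    have "\<forall>x\<in>vol_box (k / 2). \<forall>y. y \<notin> vol_box k \<longrightarrow> c * ?L \<le> dist x (y::real^'d)"
      by (auto intro!: dist_vol_box_ge[of _ k] simp: vol_box_def half)
    from C(2)[OF _ elim(2) this]
    have "long_count k \<le> intensity (vol_box (k / 2)) * ennreal (C * (c * ?L) powr (- (CARD('d) * (1 - \<eta>))))"
      by simp
    also have "\<dots> \<le> ennreal (2 ^ CARD('d) * k) * ennreal (C * (c * ?L) powr (- (CARD('d) * (1 - \<eta>))))"
      using vol_box_half_subset[of k] elim
      by (intro mult_right_mono order_trans[OF intensity_mono intensity_vol_box_le]) auto
    also have "\<dots> = ennreal (2 ^ CARD('d) * C * c powr (- (CARD('d) * (1 - \<eta>))) * k powr \<eta>)"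
    proof -
      have "k * (c * ?L) powr (- (CARD('d) * (1 - \<eta>))) = c powr (- (CARD('d) * (1 - \<eta>))) * (k * k powr (\<eta> - 1))"
      proof -
        have "- (real CARD('d) * (1 - \<eta>)) = CARD('d) * (\<eta> - 1)" by (simp add: algebra_simps)
        then show ?thesis
          using c elim root_CARD(2)[of k "\<eta> - 1"] by (simp add: powr_mult mult_ac)
      qed
      also have "k * k powr (\<eta> - 1) = k powr \<eta>" using elim by (simp add: powr_mult_base)
      finally show ?thesis using elim C(1) by (simp add: mult_ac flip: ennreal_mult)
    qed
    finally show ?case .
  qed
  then show ?thesis by blast
qed

text \<open>The layer is covered by 2 d slabs, one for each axis and sign, with one side of length
  \<rho> and all others of length L.\<close>

lemma intensity_boundary_layer_le:
  fixes k \<rho> L :: real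
  assumes "1 \<le> k" "0 < \<rho>"
  defines "L \<equiv> k powr (1 / CARD('d))"
  shows "intensity {x \<in> vol_box k. \<exists>a. L / 2 - \<rho> < \<bar>x $ a\<bar>}
    \<le> ennreal (2 * CARD('d) * (2 * L) ^ (CARD('d) - 1) * (\<rho> + 1))"
proof -
  have L: "1 \<le> L" unfolding L_def using assms by (intro ge_one_powr_ge_zero) auto
  \<comment> \<open>The flag selects the face at L / 2; without it the slab lies at - L / 2.\<close>
  define lo :: "'d \<times> bool \<Rightarrow> real^'d" where
    "lo = (\<lambda>(a, s). \<chi> i. if i = a \<and> s then L / 2 - \<rho> else - (L / 2))"
  define up :: "'d \<times> bool \<Rightarrow> real^'d" where
    "up = (\<lambda>(a, s). \<chi> i. if i = a \<and> \<not> s then \<rho> - L / 2 else L / 2)"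
  let ?S = "{x \<in> vol_box k. \<exists>a. L / 2 - \<rho> < \<bar>x $ a\<bar>} :: (real^'d) set"
  have "?S \<subseteq> (\<Union>as\<in>UNIV. cbox (lo as) (up as))"
  proof
    fix x assume "x \<in> ?S"
    then obtain a where a: "L / 2 - \<rho> < \<bar>x $ a\<bar>" and x: "\<And>i. \<bar>x $ i\<bar> \<le> L / 2"
      by (auto simp: vol_box_def L_def)
    have x': "- (L / 2) \<le> x $ i \<and> x $ i \<le> L / 2" for i using abs_le_D1[OF x[of i]] abs_le_D2[OF x[of i]] by linarith
    have "x \<in> cbox (lo (a, 0 \<le> x $ a)) (up (a, 0 \<le> x $ a))"
      unfolding mem_box_cart lo_def up_def using a x' by auto
    then show "x \<in> (\<Union>as\<in>UNIV. cbox (lo as) (up as))" by blast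
  qed
  then have "intensity ?S \<le> intensity (\<Union>as\<in>UNIV. cbox (lo as) (up as))"
    by (rule intensity_mono) (intro sets.finite_UN; simp)
  also have "\<dots> \<le> of_nat (card (UNIV :: ('d \<times> bool) set)) * ennreal ((2 * L) ^ (CARD('d) - 1) * (\<rho> + 1))"
  proof (rule intensity_UN_le)
    fix as :: "'d \<times> bool"
    obtain a s where as: "as = (a, s)" by (cases as)
    have "intensity (cbox (lo as) (up as)) \<le> ennreal (\<Prod>i\<in>UNIV. up as $ i - lo as $ i + 1)"
      using L assms(2) by (intro intensity_cbox_le) (auto simp: as lo_def up_def)
    also have "(\<Prod>i\<in>UNIV. up as $ i - lo as $ i + 1) = (\<Prod>i\<in>UNIV. if i = a then \<rho> + 1 else L + 1)"
      by (intro prod.cong) (auto simp: as lo_def up_def)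
    also have "\<dots> = (\<rho> + 1) * (L + 1) ^ (CARD('d) - 1)"
      by (subst prod.remove[of _ a]) (auto simp: card_Diff_singleton)
    also have "\<dots> \<le> (\<rho> + 1) * (2 * L) ^ (CARD('d) - 1)"
      using L assms(2) by (intro mult_left_mono power_mono) auto
    finally show "intensity (cbox (lo as) (up as)) \<le> ennreal ((2 * L) ^ (CARD('d) - 1) * (\<rho> + 1))"
      by (simp add: ennreal_leI mult.commute)
  qed auto
  also have "\<dots> = ennreal (2 * CARD('d) * (2 * L) ^ (CARD('d) - 1) * (\<rho> + 1))"
    using L assms(2) by (simp add: ennreal_of_nat_eq_real_of_nat card_cartesian_product mult_ac flip: ennreal_mult UNIV_Times_UNIV)
  finally show ?thesis .
qed

text \<open>A layer at depth about 2^l has at most about L^(d-1) 2^l vertices, each bridging that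
  distance with probability at most about 2^(- l d (1 - \<eta>)). The bound for the layer thus grows
  like 2^(l e) with e = 1 - d (1 - \<eta>). The condition \<eta> > (d - 1) / d says exactly that e >
  0, so the deepest layer dominates and gives L^(d - 1 + e) = k^\<eta>.\<close>

lemma star_upper:
  fixes \<eta> :: real
  assumes "1 < \<alpha>" "2 < \<tau>" "0 < \<eta>"
    and "zeta_ll \<alpha> < ereal \<eta>" "zeta_hl \<alpha> \<tau> < ereal \<eta>" "zeta_hh \<alpha> \<tau> (sigma_of \<kappa>) < ereal \<eta>"
    and short: "zeta_short CARD('d) < ereal \<eta>"
  shows "grows_at_most star_count \<eta>"
proof (cases "\<eta> < 1")
  case False
  have "eventually (\<lambda>k. star_count k \<le> ennreal (2 ^ CARD('d) * k powr \<eta>)) at_top"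
    using eventually_ge_at_top[of 1] by eventually_elim (rule star_count_le_powr, use False in auto)
  then show ?thesis by blast
next
  case True
  define d where "d = real CARD('d)"
  have d: "1 \<le> d" by (simp add: d_def Suc_leI)
  define e where "e = 1 - d * (1 - \<eta>)"
  have e: "0 < e"
  proof -
    have "(d - 1) / d < \<eta>" using short by (simp add: zeta_short_def d_def)
    then show ?thesis using d by (simp add: e_def field_simps)
  qed
  define q where "q = 2 powr e"
  have q: "1 < q" using e powr_less_mono[of 0 e 2] by (simp add: q_def)
  from down_count_decay[OF assms(1-3) True assms(4-6)] obtain C where C: "0 \<le> C"
    "\<And>A k r. A \<in> sets borel \<Longrightarrow> 4 \<le> r \<Longrightarrow> (\<forall>x\<in>A. \<forall>y. y \<notin> vol_box k \<longrightarrow> r \<le> dist x y) \<Longrightarrow>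
    down_count A k \<le> intensity A * ennreal (C * r powr (- (d * (1 - \<eta>))))"
    unfolding d_def by blast
  have "star_count k \<le> ennreal (2 * d * 2 ^ (CARD('d) - 1) * (5 + 9 * C / (q - 1)) * k powr \<eta>)"
    if k: "1 \<le> k" for k
  proof -
    define L where "L = k powr (1 / CARD('d))"
    have L: "1 \<le> L" unfolding L_def using k by (intro ge_one_powr_ge_zero) auto
    define S where "S \<rho> = ({x \<in> vol_box k. \<exists>a. L / 2 - \<rho> < \<bar>x $ a\<bar>} :: (real^'d) set)" for \<rho> :: real
    have S_borel [measurable]: "S \<rho> \<in> sets borel" for \<rho>
    proof -
      have "open {x::real^'d. \<exists>a. L / 2 - \<rho> < \<bar>x $ a\<bar>}"
        by (intro open_Collect_ex open_Collect_less continuous_intros)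
      then have "vol_box k \<inter> {x::real^'d. \<exists>a. L / 2 - \<rho> < \<bar>x $ a\<bar>} \<in> sets borel" by simp
      also have "vol_box k \<inter> {x::real^'d. \<exists>a. L / 2 - \<rho> < \<bar>x $ a\<bar>} = S \<rho>"
        by (auto simp: S_def)
      finally show ?thesis .
    qed
    define c where "c = 2 * d * (2 * L) ^ (CARD('d) - 1)"
    have c: "0 \<le> c" using d L by (simp add: c_def)
    have int_S: "intensity (S \<rho>) \<le> ennreal (c * (\<rho> + 1))" if "0 < \<rho>" for \<rho>
      using intensity_boundary_layer_le[OF k that] by (simp add: S_def L_def c_def d_def)
    \<comment> \<open>The factor 4 matches the minimal distance in the decay bound, and 9 comes from
      4 * 2^(l+1) + 1 \<le> 9 * 2^l.\<close>
    have step: "down_count (S (4 * 2 ^ Suc l) - S (4 * 2 ^ l)) k \<le> ennreal (9 * C * c * q ^ l)" for l :: nat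
    proof -
      let ?A = "S (4 * 2 ^ Suc l) - S (4 * 2 ^ l)"
      have "down_count ?A k \<le> intensity ?A * ennreal (C * (4 * 2 ^ l) powr (- (d * (1 - \<eta>))))"
      proof (rule C(2))
        show "\<forall>x\<in>?A. \<forall>y. y \<notin> vol_box k \<longrightarrow> 4 * 2 ^ l \<le> dist x y"
        proof (intro ballI allI impI)
          fix x y :: "real^'d" assume "x \<in> ?A" "y \<notin> vol_box k"
          then have "\<And>a. \<bar>x $ a\<bar> \<le> L / 2 - 4 * 2 ^ l" by (force simp: S_def not_less)
          then show "4 * 2 ^ l \<le> dist x y"
            using \<open>y \<notin> vol_box k\<close> unfolding L_def by (rule dist_vol_box_ge)
        qed
      qed auto
      also have "\<dots> \<le> ennreal (c * (4 * 2 ^ Suc l + 1)) * ennreal (C * (4 * 2 ^ l) powr (- (d * (1 - \<eta>))))"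
        by (intro mult_right_mono order_trans[OF intensity_mono int_S]) auto
      also have "\<dots> = ennreal (c * (4 * 2 ^ Suc l + 1) * (C * (4 * 2 ^ l) powr (- (d * (1 - \<eta>)))))"
        using c C(1) by (simp add: ennreal_mult)
      also have "\<dots> \<le> ennreal (9 * C * c * q ^ l)"
      proof (rule ennreal_leI)
        have "(4 * 2 ^ l) powr (- (d * (1 - \<eta>))) \<le> (2 ^ l) powr (- (d * (1 - \<eta>)))"
          using d True by (intro powr_mono2') auto
        then have "c * (4 * 2 ^ Suc l + 1) * (C * (4 * 2 ^ l) powr (- (d * (1 - \<eta>))))
          \<le> c * (9 * 2 ^ l) * (C * (2 ^ l) powr (- (d * (1 - \<eta>))))"
          using c C(1) by (intro mult_mono) auto
        also have "\<dots> = 9 * C * c * (2 ^ l * (2 ^ l) powr (- (d * (1 - \<eta>))))" by simp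
        also have "2 ^ l * (2 ^ l) powr (- (d * (1 - \<eta>))) = (2 ^ l) powr e"
          by (subst powr_mult_base) (auto simp: e_def)
        also have "(2 ^ l) powr e = q ^ l"
          by (simp add: q_def powr_powr mult_ac flip: powr_realpow)
        finally show "c * (4 * 2 ^ Suc l + 1) * (C * (4 * 2 ^ l) powr (- (d * (1 - \<eta>)))) \<le> 9 * C * c * q ^ l" .
      qed
      finally show ?thesis .
    qed
    have sum: "down_count (S (4 * 2 ^ n)) k \<le> ennreal (5 * c + 9 * C * c * (\<Sum>l<n. q ^ l))" for n :: nat
    proof (induction n)
      case 0
      show ?case
        using order_trans[OF down_count_le_intensity[OF S_borel] int_S[of 4]] by (simp add: mult.commute)
    next
      case (Suc n)
      have "S (4 * 2 ^ n) \<subseteq> S (4 * 2 ^ Suc n)"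
        proof
        fix x assume "x \<in> S (4 * 2 ^ n)"
        then obtain a where "x \<in> vol_box k" "L / 2 - 4 * 2 ^ n < \<bar>x $ a\<bar>" by (auto simp: S_def)
        moreover have "L / 2 - 4 * 2 ^ Suc n \<le> L / 2 - 4 * 2 ^ n" by simp
        ultimately show "x \<in> S (4 * 2 ^ Suc n)" unfolding S_def using le_less_trans by blast
      qed
      then have "S (4 * 2 ^ Suc n) = S (4 * 2 ^ n) \<union> (S (4 * 2 ^ Suc n) - S (4 * 2 ^ n))" by blast
      then have "down_count (S (4 * 2 ^ Suc n)) k
          \<le> down_count (S (4 * 2 ^ n)) k + down_count (S (4 * 2 ^ Suc n) - S (4 * 2 ^ n)) k"
        using down_count_Un[OF S_borel sets.Diff[OF S_borel S_borel]] by metis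
      also have "\<dots> \<le> ennreal (5 * c + 9 * C * c * (\<Sum>l<n. q ^ l)) + ennreal (9 * C * c * q ^ n)"
        by (intro add_mono Suc step)
      also have "\<dots> = ennreal (5 * c + 9 * C * c * (\<Sum>l<Suc n. q ^ l))"
        using c C(1) q by (simp add: distrib_left sum_nonneg add.assoc flip: ennreal_plus)
      finally show ?case .
    qed
    \<comment> \<open>For this \<open>n\<close> the depth 4 * 2^n exceeds L / 2, so the layer is the
      whole box.\<close>
    obtain n :: nat where n: "2 ^ n \<le> L" "L < 2 ^ Suc n" using dyadic_interval[OF L] .
    have "L / 2 - 4 * 2 ^ n < \<bar>x $ a\<bar>" for x :: "real^'d" and a
      using n L by (intro less_le_trans[OF _ abs_ge_zero]) simp
    then have "vol_box k = S (4 * 2 ^ n)" by (auto simp: S_def)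
    then have "star_count k \<le> ennreal (5 * c + 9 * C * c * (\<Sum>l<n. q ^ l))"
      using sum[of n] by simp
    also have "\<dots> \<le> ennreal (c * L powr e * (5 + 9 * C / (q - 1)))"
    proof (rule ennreal_leI)
      have "(\<Sum>l<n. q ^ l) = (q ^ n - 1) / (q - 1)" using q by (simp add: geometric_sum)
      also have "\<dots> \<le> L powr e / (q - 1)"
      proof (rule divide_right_mono)
        have "q ^ n = (2 ^ n) powr e" by (simp add: q_def powr_powr mult_ac flip: powr_realpow)
        also have "\<dots> \<le> L powr e" using n e by (intro powr_mono2) auto
        finally show "q ^ n - 1 \<le> L powr e" by simp
      qed (use q in simp)
      finally have "9 * C * c * (\<Sum>l<n. q ^ l) \<le> 9 * C * c * (L powr e / (q - 1))"
        using c C(1) by (intro mult_left_mono) auto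
      moreover have "5 * c * 1 \<le> 5 * c * L powr e"
        using c L e by (intro mult_left_mono ge_one_powr_ge_zero) auto
      ultimately show "5 * c + 9 * C * c * (\<Sum>l<n. q ^ l) \<le> c * L powr e * (5 + 9 * C / (q - 1))"
        by (simp add: algebra_simps)
    qed
    also have "c * L powr e * (5 + 9 * C / (q - 1)) = 2 * d * 2 ^ (CARD('d) - 1) * (5 + 9 * C / (q - 1)) * k powr \<eta>"
    proof -
      have "L ^ (CARD('d) - 1) * L powr e = L powr (d * \<eta>)"
        using L by (simp add: e_def d_def of_nat_diff Suc_leI algebra_simps flip: powr_realpow powr_add)
      also have "\<dots> = k powr \<eta>" using k root_CARD(2)[of k \<eta>] by (simp add: L_def d_def)
      finally show ?thesis by (simp add: c_def power_mult_distrib mult_ac)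
    qed
    finally show ?thesis .
  qed
  then have "eventually (\<lambda>k. star_count k
      \<le> ennreal (2 * d * 2 ^ (CARD('d) - 1) * (5 + 9 * C / (q - 1)) * k powr \<eta>)) at_top"
    by (intro eventually_mono[OF eventually_ge_at_top[of 1]])
  then show ?thesis by blast
qed

section \<open>Lower bounds\<close>

text \<open>Integrated form of \<open>n \<le> of_bool (n \<ge> 1) + n (n - 1)\<close>, applied to the number \<open>n\<close> of edges
  from one vertex to \<open>B\<close>.\<close>

lemma down_count_bonferroni:
  fixes q q' :: real
  assumes A: "A \<in> sets borel" "bounded A" and B: "B \<in> sets borel" "bounded B" and "A \<inter> B = {}"
    and "B \<inter> vol_box k = {}" and I: "I \<in> sets borel" and J: "J \<in> sets borel"
    and down: "\<And>u v. u \<in> I \<Longrightarrow> v \<in> J \<Longrightarrow> v \<le> u"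
    and edge: "\<And>x y u v. x \<in> A \<Longrightarrow> y \<in> B \<Longrightarrow> u \<in> I \<Longrightarrow> v \<in> J \<Longrightarrow>
      q \<le> link_prob x y u v \<and> link_prob x y u v \<le> q'"
    and PI: "\<And>i. pr (\<lambda>\<omega>. W i \<omega> \<in> I) = PI"
    and PJ: "\<And>i. pr (\<lambda>\<omega>. W i \<omega> \<in> J) = PJ"
  shows "intensity A * intensity B * (PI * PJ * ennreal q)
    \<le> down_count A k + intensity A * pair_intensity B * (PI * PJ\<^sup>2 * (ennreal q')\<^sup>2)"
proof -
  note [measurable] = A(1) B(1) I J
  have e0: "0 \<le> link_prob x y u v" for x y :: "real^'d" and u v
    using p_pos by (auto simp: edge_prob_def profile_def)
  let ?R = "\<lambda>i j \<omega>. X i \<omega> \<in> A \<and> W i \<omega> \<in> I \<and> X j \<omega> \<in> B \<and> W j \<omega> \<in> J \<and> E i j \<omega>"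
  let ?Q1 = "\<lambda>i j (x::nat \<Rightarrow> real^'d) (w::nat \<Rightarrow> real). x i \<in> A \<and> x j \<in> B \<and> w i \<in> I \<and> w j \<in> J"
  let ?Q2 = "\<lambda>i j j' (x::nat \<Rightarrow> real^'d) (w::nat \<Rightarrow> real). x i \<in> A \<and> x j \<in> B \<and> x j' \<in> B \<and> w i \<in> I \<and> w j \<in> J \<and> w j' \<in> J"
  \<comment> \<open>The centre \<open>i\<close> has its mark in \<open>I\<close>, every other vertex
    in \<open>J\<close>; one family of factors serves for two and for three vertices.\<close>
  let ?g = "\<lambda>i (k::nat) (w::real). of_bool (w \<in> (if k = i then I else J)) :: ennreal"
  have [measurable]: "?g i k \<in> borel_measurable borel" for i k by measurable
  have G: "(\<integral>\<^sup>+\<omega>. ?g i k (W k \<omega>) \<partial>M) = (if k = i then PI else PJ)" for i k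
    using PI[of k] PJ[of k] by (cases "k = i") (simp_all add: emeasure_eq_nn_integral_of_bool)
  have lower: "pr (\<lambda>\<omega>. X i \<omega> \<in> A \<and> X j \<omega> \<in> B) * (PI * PJ * ennreal q) \<le> pr (\<lambda>\<omega>. ?R i j \<omega>)" for i j
  proof (cases "i = j")
    case True
    then have "{\<omega> \<in> space M. X i \<omega> \<in> A \<and> X j \<omega> \<in> B} = {}" using assms(5) by auto
    then show ?thesis by (simp only: emeasure_empty mult_zero_left zero_le)
  next
    case False
    have "(\<integral>\<^sup>+\<omega>. of_bool (X i \<omega> \<in> A \<and> X j \<omega> \<in> B) * (\<Prod>k\<in>{i, j}. ?g i k (W k \<omega>)) \<partial>M)
       = (\<integral>\<^sup>+\<omega>. of_bool (X i \<omega> \<in> A \<and> X j \<omega> \<in> B) \<partial>M) * (\<Prod>k\<in>{i, j}. \<integral>\<^sup>+\<omega>. ?g i k (W k \<omega>) \<partial>M)"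
      by (rule nn_integral_locations_marks[where f="\<lambda>x. of_bool (x i \<in> A \<and> x j \<in> B)" and g="?g i"]) measurable
    also have "\<dots> = pr (\<lambda>\<omega>. X i \<omega> \<in> A \<and> X j \<omega> \<in> B) * (PI * PJ)"
      unfolding G using False by (simp add: emeasure_eq_nn_integral_of_bool)
    finally have "pr (\<lambda>\<omega>. X i \<omega> \<in> A \<and> X j \<omega> \<in> B) * (PI * PJ * ennreal q)
      = (\<integral>\<^sup>+\<omega>. of_bool (X i \<omega> \<in> A \<and> X j \<omega> \<in> B) * (\<Prod>k\<in>{i, j}. ?g i k (W k \<omega>)) \<partial>M) * ennreal q"
      by (simp add: mult.assoc)
    also have "\<dots> = (\<integral>\<^sup>+\<omega>. of_bool (X i \<omega> \<in> A \<and> X j \<omega> \<in> B) * (\<Prod>k\<in>{i, j}. ?g i k (W k \<omega>)) * ennreal q \<partial>M)"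
      by (rule nn_integral_multc[symmetric]) measurable
    also have "\<dots> \<le> (\<integral>\<^sup>+\<omega>. of_bool (at_vertices (?Q1 i j) \<omega>) *
        ennreal (link_prob_at i j \<omega>) \<partial>M)"
      using False edge by (intro nn_integral_mono) (auto simp: of_bool_def intro!: ennreal_leI)
    also have "\<dots> = pr (\<lambda>\<omega>. at_vertices (?Q1 i j) \<omega> \<and> E i j \<omega>)"
      by (rule emeasure_edge[symmetric, OF _ False]) (unfold split_beta, measurable)
    also have "{\<omega> \<in> space M. at_vertices (?Q1 i j) \<omega> \<and> E i j \<omega>} = {\<omega> \<in> space M. ?R i j \<omega>}"
      by auto
    finally show ?thesis .
  qed
  have upper: "pr (\<lambda>\<omega>. ?R i j \<omega> \<and> ?R i j' \<omega> \<and> j \<noteq> j')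
     \<le> pr (\<lambda>\<omega>. X i \<omega> \<in> A \<and> X j \<omega> \<in> B \<and> X j' \<omega> \<in> B \<and> j \<noteq> j') * (PI * PJ\<^sup>2 * (ennreal q')\<^sup>2)" for i j j'
  proof (cases "i \<noteq> j \<and> i \<noteq> j' \<and> j \<noteq> j'")
    case False
    then have "{\<omega> \<in> space M. ?R i j \<omega> \<and> ?R i j' \<omega> \<and> j \<noteq> j'} = {}" using assms(5) by auto
    then show ?thesis by (simp only: emeasure_empty zero_le)
  next
    case True
    have "{\<omega> \<in> space M. ?R i j \<omega> \<and> ?R i j' \<omega> \<and> j \<noteq> j'}
      = {\<omega> \<in> space M. at_vertices (?Q2 i j j') \<omega> \<and> E i j \<omega> \<and> E i j' \<omega>}"
      using True by auto
    then have "pr (\<lambda>\<omega>. ?R i j \<omega> \<and> ?R i j' \<omega> \<and> j \<noteq> j')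
      = pr (\<lambda>\<omega>. at_vertices (?Q2 i j j') \<omega> \<and> E i j \<omega> \<and> E i j' \<omega>)"
      by (rule arg_cong)
    also have "\<dots> = (\<integral>\<^sup>+\<omega>. of_bool (at_vertices (?Q2 i j j') \<omega>) *
        ennreal (link_prob_at i j \<omega>
          * link_prob_at i j' \<omega>) \<partial>M)"
      using True by (intro emeasure_two_edges) (unfold split_beta, measurable)
    also have "\<dots> \<le> (\<integral>\<^sup>+\<omega>. of_bool (X i \<omega> \<in> A \<and> X j \<omega> \<in> B \<and> X j' \<omega> \<in> B) * (\<Prod>k\<in>{i, j, j'}. ?g i k (W k \<omega>)) * (ennreal q')\<^sup>2 \<partial>M)"
    proof (rule nn_integral_mono)
      fix \<omega>
      let ?e = "\<lambda>j. link_prob_at i j \<omega>"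
      show "of_bool (at_vertices (?Q2 i j j') \<omega>) * ennreal (?e j * ?e j')
        \<le> of_bool (X i \<omega> \<in> A \<and> X j \<omega> \<in> B \<and> X j' \<omega> \<in> B) * (\<Prod>k\<in>{i, j, j'}. ?g i k (W k \<omega>)) * (ennreal q')\<^sup>2"
      proof (cases "at_vertices (?Q2 i j j') \<omega>")
        case Q: True
        have "ennreal (?e j * ?e j') = ennreal (?e j) * ennreal (?e j')" using e0 by (intro ennreal_mult) auto
        also have "\<dots> \<le> ennreal q' * ennreal q'"
          using Q edge by (intro mult_mono ennreal_leI) auto
        finally show ?thesis using Q True by (auto simp: power2_eq_square)
      next
        case Q: False
        then have "of_bool (at_vertices (?Q2 i j j') \<omega>) = (0::ennreal)"
          by (simp only: of_bool_eq_0_iff not_False_eq_True)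
        then show ?thesis by (simp only: mult_zero_left zero_le)
      qed
    qed
    also have "\<dots> = (\<integral>\<^sup>+\<omega>. of_bool (X i \<omega> \<in> A \<and> X j \<omega> \<in> B \<and> X j' \<omega> \<in> B) * (\<Prod>k\<in>{i, j, j'}. ?g i k (W k \<omega>)) \<partial>M) * (ennreal q')\<^sup>2"
      by (rule nn_integral_multc) measurable
    also have "(\<integral>\<^sup>+\<omega>. of_bool (X i \<omega> \<in> A \<and> X j \<omega> \<in> B \<and> X j' \<omega> \<in> B) * (\<Prod>k\<in>{i, j, j'}. ?g i k (W k \<omega>)) \<partial>M)
       = (\<integral>\<^sup>+\<omega>. of_bool (X i \<omega> \<in> A \<and> X j \<omega> \<in> B \<and> X j' \<omega> \<in> B) \<partial>M) * (\<Prod>k\<in>{i, j, j'}. \<integral>\<^sup>+\<omega>. ?g i k (W k \<omega>) \<partial>M)"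
      by (rule nn_integral_locations_marks[where f="\<lambda>x. of_bool (x i \<in> A \<and> x j \<in> B \<and> x j' \<in> B)" and g="?g i"]) measurable
    also have "\<dots> = pr (\<lambda>\<omega>. X i \<omega> \<in> A \<and> X j \<omega> \<in> B \<and> X j' \<omega> \<in> B) * (PI * PJ\<^sup>2)"
      unfolding G using True by (simp add: emeasure_eq_nn_integral_of_bool power2_eq_square)
    finally show ?thesis using True by (simp add: mult.assoc)
  qed
  \<comment> \<open>Holds for outcomes with finitely many vertices in \<open>B\<close>, where the
    number of edges is a natural number.\<close>
  have pt: "AE \<omega> in M. (\<Sum>j. of_bool (?R i j \<omega>)) \<le> of_bool (X i \<omega> \<in> A \<and> down_edge_out X W E k \<omega> i)
      + (\<Sum>j. \<Sum>j'. of_bool (?R i j \<omega> \<and> ?R i j' \<omega> \<and> j \<noteq> j') :: ennreal)" for i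
    using AE_finite_points[OF B]
  proof eventually_elim
    case (elim \<omega>)
    let ?S = "{j. ?R i j \<omega>}"
    have fin: "finite ?S" using elim by (rule rev_finite_subset) auto
    have "of_nat (card ?S) \<le> of_bool (X i \<omega> \<in> A \<and> down_edge_out X W E k \<omega> i) + (of_nat (card ?S * (card ?S - 1)) :: ennreal)"
    proof (cases "card ?S \<le> 1")
      case True
      show ?thesis
      proof (cases "card ?S = 0")
        case False
        then have "?S \<noteq> {}" by (metis card.empty)
        then obtain j where "?R i j \<omega>" by blast
        then have "down_edge_out X W E k \<omega> i" "X i \<omega> \<in> A"
          using down assms(6) by (auto simp: down_edge_out_def)
        moreover have "card ?S = 1" using True False by linarith
        ultimately show ?thesis by simp
      qed simp
    next
      case False
      then have "card ?S * 1 \<le> card ?S * (card ?S - 1)" by (intro mult_le_mono) auto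
      then have "(of_nat (card ?S) :: ennreal) \<le> of_nat (card ?S * (card ?S - 1))"
        unfolding of_nat_le_iff by simp
      then show ?thesis by (rule add_increasing[OF zero_le])
    qed
    then show ?case
      by (simp only: suminf_of_bool_finite[OF fin] suminf_of_bool_distinct_pairs[OF fin])
  qed
  have [measurable]: "Measurable.pred M (\<lambda>\<omega>. ?R i j \<omega>)" for i j by measurable
  have "intensity A * intensity B * (PI * PJ * ennreal q) = (\<Sum>i. \<Sum>j. pr (\<lambda>\<omega>. X i \<omega> \<in> A \<and> X j \<omega> \<in> B) * (PI * PJ * ennreal q))"
    unfolding ennreal_suminf_multc intensity_prod[OF A B assms(5)] ..
  also have "\<dots> \<le> (\<Sum>i. \<Sum>j. pr (\<lambda>\<omega>. ?R i j \<omega>))"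
    by (intro ennreal_suminf_mono lower)
  also have "\<dots> \<le> (\<Sum>i. pr (\<lambda>\<omega>. X i \<omega> \<in> A \<and> down_edge_out X W E k \<omega> i)
      + (\<Sum>j. \<Sum>j'. pr (\<lambda>\<omega>. ?R i j \<omega> \<and> ?R i j' \<omega> \<and> j \<noteq> j')))"
  proof (rule ennreal_suminf_mono)
    fix i
    have "(\<Sum>j. pr (\<lambda>\<omega>. ?R i j \<omega>)) = (\<integral>\<^sup>+\<omega>. (\<Sum>j. of_bool (?R i j \<omega>)) \<partial>M)"
      by (rule suminf_pr) measurable
    also have "\<dots> \<le> (\<integral>\<^sup>+\<omega>. of_bool (X i \<omega> \<in> A \<and> down_edge_out X W E k \<omega> i)
      + (\<Sum>j. \<Sum>j'. of_bool (?R i j \<omega> \<and> ?R i j' \<omega> \<and> j \<noteq> j')) \<partial>M)"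
      by (rule nn_integral_mono_AE[OF pt])
    also have "\<dots> = (\<integral>\<^sup>+\<omega>. of_bool (X i \<omega> \<in> A \<and> down_edge_out X W E k \<omega> i) \<partial>M)
      + (\<integral>\<^sup>+\<omega>. (\<Sum>j. \<Sum>j'. of_bool (?R i j \<omega> \<and> ?R i j' \<omega> \<and> j \<noteq> j')) \<partial>M)"
      by (rule nn_integral_add) measurable
    also have "\<dots> = pr (\<lambda>\<omega>. X i \<omega> \<in> A \<and> down_edge_out X W E k \<omega> i)
      + (\<Sum>j. \<Sum>j'. pr (\<lambda>\<omega>. ?R i j \<omega> \<and> ?R i j' \<omega> \<and> j \<noteq> j'))"
      by (intro arg_cong2[where f="(+)"] emeasure_eq_nn_integral_of_bool[symmetric] suminf_pr2[symmetric]) measurable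
    finally show "(\<Sum>j. pr (\<lambda>\<omega>. ?R i j \<omega>))
      \<le> pr (\<lambda>\<omega>. X i \<omega> \<in> A \<and> down_edge_out X W E k \<omega> i)
      + (\<Sum>j. \<Sum>j'. pr (\<lambda>\<omega>. ?R i j \<omega> \<and> ?R i j' \<omega> \<and> j \<noteq> j'))" .
  qed
  also have "\<dots> \<le> (\<Sum>i. pr (\<lambda>\<omega>. X i \<omega> \<in> A \<and> down_edge_out X W E k \<omega> i)
      + (\<Sum>j. \<Sum>j'. pr (\<lambda>\<omega>. X i \<omega> \<in> A \<and> X j \<omega> \<in> B \<and> X j' \<omega> \<in> B \<and> j \<noteq> j') * (PI * PJ\<^sup>2 * (ennreal q')\<^sup>2)))"
    by (intro ennreal_suminf_mono add_left_mono upper)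
  also have "\<dots> = down_count A k + intensity A * pair_intensity B * (PI * PJ\<^sup>2 * (ennreal q')\<^sup>2)"
    unfolding ennreal_suminf_add ennreal_suminf_multc intensity_prod_pair[OF A B assms(5)] down_count_def ..
  finally show ?thesis .
qed

section \<open>Windows of marks and the target cube\<close>

lemma emeasure_mark_interval:
  assumes "\<tau> = ereal t" "2 < t" "1 \<le> w"
  shows "pr (\<lambda>\<omega>. W i \<omega> \<in> {w..<2 * w}) = ennreal ((1 - 2 powr (- (t - 1))) * w powr (- (t - 1)))"
proof -
  have sub: "{\<omega> \<in> space M. 2 * w \<le> W i \<omega>} \<subseteq> {\<omega> \<in> space M. w \<le> W i \<omega>}" using assms by auto
  have "{\<omega> \<in> space M. W i \<omega> \<in> {w..<2 * w}} = {\<omega> \<in> space M. w \<le> W i \<omega>} - {\<omega> \<in> space M. 2 * w \<le> W i \<omega>}"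
    by auto
  then have "prob {\<omega> \<in> space M. W i \<omega> \<in> {w..<2 * w}}
      = prob {\<omega> \<in> space M. w \<le> W i \<omega>} - prob {\<omega> \<in> space M. 2 * w \<le> W i \<omega>}"
    using sub by (simp only:) (rule finite_measure_Diff; measurable)
  also have "\<dots> = w powr (- (t - 1)) - (2 * w) powr (- (t - 1))"
    using W_pareto[of w i] W_pareto[of "2 * w" i] assms by simp
  also have "\<dots> = (1 - 2 powr (- (t - 1))) * w powr (- (t - 1))"
    using assms by (simp add: powr_mult algebra_simps)
  finally show ?thesis by (simp only: emeasure_eq_measure)
qed

text \<open>A window of marks of order k^a has probability of order k^(- a (t - 1)). The factor
  \<open>m\<close> makes room to place the inner window above the outer one.\<close>

lemma emeasure_scaled_mark_interval:
  assumes "\<tau> = ereal t" "2 < t" "1 \<le> m" "1 \<le> k" "0 \<le> a"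
  shows "pr (\<lambda>\<omega>. W i \<omega> \<in> {m * k powr a..<2 * (m * k powr a)})
    = ennreal ((1 - 2 powr (- (t - 1))) * m powr (- (t - 1)) * k powr (- (a * (t - 1))))"
proof -
  have "1 * 1 \<le> m * k powr a"
    using assms by (intro mult_mono ge_one_powr_ge_zero) auto
  then have "pr (\<lambda>\<omega>. W i \<omega> \<in> {m * k powr a..<2 * (m * k powr a)})
      = ennreal ((1 - 2 powr (- (t - 1))) * (m * k powr a) powr (- (t - 1)))"
    by (intro emeasure_mark_interval[OF assms(1,2)]) simp
  also have "(m * k powr a) powr (- (t - 1)) = m powr (- (t - 1)) * k powr (- (a * (t - 1)))"
    by (simp add: powr_mult powr_powr algebra_simps)
  finally show ?thesis by (simp add: mult.assoc)
qed

text \<open>A cube beyond a corner of the box, holding about k^v vertices in expectation. The gap 1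
  separates it from the box, and the side 2 k^(v/d) leaves at least k^(v/d) after the loss of one
  per axis in \<open>intensity_cbox_ge\<close>. Taking v < 1 reduces the number of targets without
  changing the order of the distance.\<close>

definition target_box :: "real \<Rightarrow> real \<Rightarrow> (real^'d) set" where
  "target_box v k = cbox (\<chi> i. k powr (1 / CARD('d)) / 2 + 1)
     (\<chi> i. k powr (1 / CARD('d)) / 2 + 1 + 2 * k powr (v / CARD('d)))"

lemma target_box_intensity:
  assumes "1 \<le> k" "0 \<le> v"
  shows "ennreal (k powr v) \<le> intensity (target_box v k)"
    and "intensity (target_box v k) \<le> ennreal (3 ^ CARD('d) * k powr v)"
proof -
  let ?l = "k powr (v / CARD('d))"
  have l: "1 \<le> ?l" using assms by (intro ge_one_powr_ge_zero) auto
  have eq: "?l ^ CARD('d) = k powr v" using assms by (simp add: powr_powr flip: powr_realpow)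
  have "?l ^ CARD('d) \<le> (\<Prod>i\<in>(UNIV::'d set). 2 * ?l - 1)"
    using l power_mono[of ?l "2 * ?l - 1" "CARD('d)"] by simp
  then have "ennreal (k powr v) \<le> ennreal (\<Prod>i\<in>(UNIV::'d set). 2 * ?l - 1)"
    unfolding eq by (rule ennreal_leI)
  also have "\<dots> \<le> intensity (target_box v k)"
    unfolding target_box_def using l by (intro order_trans[OF _ intensity_cbox_ge]) auto
  finally show "ennreal (k powr v) \<le> intensity (target_box v k)" .
  have "intensity (target_box v k) \<le> ennreal (\<Prod>i\<in>(UNIV::'d set). 2 * ?l + 1)"
    unfolding target_box_def using l by (intro order_trans[OF intensity_cbox_le]) auto
  also have "\<dots> \<le> ennreal (3 ^ CARD('d) * k powr v)"
    unfolding eq[symmetric] using l power_mono[of "2 * ?l + 1" "3 * ?l" "CARD('d)"]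
    by (intro ennreal_leI) (simp add: power_mult_distrib)
  finally show "intensity (target_box v k) \<le> ennreal (3 ^ CARD('d) * k powr v)" .
qed

lemma target_box_outside: "0 < k \<Longrightarrow> target_box v k \<inter> vol_box k = {}"
proof -
  assume "0 < k"
  have False if "x \<in> target_box v k" "x \<in> vol_box k" for x
  proof -
    obtain a :: 'd where True by blast
    have "k powr (1 / CARD('d)) / 2 + 1 \<le> x $ a" "\<bar>x $ a\<bar> \<le> k powr (1 / CARD('d)) / 2"
      using that by (auto simp: target_box_def vol_box_def mem_box_cart)
    then show False by linarith
  qed
  then show ?thesis by blast
qed

text \<open>All distances between the box of volume k / 2 and the target cube are of order k^(1/d),
  so that the argument of the profile depends, up to constants, only on k and the marks.\<close>

lemma dist_target_box:
  fixes k v :: real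
  assumes "1 \<le> k" "v \<le> 1" "x \<in> vol_box (k / 2)" "y \<in> target_box v k"
  shows "(((1 - 2 powr (- (1 / CARD('d)))) / 2) ^ CARD('d)) * k \<le> dist x y ^ CARD('d)"
    and "dist x y ^ CARD('d) \<le> (4 * CARD('d)) ^ CARD('d) * k"
proof -
  let ?L = "k powr (1 / CARD('d))" and ?c = "(1 - 2 powr (- (1 / CARD('d)))) / 2"
  have L: "1 \<le> ?L" using assms by (intro ge_one_powr_ge_zero) auto
  have c: "0 < ?c" using powr_less_mono[of "- (1 / CARD('d))" 0 2] by simp
  have half: "(k / 2) powr (1 / CARD('d)) / 2 = ?L / 2 - ?c * ?L"
    using assms by (simp add: powr_divide powr_minus_divide field_simps)
  have "y \<notin> vol_box k" using target_box_outside[of k v] assms by auto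
  then have "?c * ?L \<le> dist x y"
    using assms(3) by (intro dist_vol_box_ge[of x k]) (auto simp: vol_box_def half)
  then have "(?c * ?L) ^ CARD('d) \<le> dist x y ^ CARD('d)" using c by (intro power_mono) auto
  then show "?c ^ CARD('d) * k \<le> dist x y ^ CARD('d)"
    using root_CARD(1)[of k] assms by (simp only: power_mult_distrib)
  have l: "k powr (v / CARD('d)) \<le> ?L" using assms by (intro powr_mono divide_right_mono) auto
  have "\<bar>(x - y) $ i\<bar> \<le> 4 * ?L" for i
  proof -
    have "\<bar>x $ i\<bar> \<le> ?L / 2"
      using assms vol_box_half_subset[of k] by (auto simp: vol_box_def)
    moreover have "?L / 2 + 1 \<le> y $ i" "y $ i \<le> ?L / 2 + 1 + 2 * k powr (v / CARD('d))"
      using assms(4) by (auto simp: target_box_def mem_box_cart)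
    ultimately show ?thesis using L l by (simp add: abs_le_iff)
  qed
  then have "(\<Sum>i\<in>UNIV. \<bar>(x - y) $ i\<bar>) \<le> of_nat (card (UNIV :: 'd set)) * (4 * ?L)"
    by (intro sum_bounded_above) auto
  then have "dist x y \<le> 4 * CARD('d) * ?L"
    using norm_le_l1_cart[of "x - y"] by (simp add: dist_norm mult_ac)
  then have "dist x y ^ CARD('d) \<le> (4 * CARD('d) * ?L) ^ CARD('d)" by (intro power_mono) auto
  then show "dist x y ^ CARD('d) \<le> (4 * CARD('d)) ^ CARD('d) * k"
    using root_CARD(1)[of k] assms by (simp only: power_mult_distrib) simp
qed

text \<open>Dictionary of exponents: k^(-a) and k^(-b) are the probabilities of the inner and outer
  marks, k^(-g) that of an edge, and k^v the number of targets. A vertex with inner mark then has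
  about k^(v - b - g) edges in expectation; since this tends to zero, pairs of edges are negligible
  against single ones.\<close>

lemma down_count_lower_exponent:
  fixes a b g v cI cJ c C :: real and I J :: "real \<Rightarrow> real set"
  assumes I: "\<And>k. I k \<in> sets borel" and J: "\<And>k. J k \<in> sets borel"
    and PI: "\<And>k i. 1 \<le> k \<Longrightarrow> pr (\<lambda>\<omega>. W i \<omega> \<in> I k) = ennreal (cI * k powr (- a))"
    and PJ: "\<And>k i. 1 \<le> k \<Longrightarrow> pr (\<lambda>\<omega>. W i \<omega> \<in> J k) = ennreal (cJ * k powr (- b))"
    and down: "\<And>k u v. 1 \<le> k \<Longrightarrow> u \<in> I k \<Longrightarrow> v \<in> J k \<Longrightarrow> v \<le> u"
    and edge: "eventually (\<lambda>k. \<forall>x\<in>vol_box (k / 2). \<forall>y\<in>target_box v k. \<forall>u\<in>I k. \<forall>w\<in>J k.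
       c * k powr (- g) \<le> link_prob x y u w \<and> link_prob x y u w \<le> C * k powr (- g)) at_top"
    and pos: "0 < cI" "0 < cJ" "0 < c" and v: "0 \<le> v" "v \<le> 1" and neg: "v - b - g < 0"
  shows "grows_at_least long_count (1 - a + (v - b - g))"
proof -
  let ?d = "CARD('d)"
  let ?c = "1 / 2 * (1 / (2 * 2 ^ ?d)) * cI * cJ * c"
  \<comment> \<open>Ensures that the Bonferroni correction is at most half of the main term.\<close>
  have "eventually (\<lambda>k. 3 ^ ?d * cJ * C\<^sup>2 * k powr (v - b - g) \<le> c / 2) at_top"
  proof -
    have "((\<lambda>k::real. 3 ^ ?d * cJ * C\<^sup>2 * k powr (v - b - g)) \<longlongrightarrow> 3 ^ ?d * cJ * C\<^sup>2 * 0) at_top"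
      using neg by (intro tendsto_mult tendsto_const tendsto_neg_powr filterlim_ident)
    then have "eventually (\<lambda>k::real. 3 ^ ?d * cJ * C\<^sup>2 * k powr (v - b - g) < c / 2) at_top"
      by (rule order_tendstoD) (use pos in simp)
    then show ?thesis by (rule eventually_mono) simp
  qed
  moreover have "eventually (\<lambda>k::real. 2 \<le> (k / 2) powr (1 / ?d)) at_top"
    by real_asymp
  ultimately have "eventually (\<lambda>k. ennreal (?c * k powr (1 - a + (v - b - g))) \<le> long_count k) at_top"
    using edge eventually_ge_at_top[of 1]
  proof eventually_elim
    case (elim k)
    let ?A = "vol_box (k / 2) :: (real^'d) set" and ?B = "target_box v k"
    have bA: "bounded ?A" unfolding vol_box_eq_cbox by (rule bounded_cbox)
    have bB: "bounded ?B" "?B \<in> sets borel" unfolding target_box_def by (auto intro: bounded_cbox)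
    have out: "?B \<inter> vol_box k = {}" using elim(4) by (intro target_box_outside) simp
    then have disj: "?A \<inter> ?B = {}" using vol_box_half_subset[of k] elim(4) by auto
    have pB: "pair_intensity ?B \<le> (intensity ?B)\<^sup>2"
      unfolding target_box_def using elim(4) by (intro pair_intensity_le) auto
    obtain mA where mA: "intensity ?A = ennreal mA" "0 \<le> mA"
      using intensity_finite[OF bA] by (cases "intensity ?A") auto
    obtain mB where mB: "intensity ?B = ennreal mB" "0 \<le> mB"
      using intensity_finite[OF bB(1)] by (cases "intensity ?B") auto
    have mB_le: "mB \<le> 3 ^ ?d * k powr v" and mB_ge: "k powr v \<le> mB"
      using target_box_intensity[OF elim(4) v(1)] mB elim(4) by (auto simp: ennreal_le_iff)
    have mA_ge: "k / (2 * 2 ^ ?d) \<le> mA"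
    proof -
      let ?h = "(k / 2) powr (1 / ?d)"
      have "(?h / 2) ^ ?d \<le> (\<Prod>i\<in>(UNIV::'d set). ?h - 1)"
        using elim(2) power_mono[of "?h / 2" "?h - 1" ?d] by simp
      then have "ennreal ((?h / 2) ^ ?d) \<le> ennreal (\<Prod>i\<in>(UNIV::'d set). ?h - 1)" by (rule ennreal_leI)
      also have "\<dots> \<le> intensity ?A"
        unfolding vol_box_eq_cbox using elim(2) by (intro order_trans[OF _ intensity_cbox_ge]) auto
      finally show ?thesis
        using mA elim(4) root_CARD(1)[of "k / 2"] by (simp add: ennreal_le_iff power_divide)
    qed
    define PI where "PI = cI * k powr (- a)"
    define PJ where "PJ = cJ * k powr (- b)"
    define q where "q = c * k powr (- g)"
    define q' where "q' = C * k powr (- g)"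
    have q0: "0 < q" "0 < PI" "0 < PJ" using pos elim(4) by (auto simp: q_def PI_def PJ_def)
    \<comment> \<open>The sign of \<open>C\<close> is not known in advance; the absolute value is
      still an upper bound and has the same square.\<close>
    have bonf: "intensity ?A * intensity ?B * (ennreal PI * ennreal PJ * ennreal q)
      \<le> down_count ?A k + intensity ?A * pair_intensity ?B * (ennreal PI * (ennreal PJ)\<^sup>2 * (ennreal \<bar>q'\<bar>)\<^sup>2)"
    proof (rule down_count_bonferroni[OF _ bA bB(2,1) disj out I J down[OF elim(4)]])
      show "q \<le> link_prob x y u w \<and> link_prob x y u w \<le> \<bar>q'\<bar>"
        if "x \<in> ?A" "y \<in> ?B" "u \<in> I k" "w \<in> J k" for x y u w
        using elim(3) that by (force simp: q_def q'_def)
    qed (use PI PJ elim(4) in \<open>auto simp: PI_def PJ_def\<close>)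
    also have "\<dots> \<le> down_count ?A k + intensity ?A * (intensity ?B)\<^sup>2 * (ennreal PI * (ennreal PJ)\<^sup>2 * (ennreal \<bar>q'\<bar>)\<^sup>2)"
      using pB by (intro add_left_mono mult_right_mono mult_left_mono) auto
    also have "intensity ?A * (intensity ?B)\<^sup>2 * (ennreal PI * (ennreal PJ)\<^sup>2 * (ennreal \<bar>q'\<bar>)\<^sup>2)
        = ennreal (mA * mB\<^sup>2 * (PI * PJ\<^sup>2 * q'\<^sup>2))"
      using mA mB q0 by (simp add: ennreal_mult ennreal_power)
    also have "\<dots> \<le> ennreal (mA * mB * (PI * PJ * q) / 2)"
    proof (rule ennreal_leI)
      have "mB * PJ * q'\<^sup>2 \<le> (3 ^ ?d * k powr v) * PJ * q'\<^sup>2"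
        using mB_le q0 by (intro mult_right_mono) auto
      also have "\<dots> = (3 ^ ?d * cJ * C\<^sup>2 * k powr (v - b - g)) * k powr (- g)"
        using elim(4) by (simp add: PJ_def q'_def power_mult_distrib power2_eq_square powr_diff powr_minus_divide mult_ac)
      also have "\<dots> \<le> c / 2 * k powr (- g)" using elim(1) by (intro mult_right_mono) auto
      finally have "mB * PJ * q'\<^sup>2 \<le> q / 2" by (simp add: q_def)
      then have "(mA * mB * (PI * PJ)) * (mB * PJ * q'\<^sup>2) \<le> (mA * mB * (PI * PJ)) * (q / 2)"
        using mA mB q0 by (intro mult_left_mono) auto
      then show "mA * mB\<^sup>2 * (PI * PJ\<^sup>2 * q'\<^sup>2) \<le> mA * mB * (PI * PJ * q) / 2"
        by (simp add: power2_eq_square mult_ac)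
    qed
    also have "intensity ?A * intensity ?B * (ennreal PI * ennreal PJ * ennreal q) = ennreal (mA * mB * (PI * PJ * q))"
      using mA mB q0 by (simp add: ennreal_mult)
    finally have fin: "ennreal (mA * mB * (PI * PJ * q)) \<le> down_count ?A k + ennreal (mA * mB * (PI * PJ * q) / 2)"
      by (simp add: add_left_mono)
    have half: "ennreal (mA * mB * (PI * PJ * q) / 2) \<le> down_count ?A k"
    \<comment> \<open>The correction is subtracted among reals; an infinite count satisfies the
      claim trivially.\<close>
    proof (cases "down_count ?A k")
      case (real r)
      have "0 \<le> mA * mB * (PI * PJ * q)" using mA mB q0 by simp
      with fin real have "mA * mB * (PI * PJ * q) \<le> r + mA * mB * (PI * PJ * q) / 2"
        by (simp add: ennreal_le_iff flip: ennreal_plus)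
      then show ?thesis using real by (simp add: ennreal_leI)
    qed simp
    have "?c * k powr (1 - a + (v - b - g)) = (k / (2 * 2 ^ ?d)) * k powr v * (PI * PJ * q) / 2"
      using elim(4) by (simp add: PI_def PJ_def q_def powr_diff powr_add powr_minus_divide mult_ac)
    also have "\<dots> \<le> mA * mB * (PI * PJ * q) / 2"
      using mA_ge mB_ge mA mB q0 elim(4) by (intro divide_right_mono mult_right_mono mult_mono) auto
    finally show ?case using half by (metis ennreal_leI order_trans)
  qed
  moreover have "0 < ?c" using pos by simp
  ultimately show ?thesis by blast
qed

section \<open>Edge probabilities between the box and the target cube\<close>

lemma edge_prob_eq_p:
  fixes x y :: "real^'d"
  assumes "1 < \<alpha>" "1 \<le> \<beta> * kernel_val CARD('d) \<kappa> u v / norm (x - y) ^ CARD('d)"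
  shows "link_prob x y u v = p"
  using assms by (simp add: edge_prob_def profile_def)

text \<open>A kernel of order k^(a + \<sigma> b) is divided by the d-th power of a distance, of
  order k. The inner mark may reach 4 k^a because it will range over [2 k^a, 4 k^a).\<close>

lemma edge_ratio_bounds:
  fixes k a b v u w :: real
  assumes "1 \<le> k" "v \<le> 1" "x \<in> vol_box (k / 2)" "y \<in> target_box v k" "0 \<le> b"
    and u: "k powr a \<le> u" "u \<le> 4 * k powr a" and w: "k powr b \<le> w" "w \<le> 2 * k powr b" and "w \<le> u"
  defines "s \<equiv> \<beta> * kernel_val CARD('d) \<kappa> u w / norm (x - y) ^ CARD('d)"
  shows "\<beta> / (4 * CARD('d)) ^ CARD('d) * k powr (a + sigma_of \<kappa> * b - 1) \<le> s"
    and "s \<le> \<beta> * 2 ^ CARD('d) * 4 * 2 powr sigma_of \<kappa> / ((1 - 2 powr (- (1 / CARD('d)))) / 2) ^ CARD('d)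
      * k powr (a + sigma_of \<kappa> * b - 1)"
proof -
  let ?\<sigma> = "sigma_of \<kappa>" and ?K = "kernel_val CARD('d) \<kappa> u w" and ?D = "dist x y ^ CARD('d)"
  let ?c1 = "((1 - 2 powr (- (1 / CARD('d)))) / 2) ^ CARD('d)" and ?c2 = "(4 * CARD('d)) ^ CARD('d) :: real"
  have "0 < (1 - 2 powr (- (1 / CARD('d)))) / 2" using powr_less_mono[of "- (1 / CARD('d))" 0 2] by simp
  then have c1: "0 < ?c1" by (rule zero_less_power)
  have c2: "0 < ?c2" by simp
  have D: "?c1 * k \<le> ?D" "?D \<le> ?c2 * k" using dist_target_box[OF assms(1-4)] by auto
  have D0: "0 < ?D" using D(1) c1 assms(1) by (intro less_le_trans[OF _ D(1)]) auto
  have w1: "1 \<le> w" using w(1) ge_one_powr_ge_zero[of k b] assms by linarith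
  have e: "k powr (a + ?\<sigma> * b - 1) = k powr a * (k powr b) powr ?\<sigma> / k"
    using assms(1) by (simp add: powr_diff powr_add powr_powr mult.commute)
  have K1: "k powr a * (k powr b) powr ?\<sigma> \<le> ?K"
  proof -
    have "k powr a * (k powr b) powr ?\<sigma> \<le> u * w powr ?\<sigma>"
      using u w w1 sigma_nonneg by (intro mult_mono powr_mono2) auto
    also have "\<dots> \<le> ?K" using kernel_val_ge[of w u "CARD('d)" \<kappa>] w1 assms sigma_nonneg by auto
    finally show ?thesis .
  qed
  have K2: "?K \<le> 2 ^ CARD('d) * 4 * 2 powr ?\<sigma> * (k powr a * (k powr b) powr ?\<sigma>)"
  proof -
    have "?K \<le> 2 ^ CARD('d) * u * w powr ?\<sigma>" using kernel_val_le[of w u "CARD('d)" \<kappa>] w1 assms by auto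
    also have "\<dots> \<le> 2 ^ CARD('d) * (4 * k powr a) * (2 * k powr b) powr ?\<sigma>"
      using u w w1 sigma_nonneg by (intro mult_mono powr_mono2) auto
    finally show ?thesis by (simp add: powr_mult mult_ac)
  qed
  have "\<beta> / ?c2 * k powr (a + ?\<sigma> * b - 1) = \<beta> * (k powr a * (k powr b) powr ?\<sigma>) / (?c2 * k)"
    unfolding e by simp
  also have "\<dots> \<le> \<beta> * ?K / ?D"
    using K1 D D0 beta_pos c2 order_trans[OF _ K1, of 0] by (intro frac_le mult_left_mono) auto
  finally show "\<beta> / ?c2 * k powr (a + ?\<sigma> * b - 1) \<le> s" by (simp add: s_def dist_norm)
  have "\<beta> * ?K / ?D \<le> \<beta> * (2 ^ CARD('d) * 4 * 2 powr ?\<sigma> * (k powr a * (k powr b) powr ?\<sigma>)) / (?c1 * k)"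
    using K2 D D0 beta_pos c1 assms(1) by (intro frac_le mult_left_mono) auto
  also have "\<dots> = \<beta> * 2 ^ CARD('d) * 4 * 2 powr ?\<sigma> / ?c1 * k powr (a + ?\<sigma> * b - 1)"
    unfolding e by simp
  finally show "s \<le> \<beta> * 2 ^ CARD('d) * 4 * 2 powr ?\<sigma> / ?c1 * k powr (a + ?\<sigma> * b - 1)"
    by (simp add: s_def dist_norm)
qed

text \<open>A nonpositive exponent keeps the argument of the profile bounded, so the cap at 1 costs
  only a constant in the lower bound.\<close>

lemma edge_prob_bounds:
  fixes al a b v :: real
  assumes "\<alpha> = ereal al" "1 < al" "v \<le> 1" "0 \<le> b" and e: "a + sigma_of \<kappa> * b - 1 \<le> 0"
  shows "\<exists>c>0. \<exists>C. \<forall>k\<ge>1. \<forall>x\<in>vol_box (k / 2). \<forall>y\<in>target_box v k. \<forall>u w.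
      k powr a \<le> u \<longrightarrow> u \<le> 4 * k powr a \<longrightarrow> k powr b \<le> w \<longrightarrow> w \<le> 2 * k powr b \<longrightarrow> w \<le> u \<longrightarrow>
      c * k powr (al * (a + sigma_of \<kappa> * b - 1)) \<le> link_prob x y u w \<and>
      link_prob x y u w \<le> C * k powr (al * (a + sigma_of \<kappa> * b - 1))"
proof -
  let ?e = "a + sigma_of \<kappa> * b - 1"
  define m1 where "m1 = \<beta> / (4 * CARD('d)) ^ CARD('d)"
  define m2 where "m2 = \<beta> * 2 ^ CARD('d) * 4 * 2 powr sigma_of \<kappa> / ((1 - 2 powr (- (1 / CARD('d)))) / 2) ^ CARD('d)"
  have m1: "0 < m1" using beta_pos by (simp add: m1_def)
  have "p * min 1 m1 powr al * k powr (al * ?e) \<le> link_prob x y u w \<and>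
      link_prob x y u w \<le> m2 powr al * k powr (al * ?e)"
    if H: "1 \<le> k" "x \<in> vol_box (k / 2)" "y \<in> target_box v k" "k powr a \<le> u" "u \<le> 4 * k powr a"
      "k powr b \<le> w" "w \<le> 2 * k powr b" "w \<le> u" for k x y u w
  proof -
    define s where "s = \<beta> * kernel_val CARD('d) \<kappa> u w / norm (x - y) ^ CARD('d)"
    have s: "m1 * k powr ?e \<le> s" "s \<le> m2 * k powr ?e"
      using edge_ratio_bounds[OF H(1) assms(3) H(2,3) assms(4) H(4-8)] by (auto simp: m1_def m2_def s_def)
    have s0: "0 < s" using m1 H(1) by (intro less_le_trans[OF _ s(1)]) auto
    have m2: "0 < m2 * k powr ?e" using s0 s(2) by linarith
    then have m2': "0 < m2" using H(1) by (simp add: zero_less_mult_iff)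
    have edge: "link_prob x y u w = p * min 1 s powr al"
      using assms(1) by (simp add: edge_prob_def profile_def s_def)
    have k1: "k powr ?e \<le> 1" "0 < k powr ?e" using H(1) e powr_mono[of ?e 0 k] by auto
    have "min 1 m1 * k powr ?e \<le> 1" using m1 k1 by (intro mult_le_one) auto
    moreover have "min 1 m1 * k powr ?e \<le> s"
      using s(1) mult_right_mono[of "min 1 m1" m1 "k powr ?e"] k1 by linarith
    ultimately have "min 1 m1 * k powr ?e \<le> min 1 s" by (rule min.boundedI)
    then have "(min 1 m1 * k powr ?e) powr al \<le> min 1 s powr al"
      using m1 k1 assms(2) by (intro powr_mono2) auto
    moreover have "(min 1 m1 * k powr ?e) powr al = min 1 m1 powr al * k powr (al * ?e)"
      using m1 by (simp add: powr_mult powr_powr mult.commute)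
    ultimately have 1: "p * min 1 m1 powr al * k powr (al * ?e) \<le> p * min 1 s powr al"
      using p_pos by (simp add: mult.assoc)
    have "p * min 1 s powr al \<le> 1 * s powr al"
      using p_pos p_le_1 s0 assms(2) by (intro mult_mono powr_mono2) auto
    also have "\<dots> \<le> (m2 * k powr ?e) powr al" using s s0 assms(2) by (simp add: powr_mono2)
    also have "\<dots> = m2 powr al * k powr (al * ?e)"
      using m2' by (simp add: powr_mult powr_powr mult.commute)
    finally show ?thesis using 1 edge by simp
  qed
  moreover have "0 < p * min 1 m1 powr al" using p_pos m1 by simp
  ultimately show ?thesis
    by (intro exI[of _ "p * min 1 m1 powr al"] conjI exI[of _ "m2 powr al"] allI impI ballI) auto
qed

text \<open>The target volume has full order k. Inner marks lie in [2 k^a, 4 k^a) and outer marks in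
  [k^b, 2 k^b), so b \<le> a makes every edge point downwards, also when a = b.\<close>

lemma long_lower_finite:
  fixes al t a b :: real
  assumes al: "\<alpha> = ereal al" "1 < al" and t: "\<tau> = ereal t" "2 < t" and ab: "0 \<le> b" "b \<le> a"
    and e: "a + sigma_of \<kappa> * b - 1 \<le> 0" and neg: "1 - b * (t - 1) + al * (a + sigma_of \<kappa> * b - 1) < 0"
  shows "grows_at_least long_count (1 - a * (t - 1) + (1 - b * (t - 1) + al * (a + sigma_of \<kappa> * b - 1)))"
proof -
  obtain c C where c: "0 < c" and C: "\<And>k x y u w. 1 \<le> k \<Longrightarrow> x \<in> vol_box (k / 2) \<Longrightarrow> y \<in> target_box 1 k \<Longrightarrow>
      k powr a \<le> u \<Longrightarrow> u \<le> 4 * k powr a \<Longrightarrow> k powr b \<le> w \<Longrightarrow> w \<le> 2 * k powr b \<Longrightarrow> w \<le> u \<Longrightarrow>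
      c * k powr (al * (a + sigma_of \<kappa> * b - 1)) \<le> link_prob x y u w \<and>
      link_prob x y u w \<le> C * k powr (al * (a + sigma_of \<kappa> * b - 1))"
    using edge_prob_bounds[OF al order_refl ab(1) e] by metis
  let ?I = "\<lambda>k. {2 * k powr a..<2 * (2 * k powr a)}" and ?J = "\<lambda>k. {k powr b..<2 * k powr b}"
  let ?c = "1 - 2 powr (- (t - 1))"
  have c0: "0 < ?c" using t(2) by (rule mark_interval_const_pos)
  have le: "k powr b \<le> k powr a" "1 \<le> k powr b" if "1 \<le> k" for k :: real
    using that ab by (auto intro: powr_mono ge_one_powr_ge_zero)
  have "grows_at_least long_count (1 - a * (t - 1) + (1 - b * (t - 1) - (- (al * (a + sigma_of \<kappa> * b - 1)))))"
  proof (rule down_count_lower_exponent[where I="?I" and J="?J" and cI="?c * 2 powr (- (t - 1))" and cJ="?c" and c=c and C=C])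
    fix k :: real and i assume k: "1 \<le> k"
    show "pr (\<lambda>\<omega>. W i \<omega> \<in> ?I k) = ennreal (?c * 2 powr (- (t - 1)) * k powr (- (a * (t - 1))))"
      using emeasure_scaled_mark_interval[OF t _ k, of 2 a] ab by simp
    show "pr (\<lambda>\<omega>. W i \<omega> \<in> ?J k) = ennreal (?c * k powr (- (b * (t - 1))))"
      using emeasure_scaled_mark_interval[OF t order_refl k, of b] ab by simp
  next
    fix k u v :: real assume k: "1 \<le> k" and "u \<in> ?I k" "v \<in> ?J k"
    then show "v \<le> u" using le[OF k] by auto
  next
    show "eventually (\<lambda>k. \<forall>x\<in>vol_box (k / 2). \<forall>y\<in>target_box 1 k. \<forall>u\<in>?I k. \<forall>w\<in>?J k.
       c * k powr (- (- (al * (a + sigma_of \<kappa> * b - 1)))) \<le> link_prob x y u w \<and>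
       link_prob x y u w \<le> C * k powr (- (- (al * (a + sigma_of \<kappa> * b - 1))))) at_top"
      using eventually_ge_at_top[of 1]
    proof eventually_elim
      case (elim k)
      show ?case
      proof (intro ballI)
        fix x y :: "real^'d" and u w assume H: "x \<in> vol_box (k / 2)" "y \<in> target_box 1 k" "u \<in> ?I k" "w \<in> ?J k"
        show "c * k powr (- (- (al * (a + sigma_of \<kappa> * b - 1)))) \<le> link_prob x y u w \<and>
          link_prob x y u w \<le> C * k powr (- (- (al * (a + sigma_of \<kappa> * b - 1))))"
          unfolding minus_minus using H le[OF elim] by (intro C[OF elim H(1,2)]) auto
      qed
    qed
  qed (use c c0 neg in auto)
  then show ?thesis by simp
qed

text \<open>For a = b = 0 a vertex has about k^(1 - \<alpha>) edges in expectation, which is small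
  because \<alpha> > 1, and k vertices give the exponent 2 - \<alpha>. For constant marks both
  windows are replaced by the singleton of 1.\<close>

lemma long_lower_ll:
  assumes "1 < \<alpha>" "2 < \<tau>" "0 < zeta_ll \<alpha>" "ereal \<eta> < zeta_ll \<alpha>"
  shows "grows_at_least long_count \<eta>"
proof -
  have "\<alpha> \<noteq> \<infinity>" using assms(3) by (intro notI) simp
  then obtain al where al: "\<alpha> = ereal al" "1 < al" using assms(1) by (cases \<alpha>) auto
  have \<eta>: "\<eta> \<le> 2 - al" using assms(4) al by (simp add: zeta_ll_ereal)
  show ?thesis
  proof (cases "\<tau> = \<infinity>")
    case False
    then obtain t where t: "\<tau> = ereal t" "2 < t" using assms(2) by (cases \<tau>) auto
    have "0 + sigma_of \<kappa> * 0 - 1 \<le> 0" "1 - 0 * (t - 1) + al * (0 + sigma_of \<kappa> * 0 - 1) < 0"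
      using al by simp_all
    from long_lower_finite[OF al t order_refl order_refl this] show ?thesis
      by (rule eventually_powr_lower_mono) (use \<eta> in simp)
  next
    case True
    have "0 + sigma_of \<kappa> * 0 - 1 \<le> 0" by simp
    from edge_prob_bounds[OF al order_refl order_refl this]
    obtain c C where c: "0 < c" and C: "\<And>k x y u w. 1 \<le> k \<Longrightarrow> x \<in> vol_box (k / 2) \<Longrightarrow> y \<in> target_box 1 k \<Longrightarrow>
      k powr 0 \<le> u \<Longrightarrow> u \<le> 4 * k powr 0 \<Longrightarrow> k powr 0 \<le> w \<Longrightarrow> w \<le> 2 * k powr 0 \<Longrightarrow> w \<le> u \<Longrightarrow>
      c * k powr (al * (0 + sigma_of \<kappa> * 0 - 1)) \<le> link_prob x y u w \<and>
      link_prob x y u w \<le> C * k powr (al * (0 + sigma_of \<kappa> * 0 - 1))"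
      by metis
    have W1: "pr (\<lambda>\<omega>. W i \<omega> \<in> {1}) = 1" for i
      using W_const[OF True, of i] by (subst AE_iff_emeasure_eq_1[symmetric]) auto
    have "grows_at_least long_count (1 - 0 + (1 - 0 - al))"
    proof (rule down_count_lower_exponent[where I="\<lambda>_. {1}" and J="\<lambda>_. {1}" and cI=1 and cJ=1 and c=c and C=C])
      show "eventually (\<lambda>k. \<forall>x\<in>vol_box (k / 2). \<forall>y\<in>target_box 1 k. \<forall>u\<in>{1}. \<forall>w\<in>{1}.
       c * k powr (- al) \<le> link_prob x y u w \<and> link_prob x y u w \<le> C * k powr (- al)) at_top"
        using eventually_ge_at_top[of 1]
      proof eventually_elim
        case (elim k)
        show ?case using C[OF elim, of _ _ 1 1] elim by simp
      qed
    qed (use c al W1 in auto)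
    then show ?thesis by (rule eventually_powr_lower_mono) (use \<eta> in simp)
  qed
qed

text \<open>For b = 0 the expected number of edges per vertex is about k^(1 + \<alpha> (a - 1)), of
  order one at a = 1 - 1 / \<alpha>. There the number of suitable vertices has exponent 1 - a
  (\<tau> - 1), which is \<open>zeta_hl\<close>. Positivity of the exponent excludes \<alpha> =
  \<infinity>, where it equals 2 - \<tau>.\<close>

lemma long_lower_hl:
  assumes "1 < \<alpha>" "2 < \<tau>" "0 < zeta_hl \<alpha> \<tau>" "ereal \<eta> < zeta_hl \<alpha> \<tau>"
  shows "grows_at_least long_count \<eta>"
proof -
  have "\<tau> \<noteq> \<infinity>" using assms(3) by (intro notI) simp
  then obtain t where t: "\<tau> = ereal t" "2 < t" using assms(2) by (cases \<tau>) auto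
  have "\<alpha> \<noteq> \<infinity>" using assms(3) t by (intro notI) (simp add: zeta_hl_ereal)
  then obtain al where al: "\<alpha> = ereal al" "1 < al" using assms(1) by (cases \<alpha>) auto
  have z: "\<eta> < (t - 1) / al - (t - 2)" using assms(4) al t by (simp add: zeta_hl_ereal)
  have "0 < 1 - 1 / al" using al by simp
  moreover have "0 < (t - 1) / al - (t - 2) - \<eta>" using z by simp
  ultimately obtain \<epsilon> where \<epsilon>: "0 < \<epsilon>" "\<epsilon> \<le> 1 - 1 / al" "\<epsilon> * (al - (t - 1)) < (t - 1) / al - (t - 2) - \<eta>"
    by (rule obtain_small_scale)
  \<comment> \<open>Slightly below the critical value, so that about k^(- \<alpha> \<epsilon>) edges
    per vertex are expected.\<close>
  define a where "a = 1 - 1 / al - \<epsilon>"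
  have n: "1 - 0 * (t - 1) + al * (a + sigma_of \<kappa> * 0 - 1) = - (al * \<epsilon>)"
    using al by (simp add: a_def field_simps)
  have "grows_at_least long_count (1 - a * (t - 1) + (1 - 0 * (t - 1) + al * (a + sigma_of \<kappa> * 0 - 1)))"
  proof (rule long_lower_finite[OF al t order_refl])
    show "0 \<le> a" using \<epsilon> by (simp add: a_def)
    have "0 < 1 / al" using al by simp
    then show "a + sigma_of \<kappa> * 0 - 1 \<le> 0" using \<epsilon>(1) unfolding a_def mult_zero_right by linarith
    show "1 - 0 * (t - 1) + al * (a + sigma_of \<kappa> * 0 - 1) < 0" unfolding n using \<epsilon> al by simp
  qed
  then show ?thesis unfolding n
  proof (rule eventually_powr_lower_mono)
    have "1 - a * (t - 1) + - (al * \<epsilon>) = (t - 1) / al - (t - 2) - \<epsilon> * (al - (t - 1))"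
      by (simp add: a_def algebra_simps diff_divide_distrib)
    then show "\<eta> \<le> 1 - a * (t - 1) + - (al * \<epsilon>)" using \<epsilon>(3) by simp
  qed
qed

text \<open>For finite \<alpha> and a = b, the balance 1 - a (\<tau> - 1) + \<alpha> (a (1 +
  \<sigma>) - 1) = 0 is solved by a = (\<alpha> - 1) / D with D = \<alpha> (\<sigma> + 1) - (\<tau>
  - 1), and 1 - a (\<tau> - 1) is then \<open>zeta_hh\<close>. For \<alpha> = \<infinity> the edge
  probability switches from 0 to \<open>p\<close> around a = 1 / (\<sigma> + 1).\<close>

lemma long_lower_hh:
  assumes "1 < \<alpha>" "2 < \<tau>" "0 < zeta_hh \<alpha> \<tau> (sigma_of \<kappa>)" "ereal \<eta> < zeta_hh \<alpha> \<tau> (sigma_of \<kappa>)"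
  shows "grows_at_least long_count \<eta>"
proof -
  let ?\<sigma> = "sigma_of \<kappa>"
  note \<sigma> = sigma_nonneg
  have "\<tau> \<noteq> \<infinity>" using assms(3) by (intro notI) simp
  then obtain t where t: "\<tau> = ereal t" "2 < t" using assms(2) by (cases \<tau>) auto
  show ?thesis
  proof (cases "\<alpha> = \<infinity>")
    case False
    then obtain al where al: "\<alpha> = ereal al" "1 < al" using assms(1) by (cases \<alpha>) auto
    have al': "(t - 1) / al < t - 1" using al t by (simp add: divide_simps)
    \<comment> \<open>From \<tau> = \<sigma> + 2 onwards the formula for \<open>zeta_hh\<close> is
      zero or negative, against its assumed positivity.\<close>
    have t_less: "t < ?\<sigma> + 2"
    proof (rule ccontr)
      assume ge: "\<not> t < ?\<sigma> + 2"
      show False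
      proof (cases "t = ?\<sigma> + 2")
        case True
        then have "zeta_hh \<alpha> \<tau> ?\<sigma> = 0" using t al al' by (simp add: zeta_hh_ereal zero_ereal_def)
        then show False using assms(3) by simp
      next
        case False
        then have "zeta_hh \<alpha> \<tau> ?\<sigma> = ereal ((?\<sigma> + 2 - t) / (?\<sigma> + 1))"
          using t ge \<sigma> by (simp add: zeta_hh_ereal)
        moreover have "(?\<sigma> + 2 - t) / (?\<sigma> + 1) \<le> 0" using ge \<sigma> by (intro divide_nonpos_pos) auto
        ultimately show False using assms(3) by simp
      qed
    qed
    define D where "D = al * (?\<sigma> + 1) - (t - 1)"
    have D: "al - 1 \<le> D" "0 < D"
    proof -
      have "al * (?\<sigma> + 1) - (?\<sigma> + 1) \<le> D" using t_less by (simp add: D_def)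
      moreover have "(al - 1) * 1 \<le> (al - 1) * (?\<sigma> + 1)" using al \<sigma> by (intro mult_left_mono) auto
      ultimately show "al - 1 \<le> D" by (simp add: algebra_simps)
      then show "0 < D" using al by simp
    qed
    have D_div: "?\<sigma> + 1 - (t - 1) / al = D / al" using al by (simp add: D_def field_simps)
    have "\<eta> < (?\<sigma> + 2 - t) / (?\<sigma> + 1 - (t - 1) / al)"
      using assms(4) al t t_less al' by (simp add: zeta_hh_ereal)
    then have z: "\<eta> < al * (?\<sigma> + 2 - t) / D" by (simp add: D_div mult.commute)
    have "0 < (al - 1) / D" using D al by simp
    moreover have "0 < al * (?\<sigma> + 2 - t) / D - \<eta>" using z by simp
    ultimately obtain \<epsilon> where \<epsilon>: "0 < \<epsilon>" "\<epsilon> \<le> (al - 1) / D" "\<epsilon> * (D - (t - 1)) < al * (?\<sigma> + 2 - t) / D - \<eta>"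
      by (rule obtain_small_scale)
    define a where "a = (al - 1) / D - \<epsilon>"
    have aD: "a * D = al - 1 - \<epsilon> * D" using D by (simp add: a_def left_diff_distrib[of "(al - 1) / D"])
    have n: "1 - a * (t - 1) + al * (a + ?\<sigma> * a - 1) = - (\<epsilon> * D)"
      using aD by (simp add: D_def algebra_simps)
    have "grows_at_least long_count (1 - a * (t - 1) + (1 - a * (t - 1) + al * (a + ?\<sigma> * a - 1)))"
    proof (rule long_lower_finite[OF al t _ order_refl])
      show "0 \<le> a" using \<epsilon> by (simp add: a_def)
      \<comment> \<open>Equivalent to \<tau> \<le> \<sigma> + 2; this makes the argument of the
        profile a nonpositive power of k.\<close>
      have "(al - 1) / D * (1 + ?\<sigma>) \<le> 1"
        using D t_less by (simp add: D_def field_simps)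
      moreover have "a * (1 + ?\<sigma>) \<le> (al - 1) / D * (1 + ?\<sigma>)"
        using \<epsilon> \<sigma> by (intro mult_right_mono) (auto simp: a_def)
      ultimately show "a + ?\<sigma> * a - 1 \<le> 0" by (simp add: algebra_simps)
      show "1 - a * (t - 1) + al * (a + ?\<sigma> * a - 1) < 0" unfolding n using \<epsilon> D by simp
    qed
    then show ?thesis unfolding n
    proof (rule eventually_powr_lower_mono)
      have "al * (?\<sigma> + 2 - t) / D = 1 - (al - 1) / D * (t - 1)"
        using D by (simp add: D_def field_simps)
      then have "1 - a * (t - 1) + - (\<epsilon> * D) = al * (?\<sigma> + 2 - t) / D - \<epsilon> * (D - (t - 1))"
        by (simp add: a_def algebra_simps)
      then show "\<eta> \<le> 1 - a * (t - 1) + - (\<epsilon> * D)" using \<epsilon>(3) by simp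
    qed
  next
    case True
    have z: "0 < (?\<sigma> + 2 - t) / (?\<sigma> + 1)" "\<eta> < (?\<sigma> + 2 - t) / (?\<sigma> + 1)"
      using assms(3,4) True t \<sigma> by (simp_all add: zeta_hh_ereal)
    have eq: "1 - (t - 1) / (?\<sigma> + 1) = (?\<sigma> + 2 - t) / (?\<sigma> + 1)" using \<sigma> by (simp add: field_simps)
    have "0 < min 1 ((?\<sigma> + 2 - t) / (?\<sigma> + 1)) / t" using z t by simp
    moreover have "0 < (?\<sigma> + 2 - t) / (?\<sigma> + 1) - \<eta>" using z by simp
    ultimately obtain \<epsilon> where \<epsilon>: "0 < \<epsilon>" "\<epsilon> \<le> min 1 ((?\<sigma> + 2 - t) / (?\<sigma> + 1)) / t"
      "\<epsilon> * t < (?\<sigma> + 2 - t) / (?\<sigma> + 1) - \<eta>"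
      by (rule obtain_small_scale)
    \<comment> \<open>Just above the switch, so that the argument of the profile is bounded below by
      a positive power of k and eventually exceeds 1.\<close>
    define a where "a = 1 / (?\<sigma> + 1) + \<epsilon>"
    have a: "0 \<le> a" "0 < a + ?\<sigma> * a - 1"
    proof -
      have "(r + \<epsilon>) + ?\<sigma> * (r + \<epsilon>) = (?\<sigma> + 1) * r + (?\<sigma> + 1) * \<epsilon>" for r by (simp add: algebra_simps)
      from this[of "1 / (?\<sigma> + 1)"]
      have "a + ?\<sigma> * a = (?\<sigma> + 1) * (1 / (?\<sigma> + 1)) + (?\<sigma> + 1) * \<epsilon>" unfolding a_def .
      moreover have "(?\<sigma> + 1) * (1 / (?\<sigma> + 1)) = 1" "0 < (?\<sigma> + 1) * \<epsilon>" using \<sigma> \<epsilon>(1) by simp_all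
      ultimately show "0 < a + ?\<sigma> * a - 1" by linarith
    qed (use \<epsilon>(1) \<sigma> in \<open>simp add: a_def\<close>)
    have at: "a * (t - 1) = (t - 1) / (?\<sigma> + 1) + \<epsilon> * (t - 1)" by (simp add: a_def distrib_right)
    \<comment> \<open>Here edges are present with probability \<open>p\<close>, so the volume \<open>k\<^sup>v\<close> of the target has to be
      reduced to keep the expected number of edges small.\<close>
    define v where "v = a * (t - 1) - \<epsilon>"
    have v: "0 \<le> v" "v \<le> 1"
    proof -
      have "\<epsilon> * t \<le> min 1 ((?\<sigma> + 2 - t) / (?\<sigma> + 1))" using \<epsilon>(2) t by (simp add: pos_le_divide_eq)
      moreover have "0 \<le> (t - 1) / (?\<sigma> + 1)" using t \<sigma> by simp
      moreover have "0 \<le> \<epsilon> * (t - 2)" using \<epsilon> t by simp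
      moreover have "v = (t - 1) / (?\<sigma> + 1) + \<epsilon> * (t - 2)" unfolding v_def at by (simp add: algebra_simps)
      moreover have "\<epsilon> * (t - 2) \<le> \<epsilon> * t" using \<epsilon> by simp
      ultimately show "0 \<le> v" "v \<le> 1" using eq by (auto simp del: mult_le_cancel_left_pos)
    qed
    let ?I = "\<lambda>k. {2 * k powr a..<2 * (2 * k powr a)}" and ?J = "\<lambda>k. {k powr a..<2 * k powr a}"
    let ?c = "1 - 2 powr (- (t - 1))"
    have c0: "0 < ?c" using t(2) by (rule mark_interval_const_pos)
    have "grows_at_least long_count (1 - a * (t - 1) + (v - a * (t - 1) - 0))"
    proof (rule down_count_lower_exponent[where I="?I" and J="?J" and cI="?c * 2 powr (- (t - 1))" and cJ="?c" and c=p and C=p])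
      fix k :: real and i assume k: "1 \<le> k"
      show "pr (\<lambda>\<omega>. W i \<omega> \<in> ?I k) = ennreal (?c * 2 powr (- (t - 1)) * k powr (- (a * (t - 1))))"
        using emeasure_scaled_mark_interval[OF t _ k, of 2 a] a by simp
      show "pr (\<lambda>\<omega>. W i \<omega> \<in> ?J k) = ennreal (?c * k powr (- (a * (t - 1))))"
        using emeasure_scaled_mark_interval[OF t order_refl k, of a] a by simp
    next
      let ?m = "\<beta> / (4 * CARD('d)) ^ CARD('d)"
      have "0 < ?m" using beta_pos by simp
      moreover have "filterlim (\<lambda>k::real. k powr (a + ?\<sigma> * a - 1)) at_top at_top"
        using a(2) by real_asymp
      ultimately have "filterlim (\<lambda>k. ?m * k powr (a + ?\<sigma> * a - 1)) at_top at_top"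
        by (intro filterlim_tendsto_pos_mult_at_top[OF tendsto_const])
      then have ev: "eventually (\<lambda>k. 1 \<le> ?m * k powr (a + ?\<sigma> * a - 1)) at_top"
        unfolding filterlim_at_top by blast
      show "eventually (\<lambda>k. \<forall>x\<in>vol_box (k / 2). \<forall>y\<in>target_box v k. \<forall>u\<in>?I k. \<forall>w\<in>?J k.
         p * k powr (- 0) \<le> link_prob x y u w \<and> link_prob x y u w \<le> p * k powr (- 0)) at_top"
        using ev eventually_ge_at_top[of 1]
      proof eventually_elim
        case (elim k)
        have "link_prob x y u w = p"
          if H: "x \<in> vol_box (k / 2)" "y \<in> target_box v k" "u \<in> ?I k" "w \<in> ?J k" for x y u w
        proof (rule edge_prob_eq_p[OF assms(1)])
          have "?m * k powr (a + ?\<sigma> * a - 1) \<le> \<beta> * kernel_val CARD('d) \<kappa> u w / norm (x - y) ^ CARD('d)"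
            using H by (intro edge_ratio_bounds(1)[OF elim(2) v(2) H(1,2) a(1)]) auto
          then show "1 \<le> \<beta> * kernel_val CARD('d) \<kappa> u w / norm (x - y) ^ CARD('d)" using elim(1) by linarith
        qed
        then show ?case using elim(2) by simp
      qed
    qed (use c0 p_pos v \<epsilon> in \<open>auto simp: v_def\<close>)
    then show ?thesis
    proof (rule eventually_powr_lower_mono)
      have "1 - a * (t - 1) + (v - a * (t - 1) - 0) = (?\<sigma> + 2 - t) / (?\<sigma> + 1) - \<epsilon> * t"
        unfolding v_def eq[symmetric] at by (simp add: algebra_simps)
      then show "\<eta> \<le> 1 - a * (t - 1) + (v - a * (t - 1) - 0)" using \<epsilon>(3) by simp
    qed
  qed
qed

section \<open>Short edges across one face\<close>

lemma down_count_UN_ge: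
  assumes "finite Z" "\<And>z. z \<in> Z \<Longrightarrow> A z \<in> sets borel" "disjoint_family_on A Z"
    and "\<And>z. z \<in> Z \<Longrightarrow> c \<le> down_count (A z) k"
  shows "of_nat (card Z) * c \<le> down_count (\<Union>z\<in>Z. A z) k"
  using assms
proof (induction Z rule: finite_induct)
  case (insert z Z)
  have disj: "A z \<inter> (\<Union>y\<in>Z. A y) = {}"
    using insert.prems(2) insert.hyps(2) by (auto simp: disjoint_family_on_def)
  have "of_nat (card Z) * c \<le> down_count (\<Union>y\<in>Z. A y) k"
    using insert by (intro insert.IH) (auto simp: disjoint_family_on_def)
  then have "c + of_nat (card Z) * c \<le> down_count (A z) k + down_count (\<Union>y\<in>Z. A y) k"
    using insert.prems(3)[of z] by (intro add_mono) auto
  also have "\<dots> = down_count (\<Union>y\<in>insert z Z. A y) k"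
    using down_count_disjoint_Un[OF _ _ disj] insert.prems(1) insert.hyps(1) by (simp add: sets.finite_UN)
  finally show ?case using insert.hyps by (simp add: distrib_right)
qed simp

text \<open>Adjacent windows above the level \<open>w\<close> work for Pareto marks. Constant marks
  leave only the level 1, where both sets are the singleton of 1.\<close>

lemma mark_sets_above:
  assumes "2 < \<tau>" "1 \<le> w" "\<tau> = \<infinity> \<Longrightarrow> w = 1"
  shows "\<exists>I J PI PJ. I \<in> sets borel \<and> J \<in> sets borel \<and> (\<forall>u\<in>I. \<forall>v\<in>J. v \<le> u \<and> w \<le> v) \<and>
    0 < PI \<and> 0 < PJ \<and> PJ \<le> 1 \<and>
    (\<forall>i. pr (\<lambda>\<omega>. W i \<omega> \<in> I) = ennreal PI) \<and>
    (\<forall>i. pr (\<lambda>\<omega>. W i \<omega> \<in> J) = ennreal PJ) \<and>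
    (\<tau> = \<infinity> \<longrightarrow> I = {1} \<and> J = {1})"
proof (cases "\<tau> = \<infinity>")
  case True
  have W1: "pr (\<lambda>\<omega>. W i \<omega> \<in> {1}) = ennreal 1" for i
    using W_const[OF True, of i] unfolding ennreal_1 by (subst AE_iff_emeasure_eq_1[symmetric]) auto
  show ?thesis
    by (rule exI[of _ "{1}"], rule exI[of _ "{1}"], rule exI[of _ 1], rule exI[of _ 1]) (use W1 assms(3)[OF True] in auto)
next
  case False
  then obtain t where t: "\<tau> = ereal t" "2 < t" using assms(1) by (cases \<tau>) auto
  let ?P = "\<lambda>w. (1 - 2 powr (- (t - 1))) * w powr (- (t - 1))"
  have c: "0 < 1 - 2 powr (- (t - 1))" using t(2) by (rule mark_interval_const_pos)
  have "w powr (- (t - 1)) \<le> 1" using powr_mono[of "- (t - 1)" 0 w] assms t by simp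
  then have "?P w \<le> 1 * 1" using c by (intro mult_mono) auto
  then have P1: "?P w \<le> 1" by simp
  have P0: "0 < ?P w" "0 < ?P (2 * w)" using c assms(2) by auto
  show ?thesis
    by (rule exI[of _ "{2 * w..<2 * (2 * w)}"], rule exI[of _ "{w..<2 * w}"], rule exI[of _ "?P (2 * w)"], rule exI[of _ "?P w"])
      (use emeasure_mark_interval[OF t, of w] emeasure_mark_interval[OF t, of "2 * w"] assms(2) P0 P1 False in \<open>intro conjI; simp\<close>)
qed

text \<open>Bonferroni at a fixed scale, without asymptotics: a pair intensity of at most half the
  intensity, together with PJ q \<le> 1, makes the correction at most half of the main term.\<close>

lemma down_count_pair_ge:
  fixes q :: real
  assumes A: "A \<in> sets borel" "bounded A" and B: "B \<in> sets borel" "bounded B" and "A \<inter> B = {}"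
    and "B \<inter> vol_box k = {}" and I: "I \<in> sets borel" and J: "J \<in> sets borel"
    and down: "\<And>u v. u \<in> I \<Longrightarrow> v \<in> J \<Longrightarrow> v \<le> u"
    and edge: "\<And>x y u v. x \<in> A \<Longrightarrow> y \<in> B \<Longrightarrow> u \<in> I \<Longrightarrow> v \<in> J \<Longrightarrow> link_prob x y u v = q"
    and PI: "\<And>i. pr (\<lambda>\<omega>. W i \<omega> \<in> I) = ennreal PI"
    and PJ: "\<And>i. pr (\<lambda>\<omega>. W i \<omega> \<in> J) = ennreal PJ"
    and pos: "0 < PI" "0 < PJ" "PJ \<le> 1" "0 < q" "q \<le> 1"
    and m: "intensity A = ennreal mA" "intensity B = ennreal mB" "0 < mA" "0 < mB"
    and pair: "pair_intensity B \<le> ennreal (mB / 2)"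
  shows "ennreal (mA * mB * (PI * PJ * q) / 2) \<le> down_count A k"
proof -
  define hB where "hB = mB / 2"
  have hB: "0 < hB" "pair_intensity B \<le> ennreal hB" using m pair by (simp_all add: hB_def)
  have "ennreal (mA * mB * (PI * PJ * q)) = intensity A * intensity B * (ennreal PI * ennreal PJ * ennreal q)"
    using m pos by (simp add: ennreal_mult)
  also have "\<dots> \<le> down_count A k + intensity A * pair_intensity B * (ennreal PI * (ennreal PJ)\<^sup>2 * (ennreal q)\<^sup>2)"
    by (rule down_count_bonferroni[OF A B assms(5,6) I J down]) (use edge PI PJ in auto)
  also have "\<dots> \<le> down_count A k + ennreal mA * ennreal hB * (ennreal PI * (ennreal PJ)\<^sup>2 * (ennreal q)\<^sup>2)"
    unfolding m(1) by (intro add_left_mono mult_right_mono mult_left_mono hB(2)) auto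
  also have "\<dots> = down_count A k + ennreal (mA * hB * (PI * PJ\<^sup>2 * q\<^sup>2))"
    using m pos hB(1) by (simp add: ennreal_mult ennreal_power)
  also have "\<dots> \<le> down_count A k + ennreal (mA * mB * (PI * PJ * q) / 2)"
  proof (intro add_left_mono ennreal_leI)
    have "PJ * q \<le> 1 * 1" using pos by (intro mult_mono) auto
    then have "(mA * hB * (PI * PJ * q)) * (PJ * q) \<le> (mA * hB * (PI * PJ * q)) * 1"
      using m pos hB(1) by (intro mult_left_mono) auto
    then show "mA * hB * (PI * PJ\<^sup>2 * q\<^sup>2) \<le> mA * mB * (PI * PJ * q) / 2"
      by (simp add: power2_eq_square mult_ac hB_def)
  qed
  finally have fin: "ennreal (mA * mB * (PI * PJ * q)) \<le> down_count A k + ennreal (mA * mB * (PI * PJ * q) / 2)" .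
  show ?thesis
  proof (cases "down_count A k")
    case (real r)
    have "0 \<le> mA * mB * (PI * PJ * q)" using m pos by simp
    with fin real have "mA * mB * (PI * PJ * q) \<le> r + mA * mB * (PI * PJ * q) / 2"
      by (simp add: ennreal_le_iff flip: ennreal_plus)
    then show ?thesis using real by (simp add: ennreal_leI)
  qed simp
qed

text \<open>On the lattice \<open>s = 0\<close> is used, so that the box is a single vertex.\<close>

definition face_box :: "real \<Rightarrow> 'd \<Rightarrow> real \<Rightarrow> ('d \<Rightarrow> nat) \<Rightarrow> (real^'d) set" where
  "face_box s a h z = cbox (\<chi> i. if i = a then h else real (z i)) (\<chi> i. (if i = a then h else real (z i)) + s)"

lemma face_box_borel [measurable]: "face_box s a h z \<in> sets borel"
  and face_box_bounded: "bounded (face_box s a h z)"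
  by (auto simp: face_box_def bounded_cbox)

lemma mem_face_box:
  "x \<in> face_box s a h z \<longleftrightarrow> h \<le> x $ a \<and> x $ a \<le> h + s \<and> (\<forall>i. i \<noteq> a \<longrightarrow> real (z i) \<le> x $ i \<and> x $ i \<le> real (z i) + s)"
  by (auto simp: face_box_def mem_box_cart)

text \<open>At least (L / 4)^(d - 1) disjoint pieces lie along a face orthogonal to the axis
  \<open>a\<close>, each contributing \<delta>, and L^(d - 1) = k^((d - 1) / d). In the other
  coordinates the pieces start at integers, so s < 1 keeps them disjoint.\<close>

lemma down_count_face_ge:
  fixes h h' :: "real \<Rightarrow> real"
  assumes s: "0 \<le> s" "s < 1"
    and h: "\<And>k. 1 \<le> k \<Longrightarrow> - (k powr (1 / CARD('d)) / 2) \<le> h k" "\<And>k. h k + s \<le> k powr (1 / CARD('d)) / 2"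
    and ge: "\<And>k z. 1 \<le> k \<Longrightarrow> ennreal \<delta> \<le> down_count (face_box s a (h k) z) k"
    and "0 < \<delta>"
  shows "grows_at_least star_count ((CARD('d) - 1) / CARD('d))"
proof -
  let ?d = "CARD('d)"
  have ev: "eventually (\<lambda>k::real. 4 \<le> k powr (1 / ?d)) at_top" by real_asymp
  have "eventually (\<lambda>k. ennreal (\<delta> / 4 ^ (?d - 1) * k powr ((?d - 1) / ?d)) \<le> star_count k) at_top"
    using ev eventually_ge_at_top[of 1]
  proof eventually_elim
    case (elim k)
    let ?L = "k powr (1 / ?d)"
    \<comment> \<open>Starting points 0, ..., N - 1 together with s < 1 stay below L / 2. Using only
      the nonnegative part of the face costs a constant.\<close>
    define N where "N = nat \<lfloor>?L / 2\<rfloor>"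
    have N: "real N \<le> ?L / 2" "?L / 4 \<le> real N"
    proof -
      have "real N = of_int \<lfloor>?L / 2\<rfloor>" using elim(1) by (simp add: N_def)
      moreover have "of_int \<lfloor>?L / 2\<rfloor> \<le> ?L / 2" "?L / 2 < of_int \<lfloor>?L / 2\<rfloor> + 1" by linarith+
      ultimately show "real N \<le> ?L / 2" "?L / 4 \<le> real N" using elim(1) by linarith+
    qed
    \<comment> \<open>Coordinate \<open>a\<close> of the index does not influence the piece; fixing
      it at 0 lets different indices describe different pieces.\<close>
    define Z where "Z = (\<Pi>\<^sub>E i\<in>UNIV. if i = a then {0} else {..<N})"
    have finZ: "finite Z" unfolding Z_def by (intro finite_PiE) auto
    have "card Z = (\<Prod>i\<in>UNIV. if i = a then 1 else N)"
      unfolding Z_def by (subst card_PiE) (auto intro!: prod.cong)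
    also have "\<dots> = N ^ (?d - 1)"
      by (subst prod.remove[of _ a]) (auto simp: card_Diff_singleton)
    finally have cardZ: "card Z = N ^ (?d - 1)" .
    let ?A = "face_box s a (h k)"
    have disj: "disjoint_family_on ?A Z"
      unfolding disjoint_family_on_def
    proof (intro ballI impI)
      fix z z' assume z: "z \<in> Z" "z' \<in> Z" "z \<noteq> z'"
      then obtain i where i: "z i \<noteq> z' i" by blast
      have "i \<noteq> a" using z i by (auto simp: Z_def PiE_iff split: if_splits)
      show "?A z \<inter> ?A z' = {}"
      proof (rule ccontr)
        assume "?A z \<inter> ?A z' \<noteq> {}"
        then obtain x where "x \<in> ?A z" "x \<in> ?A z'" by blast
        then have "real (z i) \<le> real (z' i) + s" "real (z' i) \<le> real (z i) + s"
          using \<open>i \<noteq> a\<close> by (auto simp: mem_face_box intro: order_trans)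
        then have "real (z i) < real (z' i) + 1" "real (z' i) < real (z i) + 1" using s by linarith+
        then show False using i by linarith
      qed
    qed
    have sub: "(\<Union>z\<in>Z. ?A z) \<subseteq> vol_box k"
    proof
      fix x assume "x \<in> (\<Union>z\<in>Z. ?A z)"
      then obtain z where z: "z \<in> Z" "x \<in> ?A z" by blast
      have "\<bar>x $ i\<bar> \<le> ?L / 2" for i
      proof (cases "i = a")
        case True
        then have "h k \<le> x $ i" "x $ i \<le> h k + s" using z by (auto simp: mem_face_box)
        then show ?thesis using h(1)[OF elim(2)] h(2)[of k] by linarith
      next
        case False
        then have "z i < N" using z by (auto simp: Z_def PiE_iff split: if_splits)
        moreover have "real (z i) \<le> x $ i" "x $ i \<le> real (z i) + s" using z False by (auto simp: mem_face_box)
        ultimately show ?thesis using N s by linarith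
      qed
      then show "x \<in> vol_box k" by (simp add: vol_box_def)
    qed
    have "\<delta> / 4 ^ (?d - 1) * k powr ((?d - 1) / ?d) = (?L / 4) ^ (?d - 1) * \<delta>"
      using elim(2) by (simp add: power_divide powr_powr flip: powr_realpow)
    also have "\<dots> \<le> real (card Z) * \<delta>"
      unfolding cardZ of_nat_power using N elim(1) \<open>0 < \<delta>\<close> by (intro mult_right_mono power_mono) auto
    finally have "ennreal (\<delta> / 4 ^ (?d - 1) * k powr ((?d - 1) / ?d)) \<le> of_nat (card Z) * ennreal \<delta>"
      using \<open>0 < \<delta>\<close> by (simp add: ennreal_leI ennreal_of_nat_eq_real_of_nat flip: ennreal_mult)
    also have "\<dots> \<le> down_count (\<Union>z\<in>Z. ?A z) k"
      using ge[OF elim(2)] by (intro down_count_UN_ge finZ disj) auto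
    also have "\<dots> \<le> star_count k" by (rule down_count_mono[OF sub]) simp
    finally show ?case .
  qed
  moreover have "0 < \<delta> / 4 ^ (?d - 1)" using \<open>0 < \<delta>\<close> by simp
  ultimately show ?thesis by blast
qed

text \<open>Nearest neighbours across the face are at distance 1. Pareto marks are taken at least 1
  / \<beta>, which makes the argument of the profile at least 1; for constant marks the edge
  probability is positive because the model is not \<open>edgeless\<close>.\<close>

lemma star_lower_short_lattice:
  assumes "V = Lattice" "1 < \<alpha>" "2 < \<tau>" "\<not> edgeless CARD('d) V \<kappa> \<alpha> \<tau> \<beta>"
  shows "grows_at_least star_count ((CARD('d) - 1) / CARD('d))"
proof -
  obtain a :: 'd where True by blast
  define w where "w = (if \<tau> = \<infinity> then 1 else max 1 (1 / \<beta>))"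
  have w: "1 \<le> w" "\<tau> = \<infinity> \<Longrightarrow> w = 1" "\<tau> \<noteq> \<infinity> \<Longrightarrow> 1 \<le> \<beta> * w"
    using beta_pos by (auto simp: w_def max_def field_simps)
  obtain I J PI PJ where IJ: "I \<in> sets borel" "J \<in> sets borel" "\<forall>u\<in>I. \<forall>v\<in>J. v \<le> u \<and> w \<le> v"
    "0 < PI" "0 < PJ" "PJ \<le> 1"
    "\<forall>i. pr (\<lambda>\<omega>. W i \<omega> \<in> I) = ennreal PI"
    "\<forall>i. pr (\<lambda>\<omega>. W i \<omega> \<in> J) = ennreal PJ"
    "\<tau> = \<infinity> \<longrightarrow> I = {1} \<and> J = {1}"
    using mark_sets_above[OF assms(3) w(1,2)] by blast
  define q where "q = p * (if \<tau> = \<infinity> then profile \<alpha> (\<beta> * kernel_val CARD('d) \<kappa> 1 1) else 1)"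
  have k11: "1 \<le> kernel_val CARD('d) \<kappa> 1 1"
    using kernel_val_ge[of 1 1 "CARD('d)" \<kappa>] sigma_nonneg by simp
  have q: "0 < q" "q \<le> 1"
  proof -
    have "0 < profile \<alpha> (\<beta> * kernel_val CARD('d) \<kappa> 1 1)" if "\<tau> = \<infinity>"
      using assms that beta_pos k11 by (auto simp: profile_def edgeless_def)
    moreover have "profile \<alpha> (\<beta> * kernel_val CARD('d) \<kappa> 1 1) \<le> 1"
    proof -
      have "0 < \<beta> * kernel_val CARD('d) \<kappa> 1 1" using beta_pos k11 by (intro mult_pos_pos) auto
      then have "min 1 (\<beta> * kernel_val CARD('d) \<kappa> 1 1) powr real_of_ereal \<alpha> \<le> 1 powr real_of_ereal \<alpha>"
        using assms(2) by (intro powr_mono2) (cases \<alpha>, auto)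
      then show ?thesis by (simp add: profile_def)
    qed
    moreover have "0 \<le> profile \<alpha> (\<beta> * kernel_val CARD('d) \<kappa> 1 1)" by (simp add: profile_def)
    ultimately show "0 < q" "q \<le> 1"
      using p_pos p_le_1 unfolding q_def by (cases "\<tau> = \<infinity>"; intro mult_pos_pos mult_le_one; simp)+
  qed
  \<comment> \<open>The last integer hyperplane inside the box; the next one lies outside.\<close>
  define H where "H k = real_of_int \<lfloor>k powr (1 / CARD('d)) / 2\<rfloor>" for k :: real
  have single: "face_box 0 a h z = {\<chi> i. if i = a then h else real (z i)}" for h z
    by (simp add: face_box_def)
  have int_point: "{x \<in> face_box 0 a (of_int h) z. \<forall>i. x $ i \<in> \<int>} = {\<chi> i. if i = a then of_int h else real (z i)}" for h :: int and z
    unfolding single by auto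
  have int1: "intensity (face_box 0 a (of_int h) z) = ennreal 1" "pair_intensity (face_box 0 a (of_int h) z) = 0" for h :: int and z
    unfolding lattice_intensity[OF assms(1) face_box_borel face_box_bounded] int_point by simp_all
  show ?thesis
  proof (rule down_count_face_ge[where s=0 and h=H and a=a])
    fix k :: real and z :: "'d \<Rightarrow> nat" assume k: "1 \<le> k"
    let ?L = "k powr (1 / CARD('d))"
    define n where "n = \<lfloor>?L / 2\<rfloor>"
    define n' where "n' = n + 1"
    let ?A = "face_box 0 a (of_int n) z" and ?B = "face_box 0 a (of_int n') z"
    have dist1: "norm (x - y) = 1" if "x \<in> ?A" "y \<in> ?B" for x y
    proof -
      have "y - x = axis a 1"
        using that unfolding single by (auto simp: vec_eq_iff axis_def n'_def)
      then have "norm (y - x) = 1" by (simp add: norm_axis_1)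
      then show ?thesis by (simp only: norm_minus_commute)
    qed
    have "ennreal (1 * 1 * (PI * PJ * q) / 2) \<le> down_count ?A k"
    proof (rule down_count_pair_ge[where B="?B" and I=I and J=J])
      show "?A \<inter> ?B = {}" using dist1 by fastforce
      show "?B \<inter> vol_box k = {}"
      proof -
        have False if "x \<in> ?B" "x \<in> vol_box k" for x
        proof -
          have "\<bar>x $ a\<bar> \<le> ?L / 2" using that(2) unfolding vol_box_def by blast
          moreover have "x $ a = of_int n'" using that(1) by (simp add: single)
          moreover have "?L / 2 < of_int n'" unfolding n'_def n_def by linarith
          ultimately show False by linarith
        qed
        then show ?thesis by blast
      qed
      show "link_prob x y u v = q" if H: "x \<in> ?A" "y \<in> ?B" "u \<in> I" "v \<in> J" for x y u v
      proof (cases "\<tau> = \<infinity>")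
        case True
        then show ?thesis using IJ(9) H dist1[OF H(1,2)] by (simp add: q_def edge_prob_def)
      next
        case False
        have v: "v \<le> u" "w \<le> v" using IJ(3) H by auto
        have "w * 1 \<le> u * v powr sigma_of \<kappa>"
          using v w sigma_nonneg by (intro mult_mono ge_one_powr_ge_zero) auto
        also have "\<dots> \<le> kernel_val CARD('d) \<kappa> u v"
          using v w sigma_nonneg by (intro kernel_val_ge) auto
        finally have "\<beta> * w \<le> \<beta> * kernel_val CARD('d) \<kappa> u v" using beta_pos by simp
        then have "1 \<le> \<beta> * kernel_val CARD('d) \<kappa> u v / norm (x - y) ^ CARD('d)"
          using w(3)[OF False] dist1[OF H(1,2)] by simp
        then show ?thesis using edge_prob_eq_p[OF assms(2)] False by (simp add: q_def)
      qed
    qed (use IJ q int1 face_box_bounded in auto)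
    then show "ennreal (PI * PJ * q / 2) \<le> down_count (face_box 0 a (H k) z) k" by (simp add: H_def n_def)
  next
    fix k :: real assume "1 \<le> k"
    show "- (k powr (1 / CARD('d)) / 2) \<le> H k"
    proof -
      have "0 \<le> H k" by (simp add: H_def)
      moreover have "0 \<le> k powr (1 / CARD('d)) / 2" by simp
      ultimately show ?thesis by linarith
    qed
  next
    show "H k + 0 \<le> k powr (1 / CARD('d)) / 2" for k unfolding H_def by linarith
  qed (use IJ q in auto)
qed

text \<open>The boxes are so small that vertices facing each other are within 3 d s, where the
  argument of the profile is at least 1 for all marks at least one.\<close>

lemma star_lower_short_poisson:
  assumes "V = Poisson" "1 < \<alpha>" "2 < \<tau>"
  shows "grows_at_least star_count ((CARD('d) - 1) / CARD('d))"
proof -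
  let ?d = "CARD('d)"
  obtain a :: 'd where True by blast
  obtain I J PI PJ where IJ: "I \<in> sets borel" "J \<in> sets borel" "\<forall>u\<in>I. \<forall>v\<in>J. v \<le> u \<and> 1 \<le> v"
    "0 < PI" "0 < PJ" "PJ \<le> 1"
    "\<forall>i. pr (\<lambda>\<omega>. W i \<omega> \<in> I) = ennreal PI"
    "\<forall>i. pr (\<lambda>\<omega>. W i \<omega> \<in> J) = ennreal PJ"
    using mark_sets_above[OF assms(3) order_refl refl] by blast
  \<comment> \<open>The second bound gives (3 d s)^d \<le> \<beta>. The first gives s^d \<le> 1 / 2,
    so that the pair intensity (s^d)^2 is at most half of the intensity.\<close>
  define s where "s = min (1 / 2) (\<beta> powr (1 / ?d) / (3 * ?d))"
  have s: "0 < s" "s \<le> 1 / 2" using beta_pos by (auto simp: s_def)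
  have s_beta: "(3 * ?d * s) ^ ?d \<le> \<beta>"
  proof -
    have "s \<le> \<beta> powr (1 / ?d) / (3 * ?d)" by (simp add: s_def)
    then have "3 * ?d * s \<le> \<beta> powr (1 / ?d)" by (simp add: field_simps)
    then have "(3 * ?d * s) ^ ?d \<le> (\<beta> powr (1 / ?d)) ^ ?d" using s by (intro power_mono) auto
    also have "\<dots> = \<beta>" using root_CARD(1)[OF beta_pos] .
    finally show ?thesis .
  qed
  have vol: "emeasure lborel (face_box s a h z) = ennreal (s ^ ?d)" for h z
    unfolding face_box_def using s by (subst emeasure_lborel_cbox_cart) auto
  have vol_pos: "0 < emeasure lborel (face_box s a h z)" for h z unfolding vol using s by simp
  note int = poisson_intensity[OF assms(1) face_box_borel face_box_bounded vol_pos, unfolded vol]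
  have sd: "0 < s ^ ?d" "s ^ ?d \<le> 1 / 2"
  proof -
    have "s ^ ?d \<le> s ^ 1" using s by (intro power_decreasing) (auto simp: Suc_leI)
    then show "0 < s ^ ?d" "s ^ ?d \<le> 1 / 2" using s by auto
  qed
  show ?thesis
  proof (rule down_count_face_ge[where s=s and h="\<lambda>k. k powr (1 / ?d) / 2 - s" and a=a])
    fix k :: real and z :: "'d \<Rightarrow> nat" assume k: "1 \<le> k"
    let ?L = "k powr (1 / ?d)"
    \<comment> \<open>A gap \<open>s\<close> separates the boxes and excludes distance zero, where
      division would return 0.\<close>
    let ?A = "face_box s a (?L / 2 - s) z" and ?B = "face_box s a (?L / 2 + s) z"
    have "ennreal (s ^ ?d * s ^ ?d * (PI * PJ * p) / 2) \<le> down_count ?A k"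
    proof (rule down_count_pair_ge[where B="?B" and I=I and J=J])
      show "?A \<inter> ?B = {}" using s by (auto simp: mem_face_box)
      show "?B \<inter> vol_box k = {}"
      proof -
        have False if "x \<in> ?B" "x \<in> vol_box k" for x
        proof -
          have "?L / 2 + s \<le> x $ a" "\<bar>x $ a\<bar> \<le> ?L / 2" using that by (auto simp: mem_face_box vol_box_def)
          then show False using s by linarith
        qed
        then show ?thesis by blast
      qed
      show "link_prob x y u v = p" if H: "x \<in> ?A" "y \<in> ?B" "u \<in> I" "v \<in> J" for x y u v
      proof (rule edge_prob_eq_p[OF assms(2)])
        have v: "v \<le> u" "1 \<le> v" using IJ(3) H by auto
        have "1 * 1 \<le> u * v powr sigma_of \<kappa>"
          using v sigma_nonneg by (intro mult_mono ge_one_powr_ge_zero) auto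
        also have "\<dots> \<le> kernel_val ?d \<kappa> u v"
          using v sigma_nonneg by (intro kernel_val_ge) auto
        finally have K: "\<beta> \<le> \<beta> * kernel_val ?d \<kappa> u v" using beta_pos by simp
        have "\<bar>(x - y) $ i\<bar> \<le> 3 * s" for i
        proof (cases "i = a")
          case True
          then have "?L / 2 - s \<le> x $ i" "x $ i \<le> ?L / 2 - s + s" "?L / 2 + s \<le> y $ i" "y $ i \<le> ?L / 2 + s + s"
            using H by (auto simp: mem_face_box)
          then show ?thesis unfolding vector_minus_component by linarith
        next
          case False
          then have "real (z i) \<le> x $ i" "x $ i \<le> real (z i) + s" "real (z i) \<le> y $ i" "y $ i \<le> real (z i) + s"
            using H by (auto simp: mem_face_box)
          then show ?thesis unfolding vector_minus_component using s by linarith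
        qed
        then have "(\<Sum>i\<in>UNIV. \<bar>(x - y) $ i\<bar>) \<le> of_nat (card (UNIV :: 'd set)) * (3 * s)"
          by (intro sum_bounded_above) auto
        then have "norm (x - y) \<le> 3 * ?d * s" using norm_le_l1_cart[of "x - y"] by (simp add: mult_ac)
        then have "norm (x - y) ^ ?d \<le> (3 * ?d * s) ^ ?d" by (intro power_mono) auto
        then have le: "norm (x - y) ^ ?d \<le> \<beta> * kernel_val ?d \<kappa> u v" using s_beta K by linarith
        have "x \<noteq> y" using H s by (auto simp: mem_face_box)
        then have "0 < norm (x - y) ^ ?d" by simp
        with le show "1 \<le> \<beta> * kernel_val ?d \<kappa> u v / norm (x - y) ^ ?d" by (simp add: le_divide_eq)
      qed
      show "pair_intensity ?B \<le> ennreal (s ^ ?d / 2)"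
      proof -
        have "pair_intensity ?B = ennreal (s ^ ?d * s ^ ?d)"
          using sd by (simp add: int power2_eq_square ennreal_mult)
        also have "\<dots> \<le> ennreal (s ^ ?d / 2)"
          using sd mult_left_mono[of "s ^ ?d" "1 / 2" "s ^ ?d"] by (intro ennreal_leI) auto
        finally show ?thesis .
      qed
    qed (use IJ p_pos p_le_1 int sd face_box_bounded in auto)
    then show "ennreal (s ^ ?d * s ^ ?d * (PI * PJ * p) / 2) \<le> down_count (face_box s a (?L / 2 - s) z) k" .
  next
    fix k :: real assume "1 \<le> k"
    then have "1 \<le> k powr (1 / ?d)" by (simp add: ge_one_powr_ge_zero)
    then show "- (k powr (1 / ?d) / 2) \<le> k powr (1 / ?d) / 2 - s" using s by linarith
  qed (use s IJ p_pos sd in auto)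
qed

text \<open>Distinct lattice points are at distance at least one, where the threshold profile
  vanishes; each edge is then a null event, and there are countably many.\<close>

lemma edgeless_down_count:
  assumes "edgeless CARD('d) V \<kappa> \<alpha> \<tau> \<beta>"
  shows "down_count A k = 0"
proof -
  have e: "V = Lattice" "\<alpha> = \<infinity>" "\<tau> = \<infinity>" "\<beta> * kernel_val CARD('d) \<kappa> 1 1 < 1"
    using assms by (auto simp: edgeless_def)
  obtain z where z: "bij_betw z UNIV {x :: real^'d. \<forall>a. x $ a \<in> \<int>}"
    "\<And>i \<omega>. \<omega> \<in> space M \<Longrightarrow> X i \<omega> = z i"
    using lattice_obtain[OF e(1)] by blast
  have no_edge: "AE \<omega> in M. \<not> E i j \<omega>" for i j
  proof (cases "i = j")
    case False
    have "pr (\<lambda>\<omega>. True \<and> E i j \<omega>) = (\<integral>\<^sup>+\<omega>. of_bool True *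
        ennreal (link_prob_at i j \<omega>) \<partial>M)"
      by (rule emeasure_edge[where Q="\<lambda>_ _. True", OF _ False]) simp
    also have "\<dots> = (\<integral>\<^sup>+\<omega>. 0 \<partial>M)"
    proof (rule nn_integral_cong_AE)
      show "AE \<omega> in M. of_bool True * ennreal (link_prob_at i j \<omega>) = 0"
        using W_const[OF e(3), of i] W_const[OF e(3), of j] AE_space
      proof eventually_elim
        case (elim \<omega>)
        have "z i \<noteq> z j" using z(1) False by (auto simp: bij_betw_def inj_on_def)
        then obtain b where b: "z i $ b \<noteq> z j $ b" by (auto simp: vec_eq_iff)
        have "z i $ b - z j $ b \<in> \<int>" using z(1) by (intro Ints_diff) (auto simp: bij_betw_def)
        then have "1 \<le> \<bar>(z i - z j) $ b\<bar>" using Ints_nonzero_abs_ge1[of "z i $ b - z j $ b"] b by simp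
        also have "\<dots> \<le> norm (z i - z j)" by (rule component_le_norm_cart)
        finally have "1 \<le> norm (z i - z j) ^ CARD('d)" by simp
        moreover have "0 \<le> \<beta> * kernel_val CARD('d) \<kappa> 1 1"
          using beta_pos kernel_val_ge[of 1 1 "CARD('d)" \<kappa>] sigma_nonneg by simp
        ultimately have "\<beta> * kernel_val CARD('d) \<kappa> 1 1 / norm (z i - z j) ^ CARD('d) \<le> \<beta> * kernel_val CARD('d) \<kappa> 1 1 / 1"
          by (intro divide_left_mono) auto
        then have "\<beta> * kernel_val CARD('d) \<kappa> 1 1 / norm (z i - z j) ^ CARD('d) < 1" using e(4) by simp
        then show ?case using elim z(2) e(2) by (simp add: edge_prob_def profile_def)
      qed
    qed
    finally have "pr (\<lambda>\<omega>. E i j \<omega>) = 0" by simp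
    then show ?thesis by (subst AE_iff_measurable[OF _ refl]) auto
  qed (simp add: E_irrefl)
  have "pr (\<lambda>\<omega>. X i \<omega> \<in> A \<and> down_edge_out X W E k \<omega> i) = 0" for i
  proof -
    have "AE \<omega> in M. \<forall>j. \<not> E i j \<omega>" using no_edge by (simp add: AE_all_countable)
    then have "AE \<omega> in M. \<not> (X i \<omega> \<in> A \<and> down_edge_out X W E k \<omega> i)"
      by eventually_elim (auto simp: down_edge_out_def)
    then show ?thesis by (rule emeasure_eq_0_AE)
  qed
  then show ?thesis by (simp add: down_count_def)
qed

section \<open>Limits\<close>

text \<open>Needed for the maximum with 0 to be a real number, to which the growth criteria
  apply.\<close>

lemma zeta_bounded:
  assumes "1 < \<alpha>" "2 < \<tau>"
  shows "zeta_ll \<alpha> < \<infinity>" "zeta_hl \<alpha> \<tau> < \<infinity>" "zeta_hh \<alpha> \<tau> (sigma_of \<kappa>) < \<infinity>"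
proof -
  show "zeta_ll \<alpha> < \<infinity>" using assms(1) by (cases \<alpha>) (auto simp: zeta_ll_ereal)
  show "zeta_hl \<alpha> \<tau> < \<infinity>" using assms by (cases \<alpha>; cases \<tau>) (auto simp: zeta_hl_ereal)
  show "zeta_hh \<alpha> \<tau> (sigma_of \<kappa>) < \<infinity>"
  proof (cases "\<tau> = \<infinity> \<or> \<alpha> = \<infinity>")
    case True
    then show ?thesis using assms sigma_nonneg by (cases \<tau>) (auto simp: zeta_hh_ereal)
  next
    case False
    then obtain a t where a: "\<alpha> = ereal a" "\<tau> = ereal t" "1 < a" "2 < t"
      using assms by (cases \<alpha>; cases \<tau>) auto
    then have "(t - 1) / a < t - 1" by (simp add: divide_simps)
    then show ?thesis using a sigma_nonneg
      by (cases "t \<le> sigma_of \<kappa> + 2") (simp_all add: zeta_hh_ereal)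
  qed
qed

text \<open>Without edges every count is zero and the star ratio is -\<infinity>, although the
  maximum is at least 0; hence the case distinction. The long ratio is cut at 0 and converges to z =
  0 in that case.\<close>

lemma ratio_limits:
  assumes "1 < \<alpha>" "2 < \<tau>"
  obtains z where "ereal z = Max {zeta_ll \<alpha>, zeta_hl \<alpha> \<tau>, zeta_hh \<alpha> \<tau> (sigma_of \<kappa>), 0}"
    "(long_ratio M X W E \<longlongrightarrow> ereal z) at_top"
    "(star_ratio M X W E \<longlongrightarrow> (if edgeless CARD('d) V \<kappa> \<alpha> \<tau> \<beta> then -\<infinity>
       else max (ereal z) (zeta_short CARD('d)))) at_top"
proof -
  let ?Z = "{zeta_ll \<alpha>, zeta_hl \<alpha> \<tau>, zeta_hh \<alpha> \<tau> (sigma_of \<kappa>), 0}"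
  have "Max ?Z < \<infinity>" using zeta_bounded[OF assms] by (subst Max_less_iff) auto
  moreover have "0 \<le> Max ?Z" by (rule Max_ge) auto
  ultimately obtain z where z: "Max ?Z = ereal z" "0 \<le> z"
    by (cases "Max ?Z") auto
  have le_z: "zeta_ll \<alpha> \<le> ereal z" "zeta_hl \<alpha> \<tau> \<le> ereal z" "zeta_hh \<alpha> \<tau> (sigma_of \<kappa>) \<le> ereal z"
    unfolding z(1)[symmetric] by (rule Max_ge; simp)+
  have lt: "zeta_ll \<alpha> < ereal \<eta>" "zeta_hl \<alpha> \<tau> < ereal \<eta>" "zeta_hh \<alpha> \<tau> (sigma_of \<kappa>) < ereal \<eta>" if "z < \<eta>" for \<eta>
    using le_z that by (auto intro: le_less_trans)
  have long_lower: "grows_at_least long_count \<eta>"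
    if pos: "0 < z" and less: "\<eta> < z" for \<eta>
  proof -
    \<comment> \<open>A positive maximum is attained by one of the three exponents, which selects
      the lower bound to use.\<close>
    have "Max ?Z \<in> ?Z" by (rule Max_in) auto
    then consider "zeta_ll \<alpha> = ereal z" | "zeta_hl \<alpha> \<tau> = ereal z" | "zeta_hh \<alpha> \<tau> (sigma_of \<kappa>) = ereal z"
      unfolding z(1) using pos by (auto simp: zero_ereal_def)
    then show ?thesis
      by cases (use pos less long_lower_ll[OF assms] long_lower_hl[OF assms] long_lower_hh[OF assms] in auto)
  qed
  have "long_ratio M X W E = (\<lambda>k. max 0 (ln_ext (long_count k) / ereal (ln k)))"
    by (simp add: long_ratio_def[abs_def] expected_down_out_eq)
  moreover have "((\<lambda>k. max 0 (ln_ext (long_count k) / ereal (ln k))) \<longlongrightarrow> ereal z) at_top"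
  proof (rule max_0_ln_ext_ratio_tendsto[OF z(2)])
    show "grows_at_most long_count \<eta>" if "z < \<eta>" for \<eta>
      using z(2) that by (intro long_upper assms lt) auto
  qed (rule long_lower)
  ultimately have long: "(long_ratio M X W E \<longlongrightarrow> ereal z) at_top" by simp
  have star_eq: "star_ratio M X W E = (\<lambda>k. ln_ext (star_count k) / ereal (ln k))"
    by (simp add: star_ratio_def[abs_def] expected_down_out_eq)
  have "(star_ratio M X W E \<longlongrightarrow> (if edgeless CARD('d) V \<kappa> \<alpha> \<tau> \<beta> then -\<infinity>
       else max (ereal z) (zeta_short CARD('d)))) at_top"
  proof (cases "edgeless CARD('d) V \<kappa> \<alpha> \<tau> \<beta>")
    case True
    have "eventually (\<lambda>k. star_ratio M X W E k = -\<infinity>) at_top"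
      using eventually_gt_at_top[of 1]
    proof eventually_elim
      case (elim k)
      then show ?case unfolding star_eq edgeless_down_count[OF True] by (simp add: ln_ext_def)
    qed
    then show ?thesis using True by (simp add: tendsto_eventually)
  next
    case False
    define y where "y = (real CARD('d) - 1) / CARD('d)"
    have short: "grows_at_least star_count y"
      using star_lower_short_lattice[OF _ assms False] star_lower_short_poisson[OF _ assms]
      by (cases V) (auto simp: y_def of_nat_diff Suc_leI)
    have y0: "0 \<le> y" by (simp add: y_def Suc_leI)
    have "((\<lambda>k. ln_ext (star_count k) / ereal (ln k)) \<longlongrightarrow> ereal (max z y)) at_top"
    proof (rule ln_ext_ratio_tendsto)
      fix \<eta> assume "max z y < \<eta>"
      then show "grows_at_most star_count \<eta>"
        using z(2) by (intro star_upper assms lt) (auto simp: zeta_short_def y_def)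
    next
      fix \<eta> assume \<eta>: "\<eta> < max z y"
      show "grows_at_least star_count \<eta>"
      proof (cases "\<eta> < y")
        case True
        then show ?thesis using eventually_powr_lower_mono[OF short] by simp
      next
        case False
        \<comment> \<open>Here y \<le> \<eta> < z, so long edges alone provide the growth; y \<ge> 0
          gives the positivity of z that their lower bound asks for.\<close>
        then have "\<eta> < z" "0 < z" using \<eta> y0 by auto
        then obtain c where c: "0 < c" "eventually (\<lambda>k. ennreal (c * k powr \<eta>) \<le> long_count k) at_top"
          using long_lower by blast
        have "eventually (\<lambda>k. ennreal (c * k powr \<eta>) \<le> star_count k) at_top"
          using c(2) eventually_gt_at_top[of 0]
        proof eventually_elim
          case (elim k)
          show ?case using elim(1) long_count_le_star_count[OF elim(2)] by (rule order_trans)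
        qed
        with c(1) show ?thesis by blast
      qed
    qed
    moreover have "max (ereal z) (zeta_short CARD('d)) = ereal (max z y)"
      by (simp add: zeta_short_def y_def max_def)
    ultimately show ?thesis by (simp only: star_eq if_not_P[OF False])
  qed
  with long z(1) that show ?thesis by metis
qed

end

theorem claim1p4:
  fixes M :: "'w measure"
    and V :: vertex_model and \<kappa> :: kernel and \<alpha> \<tau> :: ereal and \<beta> p :: real
    and X :: "nat \<Rightarrow> 'w \<Rightarrow> real^'d"
    and W :: "nat \<Rightarrow> 'w \<Rightarrow> real"
    and E :: "nat \<Rightarrow> nat \<Rightarrow> 'w \<Rightarrow> bool"
  assumes "ksrg M V \<kappa> \<alpha> \<tau> \<beta> p X W E"
    and "1 < \<alpha>" and "2 < \<tau>"
  shows "(star_ratio M X W E \<longlongrightarrow> zeta_star M X W E) at_top \<and>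
         (long_ratio M X W E \<longlongrightarrow> zeta_long M X W E) at_top \<and>
         (\<not> edgeless CARD('d) V \<kappa> \<alpha> \<tau> \<beta> \<longrightarrow>
            zeta_star M X W E = max (zeta_long M X W E) (zeta_short CARD('d))) \<and>
         zeta_long M X W E =
           Max {zeta_ll \<alpha>, zeta_hl \<alpha> \<tau>, zeta_hh \<alpha> \<tau> (sigma_of \<kappa>), 0}"
proof -
  interpret ksrg M V \<kappa> \<alpha> \<tau> \<beta> p X W E by fact
  obtain z where z: "ereal z = Max {zeta_ll \<alpha>, zeta_hl \<alpha> \<tau>, zeta_hh \<alpha> \<tau> (sigma_of \<kappa>), 0}"
    and long: "(long_ratio M X W E \<longlongrightarrow> ereal z) at_top"
    and star: "(star_ratio M X W E \<longlongrightarrow> (if edgeless CARD('d) V \<kappa> \<alpha> \<tau> \<beta> then -\<infinity>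
       else max (ereal z) (zeta_short CARD('d)))) at_top"
    by (rule ratio_limits[OF assms(2,3)])
  have "zeta_long M X W E = ereal z" "zeta_star M X W E = (if edgeless CARD('d) V \<kappa> \<alpha> \<tau> \<beta> then -\<infinity>
       else max (ereal z) (zeta_short CARD('d)))"
    unfolding zeta_long_def zeta_star_def using tendsto_Lim[OF _ long] tendsto_Lim[OF _ star] by auto
  with z long star show ?thesis by simp
qed

end
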